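(* Let $d\ge1$ and let $E$ be a finite-dimensional normed space. For every $\alpha\in(0,1]$, $\Omega^1_\alpha$ is continuously embedded in $\Omega^1_{\mathcal C^{\alpha-1}}$; that is, the natural map sending a bounded measurable $E$-valued 1-form $A$ on $\mathbf T^d$ with $|A|_\alpha<\infty$ to the (distributional) 1-form it defines extends to an injective continuous linear map $(\Omega^1_\alpha,|\cdot|_\alpha)\to(\Omega^1_{\mathcal C^{\alpha-1}},|\cdot|_{\mathcal C^{\alpha-1}})$.
   Context: **Segments.** $\mathbf T^d=\mathbb R^d/\mathbb Z^d$ with geodesic metric $|x-y|$. An axis line segment is a set $\ell=\{x+ce_\mu:c\in[0,\lambda]\}\subset\mathbf T^d$ with $x\in\mathbf T^d$, $\mu\in\{1,\dots,d\}$, $\lambda\in[0,1]$; $|\ell|:=\lambda$, and if $|\ell|>0$ the direction of $\ell$ is $\mu$. $\mathcal X$ is the set of axis line segments. With $\pi_\mu:\mathbf T^d\to\mathbf T$ the projection on the $\mu$-th coordinate, $\ell,\bar\ell$ are parallel if they have the same direction $\mu$ and $\pi_\mu\ell=\pi_\mu\bar\ell$; then $\rho(\ell,\bar\ell)=|\ell|^{1/2}d(\ell,\bar\ell)^{1/2}$, $d(\ell,\bar\ell)=\inf\{|x-y|:x\in\ell,y\in\bar\ell\}$. $\ell,\bar\ell$ are joinable if $\ell\cup\bar\ell\in\mathcal X$ and $|\ell\cup\bar\ell|=|\ell|+|\bar\ell|$. $\Omega$ is the space of $A:\mathcal X\to E$ with $A(\ell\cup\bar\ell)=A(\ell)+A(\bar\ell)$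 for joinable $\ell,\bar\ell$. **Norms.** $|A|_{\alpha\text{-gr}}=\sup_{|\ell|>0}|A(\ell)|/|\ell|^\alpha$; $|A|_{\alpha;\rho}=\sup|A(\ell)-A(\bar\ell)|/\rho(\ell,\bar\ell)^\alpha$ over distinct parallel $\ell,\bar\ell$; $|A|_\alpha=|A|_{\alpha\text{-gr}}+|A|_{\alpha;\rho}$; $\Omega_\alpha=\{A\in\Omega:|A|_\alpha<\infty\}$ with norm $|\cdot|_\alpha$. **1-forms.** $\Omega^1$ is the space of bounded measurable $E$-valued 1-forms $A=\sum_{\mu=1}^dA_\mu\,dx_\mu$ on $\mathbf T^d$, each treated as an element of $\Omega$ via $A(\{x+ce_\mu:c\in[0,\lambda]\})=\int_0^\lambda A_\mu(x+ce_\mu)\,dc$. $\Omega^1_\alpha$ is the closure of $\{A\in\Omega^1:|A|_\alpha<\infty\}$ in $\Omega_\alpha$, with norm $|\cdot|_\alpha$. (Elements of this set inducing the same function on $\mathcal X$ are identified; this is the same as identifying them when they agree a.e.) **Hölder--Besov spaces.** For $\beta<0$ let $r=-\lfloor\beta\rfloor$ and let $\mathcal B^r$ be the set of $\psi\in C^\infty(\mathbb R^d)$ with $|\psi|_{\mathcal C^r}\le1$ and support in $B(0,1/4)$, where $\mathcal C^r$ is the space of $(r-1)$-times differentiable functions with Lipschitz $(r-1)$-th derivative. For $\lambda\in(0,1]$, $\psi^\lambda(y)=\lambda^{-d}\psi(\lambda^{-1}y)$, viewed as a function on $\mathbf T^d$, and $\psi^\lambda_x(y)=\psi^\lambda(y-x)$.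 $\mathcal C^\beta(\mathbf T^d,E)$ is the space of distributions $\xi\in\mathcal D'(\mathbf T^d,E)$ with $|\xi|_{\mathcal C^\beta}=\sup_{\lambda\in(0,1]}\sup_{\psi\in\mathcal B^r}\sup_{x\in\mathbf T^d}|\langle\xi,\psi^\lambda_x\rangle|/\lambda^\beta<\infty$. $\Omega^1_{\mathcal C^\beta}$ is the space of distributional 1-forms $A=\sum_\mu A_\mu dx_\mu$ with $|A|_{\mathcal C^\beta}=\sum_\mu|A_\mu|_{\mathcal C^\beta}<\infty$. For $\beta=0$, $\Omega^1_{\mathcal C^0}$ is the space of $L^\infty$ $E$-valued 1-forms with norm $|A|_{\mathcal C^0}=\sum_\mu|A_\mu|_{L^\infty}$. *)

theory Defs
  imports "HOL-Probability.Essential_Supremum"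
begin

definition lattice_rel :: "real^'d \<Rightarrow> real^'d \<Rightarrow> bool" where
  "lattice_rel x y \<longleftrightarrow> (\<forall>i. x $ i - y $ i \<in> \<int>)"

quotient_type 'd torus = "real^'d::finite" / lattice_rel
  morphisms rep_torus to_torus
proof (rule equivpI)
  show "reflp lattice_rel" by (auto simp: reflp_def lattice_rel_def)
  show "symp lattice_rel"
    unfolding symp_def lattice_rel_def by (metis Ints_minus minus_diff_eq)
  show "transp lattice_rel"
    unfolding transp_def lattice_rel_def
    by (metis Ints_add add_diff_eq diff_add_cancel)
qed

instantiation torus :: (finite) ab_group_add
begin

lift_definition zero_torus :: "'a torus" is "0 :: real^'a" .

lift_definition plus_torus :: "'a torus \<Rightarrow> 'a torus \<Rightarrow> 'a torus"
  is "(+) :: real^'a \<Rightarrow> _"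
  unfolding lattice_rel_def
  by (simp add: add_diff_add Ints_add)

lift_definition uminus_torus :: "'a torus \<Rightarrow> 'a torus"
  is "uminus :: real^'a \<Rightarrow> _"
  unfolding lattice_rel_def
  by (metis Ints_minus minus_diff_eq minus_diff_minus vector_uminus_component)

lift_definition minus_torus :: "'a torus \<Rightarrow> 'a torus \<Rightarrow> 'a torus"
  is "(-) :: real^'a \<Rightarrow> _"
  unfolding lattice_rel_def
proof (intro allI)
  fix x x' y y' :: "real^'a" and i
  assume "\<forall>i. x $ i - x' $ i \<in> \<int>" "\<forall>i. y $ i - y' $ i \<in> \<int>"
  then have "(x $ i - x' $ i) - (y $ i - y' $ i) \<in> \<int>" by (blast intro: Ints_diff)
  then show "(x - y) $ i - (x' - y') $ i \<in> \<int>" by (simp add: algebra_simps)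
qed

instance
proof
  fix a b c :: "'a torus"
  show "a + b + c = a + (b + c)" by transfer (simp add: lattice_rel_def)
  show "a + b = b + a" by transfer (simp add: lattice_rel_def)
  show "0 + a = a" by transfer (simp add: lattice_rel_def)
  show "- a + a = 0" by transfer (simp add: lattice_rel_def)
  show "a - b = a + - b" by transfer (simp add: lattice_rel_def)
qed

end

lemma to_torus_eq_iff: "to_torus x = to_torus y \<longleftrightarrow> lattice_rel x y"
  by (simp add: torus.abs_eq_iff)

lemma ex_to_torus: "\<exists>x. p = to_torus x"
  by (metis Quotient_abs_rep Quotient_torus)

lemma to_torus_add: "to_torus x + to_torus y = to_torus (x + y)"
  by (simp add: plus_torus.abs_eq)

lemma to_torus_diff: "to_torus x - to_torus y = to_torus (x - y)"
  by (simp add: minus_torus.abs_eq)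

text \<open>The geodesic metric is the quotient of the Euclidean one.\<close>

instantiation torus :: (finite) metric_space
begin

definition dist_torus :: "'a torus \<Rightarrow> 'a torus \<Rightarrow> real" where
  "dist_torus p q = Inf {dist x y | x y. to_torus x = p \<and> to_torus y = q}"

definition uniformity_torus :: "('a torus \<times> 'a torus) filter" where
  "uniformity_torus = (INF e\<in>{0<..}. principal {(x, y). dist x y < e})"

definition open_torus :: "'a torus set \<Rightarrow> bool" where
  "open_torus U \<longleftrightarrow> (\<forall>x\<in>U. \<forall>\<^sub>F (x', y) in uniformity. x' = x \<longrightarrow> y \<in> U)"

instance
proof
  show "uniformity = (INF e\<in>{0<..}. principal {(x::'a torus, y). dist x y < e})"
    by (rule uniformity_torus_def)
  show "open U \<longleftrightarrow> (\<forall>x\<in>U. \<forall>\<^sub>F (x', y) in uniformity. x' = x \<longrightarrow> y \<in> U)" for U :: "'a torus set"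
    by (rule open_torus_def)
next
  have lower: "dist p q \<le> dist x y" if "to_torus x = p" "to_torus y = q" for p q :: "'a torus" and x y
    unfolding dist_torus_def
    by (rule cInf_lower) (use that in \<open>auto intro!: bdd_belowI[of _ 0]\<close>)
  have approx: "\<exists>x. to_torus x = p \<and> dist x y < dist p q + e"
    if e: "e > 0" and q: "to_torus y = q" for p q :: "'a torus" and y e
  proof -
    have "{dist x y | x y. to_torus x = p \<and> to_torus y = q} \<noteq> {}"
      using ex_to_torus[of p] ex_to_torus[of q] by auto
    then obtain x z where xz: "to_torus x = p" "to_torus z = q" "dist x z < dist p q + e"
      using cInf_lessD[of "{dist x y | x y. to_torus x = p \<and> to_torus y = q}" "dist p q + e"] e
      unfolding dist_torus_def[of p q, symmetric] by fastforce
    have "to_torus (x + (y - z)) = p + (q - q)"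
      by (simp add: to_torus_add[symmetric] to_torus_diff[symmetric] xz q)
    moreover have "dist (x + (y - z)) y = dist x z"
      by (simp add: dist_norm algebra_simps)
    ultimately show ?thesis using xz by (intro exI[of _ "x + (y - z)"]) simp
  qed
  fix p q r :: "'a torus"
  show "dist p q \<le> dist p r + dist q r"
  proof (rule field_le_epsilon)
    fix e :: real assume "e > 0"
    obtain z where z: "to_torus z = r" using ex_to_torus by metis
    obtain x where x: "to_torus x = p" "dist x z < dist p r + e/2"
      using approx[of "e/2" z r p] z \<open>e > 0\<close> by auto
    obtain y where y: "to_torus y = q" "dist y z < dist q r + e/2"
      using approx[of "e/2" z r q] z \<open>e > 0\<close> by auto
    have "dist p q \<le> dist x y" using lower x y by blast
    also have "\<dots> \<le> dist x z + dist y z" by (rule dist_triangle2)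
    finally show "dist p q \<le> dist p r + dist q r + e" using x y by simp
  qed
  show "dist p q = 0 \<longleftrightarrow> p = q"
  proof
    assume "p = q"
    obtain x where "to_torus x = p" using ex_to_torus by metis
    then have "dist p q \<le> 0" using lower[of x p x q] \<open>p = q\<close> by simp
    moreover have "dist p q \<ge> 0"
      unfolding dist_torus_def
      by (rule cInf_greatest) (use ex_to_torus[of p] ex_to_torus[of q] in auto)
    ultimately show "dist p q = 0" by simp
  next
    assume d: "dist p q = 0"
    obtain y where y: "to_torus y = q" using ex_to_torus by metis
    obtain x where x: "to_torus x = p" "dist x y < 1/2" using approx[of "1/2" y q p] d y by auto
    have "dist x y \<le> e" if e: "e > 0" for e
    proof -
      obtain x' where x': "to_torus x' = p" "dist x' y < min e (1/2)"
        using approx[of "min e (1/2)" y q p] d y e by auto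
      have "x $ i = x' $ i" for i
      proof -
        have "x $ i - x' $ i \<in> \<int>"
          using x(1) x'(1) to_torus_eq_iff[of x x'] by (simp add: lattice_rel_def)
        moreover have "\<bar>x $ i - x' $ i\<bar> < 1"
        proof -
          have "dist x x' \<le> dist x y + dist x' y" by (rule dist_triangle2)
          then show ?thesis
            using component_le_norm_cart[of "x - x'" i] x x' by (simp add: dist_norm)
        qed
        ultimately show ?thesis using Ints_nonzero_abs_less1[of "x $ i - x' $ i"] by auto
      qed
      then have "x = x'" by (simp add: vec_eq_iff)
      then show ?thesis using x' by simp
    qed
    then have "dist x y \<le> 0" by (meson dense_ge)
    then show "p = q" using x y by simp
  qed
qed

end

lemma dist_to_torus_le: "dist (to_torus x) (to_torus y) \<le> dist x y"
  unfolding dist_torus_def by (rule cInf_lower) (auto intro!: bdd_belowI[of _ 0])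

lemma continuous_on_line:
  "continuous_on UNIV (\<lambda>c. p + to_torus (c *\<^sub>R v))" for p :: "'d::finite torus"
proof -
  obtain x where x: "p = to_torus x" using ex_to_torus by blast
  have "continuous_on UNIV (to_torus :: real^'d \<Rightarrow> _)"
    unfolding continuous_on_iff using dist_to_torus_le le_less_trans by blast
  moreover have "continuous_on UNIV (\<lambda>c. x + c *\<^sub>R v)" by (intro continuous_intros)
  ultimately have "continuous_on UNIV (\<lambda>c. to_torus (x + c *\<^sub>R v))"
    using continuous_on_compose2 by blast
  then show ?thesis by (simp add: x to_torus_add)
qed

lemma to_torus_borel_measurable: "to_torus \<in> borel \<rightarrow>\<^sub>M borel"
  by (intro borel_measurable_continuous_onI)
     (use dist_to_torus_le le_less_trans in \<open>auto simp: continuous_on_iff, blast\<close>)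

definition torus_measure :: "'d::finite torus measure" where
  "torus_measure = distr (restrict_space lborel {x. \<forall>i. 0 \<le> x $ i \<and> x $ i < 1}) borel to_torus"

text \<open>The one-dimensional torus is \<open>1 torus\<close>, with \<open>1\<close> the one-element index type.\<close>

lift_definition torus_coord :: "'d::finite \<Rightarrow> 'd torus \<Rightarrow> 1 torus"
  is "\<lambda>\<mu> x. (\<chi> _. x $ \<mu>)"
  by (simp add: lattice_rel_def)

definition seg :: "'d::finite torus \<Rightarrow> 'd \<Rightarrow> real \<Rightarrow> 'd torus set" where
  "seg x \<mu> l = (\<lambda>c. x + to_torus (c *\<^sub>R axis \<mu> 1)) ` {0..l}"

definition segments :: "'d::finite torus set set" where
  "segments = {seg x \<mu> l | x \<mu> l. 0 \<le> l \<and> l \<le> 1}"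

definition seg_length :: "'d::finite torus set \<Rightarrow> real" where
  "seg_length L = (THE l. 0 \<le> l \<and> l \<le> 1 \<and> (\<exists>x \<mu>. L = seg x \<mu> l))"

definition has_direction :: "'d::finite torus set \<Rightarrow> 'd \<Rightarrow> bool" where
  "has_direction L \<mu> \<longleftrightarrow> (\<exists>x l. 0 < l \<and> l \<le> 1 \<and> L = seg x \<mu> l)"

lemma seg_eq_seg:
  fixes x y :: "'d::finite torus"
  assumes l: "0 \<le> l" "l < 1" "0 \<le> l'" "l' \<le> 1" and eq: "seg x \<mu> l = seg y \<nu> l'"
  shows "l = l' \<and> x = y \<and> (l > 0 \<longrightarrow> \<mu> = \<nu>)"
proof -
  have y_in: "y \<in> seg y \<nu> l'"
    using l unfolding seg_def
    by (intro image_eqI[of _ _ 0]) (auto simp: zero_torus.abs_eq[symmetric])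
  then obtain c where c: "0 \<le> c" "c \<le> l" and y: "y = x + to_torus (c *\<^sub>R axis \<mu> 1)"
    unfolding eq[symmetric] by (auto simp: seg_def)
  have rel: "(x + to_torus (s *\<^sub>R axis \<mu> 1) = y + to_torus (t *\<^sub>R axis \<nu> 1)) \<longleftrightarrow>
      (\<forall>i. s * (if i = \<mu> then 1 else 0) - (c * (if i = \<mu> then 1 else 0) + t * (if i = \<nu> then 1 else 0)) \<in> \<int>)"
    for s t
    unfolding y add.assoc to_torus_add
    by (simp add: to_torus_eq_iff lattice_rel_def axis_def)
  have fwd: "\<exists>t\<in>{0..l'}. x + to_torus (s *\<^sub>R axis \<mu> 1) = y + to_torus (t *\<^sub>R axis \<nu> 1)"
    if "s \<in> {0..l}" for s
    using eq that unfolding seg_def by (metis (no_types, lifting) image_iff)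
  have bwd: "\<exists>s\<in>{0..l}. x + to_torus (s *\<^sub>R axis \<mu> 1) = y + to_torus (t *\<^sub>R axis \<nu> 1)"
    if "t \<in> {0..l'}" for t
    using eq that unfolding seg_def by (metis (no_types, lifting) image_iff)
  have small: "a = 0" if "a \<in> \<int>" "-1 < a" "a < 1" for a :: real
    using Ints_nonzero_abs_less1[of a] that by auto
  show ?thesis
  proof (cases "l' = 0")
    case True
    have "l = 0"
    proof (rule ccontr)
      assume "l \<noteq> 0"
      obtain t where t: "t \<in> {0..l'}"
        "x + to_torus (0 *\<^sub>R axis \<mu> 1) = y + to_torus (t *\<^sub>R axis \<nu> 1)"
        using fwd[of 0] l by auto
      obtain t' where t': "t' \<in> {0..l'}"
        "x + to_torus (l *\<^sub>R axis \<mu> 1) = y + to_torus (t' *\<^sub>R axis \<nu> 1)"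
        using fwd[of l] l by auto
      have "x + to_torus (0 *\<^sub>R axis \<mu> 1) = x + to_torus (l *\<^sub>R axis \<mu> 1)"
        using t t' True by auto
      then have "to_torus (0 *\<^sub>R axis \<mu> 1 :: real^'d) = to_torus (l *\<^sub>R axis \<mu> 1)"
        by (metis add_left_cancel)
      then have "lattice_rel (0 *\<^sub>R axis \<mu> 1 :: real^'d) (l *\<^sub>R axis \<mu> 1)"
        by (simp only: to_torus_eq_iff)
      then have "- l \<in> \<int>"
        by (auto simp: lattice_rel_def axis_def dest: spec[of _ \<mu>])
      then show False using small[of "- l"] l \<open>l \<noteq> 0\<close> by auto
    qed
    moreover have "x = y"
      using y c \<open>l = 0\<close> by (simp add: zero_torus.abs_eq[symmetric])
    ultimately show ?thesis using True by simp
  next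
    case False
    then have l'0: "l' > 0" using l by simp
    have "\<nu> = \<mu>"
    proof (rule ccontr)
      assume ne: "\<nu> \<noteq> \<mu>"
      obtain s where s: "s \<in> {0..l}"
        "x + to_torus (s *\<^sub>R axis \<mu> 1) = y + to_torus (min l' (1/2) *\<^sub>R axis \<nu> 1)"
        using bwd[of "min l' (1/2)"] l by auto
      from s(2)[unfolded rel] have "- min l' (1/2) \<in> \<int>"
        using ne by (auto dest: spec[of _ \<nu>])
      then show False using small[of "- min l' (1/2)"] l'0 by (auto simp: min_def split: if_splits)
    qed
    have fwd': "\<exists>t\<in>{0..l'}. s - (c + t) \<in> \<int>" if "s \<in> {0..l}" for s
      using fwd[OF that] unfolding rel by (fastforce simp: \<open>\<nu> = \<mu>\<close> dest: spec[of _ \<mu>])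
    have bwd': "\<exists>s\<in>{0..l}. s - (c + t) \<in> \<int>" if "t \<in> {0..l'}" for t
      using bwd[OF that] unfolding rel by (fastforce simp: \<open>\<nu> = \<mu>\<close> dest: spec[of _ \<mu>])
    have cl': "c + l' < 1"
    proof (rule ccontr)
      assume "\<not> c + l' < 1"
      moreover have "l < (l + 1) / 2" "(l + 1) / 2 < 1" using l by simp_all
      ultimately have "0 \<le> (l + 1) / 2 - c" "(l + 1) / 2 - c \<le> l'" using c by linarith+
      then have "(l + 1) / 2 - c \<in> {0..l'}" by simp
      then obtain s where s: "s \<in> {0..l}" "s - (c + ((l + 1) / 2 - c)) \<in> \<int>"
        using bwd' by blast
      have sl: "0 \<le> s" "s \<le> l" using s(1) by auto
      have mid: "l < (l + 1) / 2" "(l + 1) / 2 < 1" using l by simp_all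
      have "s - (l + 1) / 2 = 0"
      proof (rule small)
        show "s - (l + 1) / 2 \<in> \<int>" using s(2) by simp
        show "-1 < s - (l + 1) / 2" "s - (l + 1) / 2 < 1" using sl mid by linarith+
      qed
      then show False using sl mid by linarith
    qed
    obtain s where s: "s \<in> {0..l}" "s - (c + l') \<in> \<int>" using bwd'[of l'] l by auto
    have le: "c + l' \<le> l" using small[OF s(2)] s(1) cl' l c by auto
    obtain t where t: "t \<in> {0..l'}" "0 - (c + t) \<in> \<int>" using fwd'[of 0] l by auto
    have c0: "c = 0" using small[OF t(2)] t(1) cl' c by auto
    obtain t' where t': "t' \<in> {0..l'}" "l - (c + t') \<in> \<int>" using fwd'[of l] l by auto
    have "l \<le> l'" using small[OF t'(2)] t'(1) cl' c0 l by auto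
    then show ?thesis
      using le c0 y \<open>\<nu> = \<mu>\<close> by (simp add: zero_torus.abs_eq[symmetric])
  qed
qed

lemma seg_length_seg:
  assumes "0 \<le> l" "l \<le> 1"
  shows "seg_length (seg x \<mu> l) = l"
  unfolding seg_length_def
proof (rule the_equality)
  fix l' assume l': "0 \<le> l' \<and> l' \<le> 1 \<and> (\<exists>y \<nu>. seg x \<mu> l = seg y \<nu> l')"
  then obtain y \<nu> where eq: "seg x \<mu> l = seg y \<nu> l'" by blast
  consider "l < 1" | "l' < 1" | "l = 1" "l' = 1" using assms l' by linarith
  then show "l' = l"
    using seg_eq_seg[OF _ _ _ _ eq] seg_eq_seg[OF _ _ _ _ eq[symmetric]] assms l' by cases auto
qed (use assms in auto)

definition joinable :: "'d::finite torus set \<Rightarrow> 'd torus set \<Rightarrow> bool" where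
  "joinable L L' \<longleftrightarrow> L \<in> segments \<and> L' \<in> segments \<and> L \<union> L' \<in> segments \<and>
     seg_length (L \<union> L') = seg_length L + seg_length L'"

definition parallel :: "'d::finite torus set \<Rightarrow> 'd torus set \<Rightarrow> bool" where
  "parallel L L' \<longleftrightarrow> (\<exists>\<mu>. has_direction L \<mu> \<and> has_direction L' \<mu> \<and> torus_coord \<mu> ` L = torus_coord \<mu> ` L')"

definition rho :: "'d::finite torus set \<Rightarrow> 'd torus set \<Rightarrow> real" where
  "rho L L' = seg_length L powr (1/2) * setdist L L' powr (1/2)"

text \<open>A function on \<^term>\<open>segments\<close> is represented by its extension by zero.\<close>

definition Omega :: "('d::finite torus set \<Rightarrow> 'e::real_normed_vector) set" where
  "Omega = {A. (\<forall>L. L \<notin> segments \<longrightarrow> A L = 0) \<and> (\<forall>L L'. joinable L L' \<longrightarrow> A (L \<union> L') = A L + A L')}"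

definition gr_norm :: "real \<Rightarrow> ('d::finite torus set \<Rightarrow> 'e::real_normed_vector) \<Rightarrow> ennreal" where
  "gr_norm \<alpha> A = (SUP L\<in>{L\<in>segments. seg_length L > 0}. ennreal (norm (A L) / seg_length L powr \<alpha>))"

definition rho_norm :: "real \<Rightarrow> ('d::finite torus set \<Rightarrow> 'e::real_normed_vector) \<Rightarrow> ennreal" where
  "rho_norm \<alpha> A = (SUP (L, L')\<in>{(L, L'). parallel L L' \<and> L \<noteq> L'}. ennreal (norm (A L - A L') / rho L L' powr \<alpha>))"

definition alpha_norm :: "real \<Rightarrow> ('d::finite torus set \<Rightarrow> 'e::real_normed_vector) \<Rightarrow> ennreal" where
  "alpha_norm \<alpha> A = gr_norm \<alpha> A + rho_norm \<alpha> A"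

definition Omega_alpha :: "real \<Rightarrow> ('d::finite torus set \<Rightarrow> 'e::real_normed_vector) set" where
  "Omega_alpha \<alpha> = {A \<in> Omega. alpha_norm \<alpha> A < \<infinity>}"

text \<open>
  A one-form is the family of its components. Measurable means Borel measurable, so that the
  restriction of a component to a line is measurable. The classes \<^class>\<open>banach\<close> and
  \<^class>\<open>second_countable_topology\<close> are those of the Bochner integral; every finite-dimensional
  normed space belongs to both.
\<close>

definition bdd_forms :: "('d::finite \<Rightarrow> 'd torus \<Rightarrow> 'e::{banach, second_countable_topology}) set" where
  "bdd_forms = {A. \<forall>\<mu>. A \<mu> \<in> borel_measurable borel \<and> bounded (range (A \<mu>))}"

definition line_int ::
  "('d::finite \<Rightarrow> 'd torus \<Rightarrow> 'e::{banach, second_countable_topology}) \<Rightarrow> 'd torus set \<Rightarrow> 'e" where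
  "line_int A L = (if L \<in> segments then
     THE v. \<exists>x \<mu> l. 0 \<le> l \<and> l \<le> 1 \<and> L = seg x \<mu> l \<and>
       v = (LINT c:{0..l}|lborel. A \<mu> (x + to_torus (c *\<^sub>R axis \<mu> 1)))
     else 0)"

lemma line_int_seg:
  fixes A :: "'d::finite \<Rightarrow> 'd torus \<Rightarrow> 'e::{banach, second_countable_topology}"
  assumes A: "A \<in> bdd_forms" and l: "0 \<le> l" "l \<le> 1"
  shows "line_int A (seg x \<mu> l) = (LINT c:{0..l}|lborel. A \<mu> (x + to_torus (c *\<^sub>R axis \<mu> 1)))"
    (is "_ = ?I x \<mu> l")
proof -
  have degen: "?I y \<nu> 0 = 0" for y :: "'d torus" and \<nu>
  proof -
    have "AE c in lborel. indicator {0..0::real} c *\<^sub>R A \<nu> (y + to_torus (c *\<^sub>R axis \<nu> 1)) = 0"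
      using AE_lborel_singleton[of "0::real"] by (auto elim!: eventually_mono)
    then show ?thesis unfolding set_lebesgue_integral_def by (rule integral_eq_zero_AE)
  qed
  have full: "?I y \<mu> 1 = ?I x \<mu> 1" if yx: "y = x + to_torus (a *\<^sub>R axis \<mu> 1)" "0 \<le> a" "a \<le> 1" for y a
  proof -
    define g where "g c = A \<mu> (x + to_torus (c *\<^sub>R axis \<mu> 1))" for c
    have "continuous_on UNIV (\<lambda>c. x + to_torus (c *\<^sub>R axis \<mu> 1))" by (rule continuous_on_line)
    then have "(\<lambda>c. x + to_torus (c *\<^sub>R axis \<mu> 1)) \<in> borel \<rightarrow>\<^sub>M borel"
      by (rule borel_measurable_continuous_onI)
    then have gm: "g \<in> borel_measurable borel"
      using A unfolding g_def bdd_forms_def by (auto intro: measurable_compose)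
    obtain K where K: "\<And>p. norm (A \<mu> p) \<le> K"
      using A by (auto simp: bdd_forms_def bounded_iff)
    have gi: "set_integrable lborel {u..v} g" for u v
      unfolding set_integrable_def
    proof (rule integrableI_bounded_set[where A = "{u..v}" and B = K])
      show "(\<lambda>c. indicator {u..v} c *\<^sub>R g c) \<in> borel_measurable lborel"
        using gm by simp
    qed (use K in \<open>auto simp: g_def indicator_def emeasure_lborel_Icc_eq\<close>)
    have per: "g (c + 1) = g c" for c
    proof -
      have "to_torus ((c + 1) *\<^sub>R axis \<mu> 1 :: real^'d) = to_torus (c *\<^sub>R axis \<mu> 1)"
        by (auto simp: to_torus_eq_iff lattice_rel_def axis_def)
      then show ?thesis by (simp add: g_def)
    qed
    have shift: "(LINT c:{u..v}|lborel. g (w + c)) = (LINT c:{w+u..w+v}|lborel. g c)" for u v w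
    proof -
      have "(\<integral>c. indicator {w+u..w+v} c *\<^sub>R g c \<partial>lborel) =
          \<bar>1\<bar> *\<^sub>R (\<integral>c. indicator {w+u..w+v} (w + 1 * c) *\<^sub>R g (w + 1 * c) \<partial>lborel)"
        by (rule lborel_integral_real_affine) simp
      also have "\<dots> = (\<integral>c. indicator {u..v} c *\<^sub>R g (w + c) \<partial>lborel)"
        by (auto intro!: Bochner_Integration.integral_cong simp: indicator_def)
      finally show ?thesis unfolding set_lebesgue_integral_def by simp
    qed
    have split: "(LINT c:{u..w}|lborel. g c) = (LINT c:{u..v}|lborel. g c) + (LINT c:{v..w}|lborel. g c)"
      if "u \<le> v" "v \<le> w" for u v w
    proof -
      have "{u..w} = {u..v} \<union> {v..w}" using that by auto
      moreover have "(LINT c:{u..v} \<union> {v..w}|lborel. g c) =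
          (LINT c:{u..v}|lborel. g c) + (LINT c:{v..w}|lborel. g c)"
      proof (rule set_integral_Un_AE)
        show "AE c in lborel. \<not> (c \<in> {u..v} \<and> c \<in> {v..w})"
          using AE_lborel_singleton[of v] by eventually_elim auto
      qed (use gi in auto)
      ultimately show ?thesis by simp
    qed
    have "?I y \<mu> 1 = (LINT c:{0..1}|lborel. g (a + c))"
      by (simp add: g_def yx add.assoc to_torus_add scaleR_add_left)
    also have "\<dots> = (LINT c:{a..1+a}|lborel. g c)" using shift[of 0 1 a] by (simp add: add.commute)
    also have "\<dots> = (LINT c:{a..1}|lborel. g c) + (LINT c:{1..1+a}|lborel. g c)"
      using yx by (intro split) auto
    also have "(LINT c:{1..1+a}|lborel. g c) = (LINT c:{0..a}|lborel. g c)"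
      using shift[of 0 a 1] per by (simp add: add.commute)
    also have "(LINT c:{a..1}|lborel. g c) + (LINT c:{0..a}|lborel. g c) = (LINT c:{0..1}|lborel. g c)"
      using split[of 0 a 1] yx by simp
    finally show ?thesis by (simp add: g_def)
  qed
  have unique: "?I y \<nu> l' = ?I x \<mu> l" if l': "0 \<le> l'" "l' \<le> 1" and eq: "seg x \<mu> l = seg y \<nu> l'" for y \<nu> l'
  proof -
    have ll: "l' = l" using seg_length_seg[OF l, of x \<mu>] seg_length_seg[OF l', of y \<nu>] eq by simp
    show ?thesis
    proof (cases "l < 1")
      case True
      then show ?thesis
        using seg_eq_seg[OF l(1) _ l' eq] degen l by (cases "l = 0") auto
    next
      case False
      then have l1: "l = 1" using l by simp
      have mem: "y + to_torus (t *\<^sub>R axis \<nu> 1) \<in> seg x \<mu> l" if "t \<in> {0..1}" for t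
        unfolding eq unfolding seg_def by (rule image_eqI[of _ _ t]) (use that ll l1 in auto)
      obtain a where a: "0 \<le> a" "a \<le> 1" "y = x + to_torus (a *\<^sub>R axis \<mu> 1)"
        using mem[of 0] unfolding l1 seg_def by (auto simp: zero_torus.abs_eq[symmetric])
      obtain b where b: "y + to_torus ((1/2) *\<^sub>R axis \<nu> 1) = x + to_torus (b *\<^sub>R axis \<mu> 1)"
        using mem[of "1/2"] by (auto simp: seg_def)
      have "\<nu> = \<mu>"
      proof (rule ccontr)
        assume "\<nu> \<noteq> \<mu>"
        have "lattice_rel (a *\<^sub>R axis \<mu> 1 + (1/2) *\<^sub>R axis \<nu> 1 :: real^'d) (b *\<^sub>R axis \<mu> 1)"
          using b unfolding a add.assoc to_torus_add by (simp only: add_left_cancel to_torus_eq_iff)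
        then have "(1/2 :: real) \<in> \<int>"
          using \<open>\<nu> \<noteq> \<mu>\<close> by (auto simp: lattice_rel_def axis_def dest: spec[of _ \<nu>])
        then show False using Ints_nonzero_abs_less1[of "1/2 :: real"] by simp
      qed
      then show ?thesis using full[OF a(3,1,2)] ll l1 by simp
    qed
  qed
  have "seg x \<mu> l \<in> segments" using l by (auto simp: segments_def)
  moreover have "(THE v. \<exists>y \<nu> l'. 0 \<le> l' \<and> l' \<le> 1 \<and> seg x \<mu> l = seg y \<nu> l' \<and> v = ?I y \<nu> l') = ?I x \<mu> l"
  proof (rule the_equality)
    show "\<exists>y \<nu> l'. 0 \<le> l' \<and> l' \<le> 1 \<and> seg x \<mu> l = seg y \<nu> l' \<and> ?I x \<mu> l = ?I y \<nu> l'"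
      using l by (intro exI[of _ x] exI[of _ \<mu>] exI[of _ l]) simp
  next
    fix v assume "\<exists>y \<nu> l'. 0 \<le> l' \<and> l' \<le> 1 \<and> seg x \<mu> l = seg y \<nu> l' \<and> v = ?I y \<nu> l'"
    then obtain y \<nu> l' where *: "0 \<le> l'" "l' \<le> 1" "seg x \<mu> l = seg y \<nu> l'" and v: "v = ?I y \<nu> l'"
      by blast
    show "v = ?I x \<mu> l" unfolding v by (rule unique[OF *])
  qed
  ultimately show ?thesis by (simp only: line_int_def if_True)
qed

definition Omega1 ::
  "real \<Rightarrow> ('d::finite torus set \<Rightarrow> 'e::{banach, second_countable_topology}) set" where
  "Omega1 \<alpha> = {B \<in> Omega_alpha \<alpha>. \<forall>\<epsilon>>0. \<exists>A\<in>bdd_forms.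
     alpha_norm \<alpha> (line_int A) < \<infinity> \<and> alpha_norm \<alpha> (\<lambda>L. B L - line_int A L) < ennreal \<epsilon>}"

definition partial :: "'d::finite \<Rightarrow> (real^'d \<Rightarrow> real) \<Rightarrow> real^'d \<Rightarrow> real" where
  "partial i f x = deriv (\<lambda>t. f (x + t *\<^sub>R axis i 1)) 0"

definition iter_partial :: "'d::finite list \<Rightarrow> (real^'d \<Rightarrow> real) \<Rightarrow> real^'d \<Rightarrow> real" where
  "iter_partial is f = foldr partial is f"

definition smooth :: "(real^'d::finite \<Rightarrow> real) \<Rightarrow> bool" where
  "smooth f \<longleftrightarrow> (\<forall>is x. iter_partial is f differentiable (at x))"

definition deriv_sup :: "nat \<Rightarrow> (real^'d::finite \<Rightarrow> real) \<Rightarrow> ennreal" where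
  "deriv_sup n f = (SUP is\<in>{is. length is \<le> n}. SUP x. ennreal \<bar>iter_partial is f x\<bar>)"

definition deriv_lip :: "nat \<Rightarrow> (real^'d::finite \<Rightarrow> real) \<Rightarrow> ennreal" where
  "deriv_lip n f = (SUP is\<in>{is. length is = n}. SUP (x, y)\<in>{(x, y). x \<noteq> y}.
     ennreal (\<bar>iter_partial is f x - iter_partial is f y\<bar> / dist x y))"

definition test_funs :: "('d::finite torus \<Rightarrow> real) set" where
  "test_funs = {\<phi>. smooth (\<phi> \<circ> to_torus)}"

text \<open>A distribution is represented by its extension by zero to all functions.\<close>

definition distributions :: "(('d::finite torus \<Rightarrow> real) \<Rightarrow> 'e::real_normed_vector) set" where
  "distributions = {\<xi>.
     (\<forall>\<phi>\<in>test_funs. \<forall>\<eta>\<in>test_funs. \<xi> (\<lambda>p. \<phi> p + \<eta> p) = \<xi> \<phi> + \<xi> \<eta>) \<and>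
     (\<forall>\<phi>\<in>test_funs. \<forall>c. \<xi> (\<lambda>p. c * \<phi> p) = c *\<^sub>R \<xi> \<phi>) \<and>
     (\<exists>C n. \<forall>\<phi>\<in>test_funs. ennreal (norm (\<xi> \<phi>)) \<le> ennreal C * deriv_sup n (\<phi> \<circ> to_torus)) \<and>
     (\<forall>\<phi>. \<phi> \<notin> test_funs \<longrightarrow> \<xi> \<phi> = 0)}"

definition fun_distr ::
  "('d::finite torus \<Rightarrow> 'e::{banach, second_countable_topology}) \<Rightarrow> ('d torus \<Rightarrow> real) \<Rightarrow> 'e" where
  "fun_distr f \<phi> = (if \<phi> \<in> test_funs then LINT p|torus_measure. \<phi> p *\<^sub>R f p else 0)"

definition form_distr ::
  "('d::finite \<Rightarrow> 'd torus \<Rightarrow> 'e::{banach, second_countable_topology}) \<Rightarrow> 'd \<Rightarrow> ('d torus \<Rightarrow> real) \<Rightarrow> 'e" where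
  "form_distr A \<mu> = fun_distr (A \<mu>)"

text \<open>
  For \<open>r \<ge> 1\<close>, the norm of the space of \<open>r - 1\<close> times differentiable functions with Lipschitz derivatives
  of order \<open>r - 1\<close> is taken to be the supremum of the derivatives plus the Lipschitz constant.
\<close>

definition bumps :: "nat \<Rightarrow> (real^'d::finite \<Rightarrow> real) set" where
  "bumps r = {\<psi>. smooth \<psi> \<and> deriv_sup (r - 1) \<psi> + deriv_lip (r - 1) \<psi> \<le> 1 \<and>
     closure {x. \<psi> x \<noteq> 0} \<subseteq> ball 0 (1/4)}"

definition rescale :: "real \<Rightarrow> (real^'d::finite \<Rightarrow> real) \<Rightarrow> real^'d \<Rightarrow> real" where
  "rescale l \<psi> y = \<psi> ((1 / l) *\<^sub>R y) / l ^ CARD('d)"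

text \<open>
  A function on Euclidean space supported near the origin is viewed as a function on the torus by
  summing over fibres; for the functions used here at most one summand is nonzero.
\<close>

definition periodise :: "(real^'d::finite \<Rightarrow> real) \<Rightarrow> 'd torus \<Rightarrow> real" where
  "periodise f p = (\<Sum>\<^sub>\<infinity>x\<in>{x. to_torus x = p}. f x)"

definition besov_norm ::
  "real \<Rightarrow> (('d::finite torus \<Rightarrow> real) \<Rightarrow> 'e::real_normed_vector) \<Rightarrow> ennreal" where
  "besov_norm \<beta> \<xi> = (SUP l\<in>{0<..1}. SUP \<psi>\<in>bumps (nat (- \<lfloor>\<beta>\<rfloor>)). SUP x.
     ennreal (norm (\<xi> (\<lambda>y. periodise (rescale l \<psi>) (y - x))) / l powr \<beta>))"

definition Linf_norm :: "('d::finite torus \<Rightarrow> 'e::{banach, second_countable_topology}) \<Rightarrow> ennreal" where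
  "Linf_norm f = esssup torus_measure (\<lambda>p. ennreal (norm (f p)))"

text \<open>
  For \<open>\<beta> = 0\<close> the space is \<open>L\<^sup>\<infinity>\<close>, identified with the distributions given by its elements. All
  functions representing the same distribution agree almost everywhere, so the infimum is over a
  single value; it is \<open>\<infinity>\<close> if the distribution is not given by an essentially bounded function.
\<close>

definition C_norm ::
  "real \<Rightarrow> (('d::finite torus \<Rightarrow> real) \<Rightarrow> 'e::{banach, second_countable_topology}) \<Rightarrow> ennreal" where
  "C_norm \<beta> \<xi> = (if \<beta> < 0 then besov_norm \<beta> \<xi>
     else (INF f\<in>{f \<in> borel_measurable borel. Linf_norm f < \<infinity> \<and> fun_distr f = \<xi>}. Linf_norm f))"

definition form_C_norm ::
  "real \<Rightarrow> ('d \<Rightarrow> ('d::finite torus \<Rightarrow> real) \<Rightarrow> 'e::{banach, second_countable_topology}) \<Rightarrow> ennreal" where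
  "form_C_norm \<beta> A = (\<Sum>\<mu>\<in>UNIV. C_norm \<beta> (A \<mu>))"

definition Omega1_C ::
  "real \<Rightarrow> ('d \<Rightarrow> ('d::finite torus \<Rightarrow> real) \<Rightarrow> 'e::{banach, second_countable_topology}) set" where
  "Omega1_C \<beta> = {A. (\<forall>\<mu>. A \<mu> \<in> distributions) \<and> form_C_norm \<beta> A < \<infinity>}"

end

theory Submission
  imports Defs "HOL-Probability.Probability_Measure"
begin

text \<open>
  The line integrals of a form determine it as a distribution, and their growth controls its size.
  For a bounded form \<open>A\<close>, let \<open>L s p\<close> be the integral of the component \<open>A \<mu>\<close> over the segment of length
  \<open>s\<close> from \<open>p\<close> in direction \<open>\<mu>\<close>. Translation invariance and integration by parts give
  \<open>h \<cdot> \<langle>A \<mu>, \<phi>\<rangle> = \<integral> \<phi> \<cdot> L h + \<integral>\<^sub>0\<^sup>h \<integral> \<partial>\<phi> \<cdot> L s ds\<close>. If \<open>\<bar>L s\<bar> \<le> K * s powr \<alpha>\<close>, then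
  \<open>\<bar>\<langle>A \<mu>, \<phi>\<rangle>\<bar> \<le> K * h powr (\<alpha> - 1) * (\<integral> \<bar>\<phi>\<bar> + h * \<integral> \<bar>\<partial>\<phi>\<bar>)\<close> for every \<open>0 < h \<le> 1\<close>, which is
  the content of \<open>test_pairing_bound\<close>, and \<open>represents_bound\<close> for limits. With \<open>h = 1\<close> the map from forms
  to distributions extends continuously to the closure. With \<open>h\<close> equal to the scale \<open>l\<close> of a bump
  function, for which \<open>\<integral> \<bar>\<phi>\<bar> \<le> 1\<close> and \<open>\<integral> \<bar>\<partial>\<phi>\<bar> \<le> 1 / l\<close>, the estimate reads
  \<open>2 * K * l powr (\<alpha> - 1)\<close>, which is the Besov bound for \<open>\<alpha> < 1\<close> (\<open>represents_besov_bound\<close>).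

  For \<open>\<alpha> = 1\<close> the target norm is that of \<open>L\<^sup>\<infinity>\<close>. There \<open>\<bar>L s\<bar> \<le> K * s\<close> and Lebesgue differentiation on lines
  give \<open>norm (A \<mu> p) \<le> K\<close> for almost every \<open>p\<close>, so limits of forms are limits in \<open>L\<^sup>\<infinity>\<close>
  (\<open>represents_Linf\<close>).

  All these bounds are in terms of \<^term>\<open>gr_norm\<close>. Injectivity uses \<^term>\<open>rho_norm\<close>, which makes
  \<open>p \<mapsto> D (seg p \<mu> h)\<close> continuous (\<open>continuous_seg\<close>). The integral of this function against a test
  function \<open>\<phi>\<close> is the integral over \<open>0 \<le> c \<le> h\<close> of the distribution of \<open>D\<close> at the translates of \<open>\<phi>\<close>
  by \<open>c\<close>. If that distribution vanishes, the continuous function is orthogonal to all test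
  functions; these are dense by the Stone-Weierstrass theorem, so it is zero
  (\<open>represents_zero_seg\<close>, \<open>represents_inj\<close>).
\<close>

section \<open>Topology of the torus\<close>

lemma continuous_to_torus: "continuous_on S to_torus"
  unfolding continuous_on_iff using dist_to_torus_le le_less_trans by blast

text \<open>
  The lattice acts by isometries, so an almost optimal pair of lifts can be moved to start at any
  prescribed lift of the first point.
\<close>

lemma lift_near:
  assumes "dist (to_torus x) q < e"
  shows "\<exists>y. to_torus y = q \<and> dist x y < e"
proof -
  define S where "S = {dist x' y | x' y. to_torus x' = to_torus x \<and> to_torus y = q}"
  have "S \<noteq> {}" using ex_to_torus[of q] by (auto simp: S_def)
  moreover have "Inf S < e" using assms by (simp add: S_def dist_torus_def)
  ultimately obtain x' y' where xy: "to_torus x' = to_torus x" "to_torus y' = q" "dist x' y' < e"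
    using cInf_lessD[of S e] by (auto simp: S_def)
  have "to_torus (y' + (x - x')) = q + (to_torus x - to_torus x')"
    by (simp add: to_torus_add[symmetric] to_torus_diff[symmetric] xy)
  moreover have "dist x (y' + (x - x')) = dist x' y'" by (simp add: dist_norm algebra_simps)
  ultimately show ?thesis using xy by (intro exI[of _ "y' + (x - x')"]) simp
qed

lemma open_to_torus_image:
  assumes "open U"
  shows "open (to_torus ` U)"
  unfolding open_dist
proof safe
  fix x assume "x \<in> U"
  then obtain e where e: "e > 0" "ball x e \<subseteq> U" using assms openE by blast
  have "q \<in> to_torus ` U" if "dist q (to_torus x) < e" for q
    using lift_near[of x q e] that e by (force simp: dist_commute)
  then show "\<exists>e>0. \<forall>q. dist q (to_torus x) < e \<longrightarrow> q \<in> to_torus ` U" using e by blast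
qed

lemma continuous_on_torus_iff:
  "continuous_on UNIV (\<lambda>x. f (to_torus x)) \<longleftrightarrow> continuous_on UNIV f"
proof
  assume f: "continuous_on UNIV (\<lambda>x. f (to_torus x))"
  show "continuous_on UNIV f"
    unfolding continuous_on_open_vimage[OF open_UNIV]
  proof (intro allI impI)
    fix B :: "'b set" assume "open B"
    then have "open ((\<lambda>x. f (to_torus x)) -` B)"
      using f by (auto simp: continuous_on_open_vimage)
    then have "open (to_torus ` ((\<lambda>x. f (to_torus x)) -` B))" by (rule open_to_torus_image)
    moreover have "to_torus ` ((\<lambda>x. f (to_torus x)) -` B) = f -` B"
    proof (intro equalityI subsetI)
      fix p assume "p \<in> f -` B"
      moreover obtain x where "p = to_torus x" using ex_to_torus by blast
      ultimately show "p \<in> to_torus ` ((\<lambda>x. f (to_torus x)) -` B)" by auto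
    qed auto
    ultimately show "open (f -` B \<inter> UNIV)" by simp
  qed
next
  assume "continuous_on UNIV f"
  then show "continuous_on UNIV (\<lambda>x. f (to_torus x))"
    by (rule continuous_on_compose2[OF _ continuous_to_torus]) auto
qed

text \<open>
  Second countability makes every continuous function on the product of the line and the torus
  measurable for the product of the Borel \<open>\<sigma>\<close>-algebras, as Fubini's theorem requires.
\<close>

instance torus :: (finite) second_countable_topology
proof
  obtain B :: "(real^'a) set set" where B: "countable B" "topological_basis B"
    using ex_countable_basis by blast
  have "topological_basis ((`) to_torus ` B)"
  proof (rule topological_basisI)
    show "open V" if "V \<in> (`) to_torus ` B" for V :: "'a torus set"
      using that B(2) open_to_torus_image topological_basis_open by auto
  next
    fix V :: "'a torus set" and p assume V: "open V" "p \<in> V"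
    obtain x where x: "p = to_torus x" using ex_to_torus by blast
    have "open (to_torus -` V)" using open_vimage[OF V(1) continuous_to_torus] .
    then obtain U where "U \<in> B" "x \<in> U" "U \<subseteq> to_torus -` V"
      using topological_basisE[OF B(2), of "to_torus -` V" x] V x by auto
    then show "\<exists>W\<in>(`) to_torus ` B. p \<in> W \<and> W \<subseteq> V" using x by (intro bexI[of _ "to_torus ` U"]) auto
  qed
  then show "\<exists>B :: 'a torus set set. countable B \<and> open = generate_topology B"
    using B(1) topological_basis_imp_subbasis by (metis countable_image)
qed

lemma dist_add_right: "dist (p + r) (q + r) = dist p q" for p :: "'d::finite torus"
proof -
  have le: "dist (p + r) (q + r) \<le> dist p q" for p q r :: "'d torus"
  proof (rule field_le_epsilon)
    fix e :: real assume "e > 0"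
    obtain x z where x: "p = to_torus x" and z: "r = to_torus z" using ex_to_torus by metis
    obtain y where y: "q = to_torus y" "dist x y < dist p q + e"
      using lift_near[of x q "dist p q + e"] \<open>e > 0\<close> x by auto
    have "dist (p + r) (q + r) \<le> dist (x + z) (y + z)"
      unfolding x y z to_torus_add by (rule dist_to_torus_le)
    then show "dist (p + r) (q + r) \<le> dist p q + e" using y by simp
  qed
  show ?thesis using le[of p r q] le[of "p + r" "- r" "q + r"] by simp
qed

lemma dist_add_add: "dist (p + p') (q + q') \<le> dist p q + dist p' q'" for p :: "'d::finite torus"
proof -
  have "dist (p + p') (q + q') \<le> dist (p + p') (q + p') + dist (p' + q) (q' + q)"
    using dist_triangle[of "p + p'" "q + q'" "q + p'"] by (simp add: add.commute)
  then show ?thesis by (simp add: dist_add_right)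
qed

lemma continuous_on_torus_add [continuous_intros]:
  fixes f g :: "'a::topological_space \<Rightarrow> 'd::finite torus"
  assumes "continuous_on S f" "continuous_on S g"
  shows "continuous_on S (\<lambda>x. f x + g x)"
proof -
  have "((\<lambda>x. f x + g x) \<longlongrightarrow> f a + g a) (at a within S)" if "a \<in> S" for a
  proof -
    have "((\<lambda>x. dist (f x) (f a) + dist (g x) (g a)) \<longlongrightarrow> 0 + 0) (at a within S)"
      using assms that by (intro tendsto_add) (auto simp: continuous_on_def tendsto_dist_iff[symmetric])
    then have lim: "((\<lambda>x. dist (f x) (f a) + dist (g x) (g a)) \<longlongrightarrow> 0) (at a within S)"
      by simp
    have "((\<lambda>x. dist (f x + g x) (f a + g a)) \<longlongrightarrow> 0) (at a within S)"
    proof (rule tendsto_sandwich[OF _ _ tendsto_const lim])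
      show "\<forall>\<^sub>F x in at a within S. 0 \<le> dist (f x + g x) (f a + g a)" by simp
      show "\<forall>\<^sub>F x in at a within S. dist (f x + g x) (f a + g a) \<le> dist (f x) (f a) + dist (g x) (g a)"
        by (rule always_eventually) (blast intro: dist_add_add)
    qed
    then show ?thesis by (subst tendsto_dist_iff)
  qed
  then show ?thesis by (simp add: continuous_on_def)
qed

lemma continuous_on_torus_diff [continuous_intros]:
  fixes f g :: "'a::topological_space \<Rightarrow> 'd::finite torus"
  assumes "continuous_on S f" "continuous_on S g"
  shows "continuous_on S (\<lambda>x. f x - g x)"
proof -
  have "dist (- p) (- q) = dist p q" for p q :: "'d torus"
    using dist_add_right[of "- p" "p + q" "- q"] by (simp add: dist_commute)
  then have "continuous_on UNIV (uminus :: 'd torus \<Rightarrow> 'd torus)"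
    unfolding continuous_on_iff by auto
  then have "continuous_on S (\<lambda>x. - g x)"
    using assms(2) by (rule continuous_on_compose2) auto
  from continuous_on_torus_add[OF assms(1) this] show ?thesis by simp
qed

lemma compact_torus: "compact (UNIV :: 'd::finite torus set)"
proof -
  have "to_torus ` cbox 0 (\<chi> i. 1) = (UNIV :: 'd torus set)"
  proof (intro equalityI subsetI UNIV_I)
    fix p :: "'d torus"
    obtain x where x: "p = to_torus x" using ex_to_torus by blast
    have "lattice_rel x (\<chi> i. frac (x $ i))" by (auto simp: lattice_rel_def frac_def)
    then have "p = to_torus (\<chi> i. frac (x $ i))" by (simp add: x to_torus_eq_iff)
    moreover have "(\<chi> i. frac (x $ i)) \<in> cbox 0 (\<chi> i. 1)"
      by (simp add: mem_box_cart frac_lt_1 less_imp_le)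
    ultimately show "p \<in> to_torus ` cbox 0 (\<chi> i. 1)" by blast
  qed
  then show ?thesis using compact_continuous_image[OF continuous_to_torus compact_cbox] by metis
qed

lemma bounded_continuous_torus:
  fixes f :: "'d::finite torus \<Rightarrow> 'b::metric_space"
  assumes "continuous_on UNIV f"
  shows "bounded (range f)"
  using compact_continuous_image[OF assms compact_torus] compact_imp_bounded by blast

section \<open>Haar measure on the torus\<close>

definition unit_cell :: "(real^'d::finite) set" where
  "unit_cell = {x. \<forall>i. 0 \<le> x $ i \<and> x $ i < 1}"

lemma unit_cell_sets [measurable]: "unit_cell \<in> sets borel"
proof -
  have "unit_cell = (\<Inter>i. {x :: real^'d. 0 \<le> x $ i} \<inter> {x. x $ i < 1})"
    by (auto simp: unit_cell_def)
  also have "\<dots> \<in> sets borel"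
    by (intro sets.finite_INT sets.Int borel_closed borel_open closed_Collect_le open_Collect_less
        continuous_intros) auto
  finally show ?thesis .
qed

lemma emeasure_unit_cell: "emeasure lborel (unit_cell :: (real^'d::finite) set) = 1"
proof (rule antisym)
  let ?u = "(\<chi> i. 1) :: real^'d"
  have p: "(\<Prod>b\<in>Basis. (?u - 0) \<bullet> b) = 1"
    by (auto simp: Basis_vec_def inner_axis intro!: prod.neutral)
  have le: "\<forall>b\<in>Basis. 0 \<bullet> b \<le> ?u \<bullet> b" by (auto simp: Basis_vec_def inner_axis)
  have "emeasure lborel (unit_cell :: (real^'d) set) \<le> emeasure lborel (cbox 0 ?u)"
    by (intro emeasure_mono) (auto simp: unit_cell_def mem_box_cart less_imp_le)
  then show "emeasure lborel (unit_cell :: (real^'d) set) \<le> 1"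
    using p le by (simp add: emeasure_lborel_cbox)
  have "emeasure lborel (box 0 ?u) \<le> emeasure lborel (unit_cell :: (real^'d) set)"
    by (intro emeasure_mono) (auto simp: unit_cell_def mem_box_cart less_imp_le)
  then show "1 \<le> emeasure lborel (unit_cell :: (real^'d) set)"
    using p le by (simp add: emeasure_lborel_box)
qed

lemma torus_measure_unit_cell:
  "torus_measure = distr (restrict_space lborel unit_cell) borel to_torus"
  by (simp add: torus_measure_def unit_cell_def)

lemma sets_torus_measure [simp, measurable_cong]: "sets torus_measure = sets borel"
  by (simp add: torus_measure_def)

lemma space_torus_measure [simp]: "space torus_measure = UNIV"
  by (simp add: torus_measure_def)

lemma to_torus_measurable_cell [measurable]:
  "to_torus \<in> restrict_space lborel unit_cell \<rightarrow>\<^sub>M borel"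
  using to_torus_borel_measurable by (intro measurable_restrict_space1) simp

lemma emeasure_torus:
  assumes "P \<in> sets borel"
  shows "emeasure torus_measure P = emeasure lborel (unit_cell \<inter> to_torus -` P)"
  unfolding torus_measure_unit_cell using assms
  by (subst emeasure_distr) (auto simp: space_restrict_space emeasure_restrict_space Int_commute)

interpretation torus_measure: prob_space torus_measure
  by standard (simp add: emeasure_torus emeasure_unit_cell)

lemma torus_measure_UNIV [simp]:
  "emeasure torus_measure UNIV = 1" "measure torus_measure UNIV = 1"
  using torus_measure.emeasure_space_1 torus_measure.prob_space by simp_all

lemma integral_torus:
  fixes f :: "'d::finite torus \<Rightarrow> 'e::{banach, second_countable_topology}"
  assumes [measurable]: "f \<in> borel_measurable borel"
  shows "(LINT p|torus_measure. f p) = (LINT x:unit_cell|lborel. f (to_torus x))"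
  unfolding torus_measure_unit_cell set_lebesgue_integral_def
  by (subst integral_distr) (auto simp: integral_restrict_space)

lemma integrable_torus_bounded:
  fixes f :: "'d::finite torus \<Rightarrow> 'e::{banach, second_countable_topology}"
  assumes "f \<in> borel_measurable borel" "bounded (range f)"
  shows "integrable torus_measure f"
  using assms by (auto simp: bounded_iff intro!: torus_measure.integrable_const_bound)

text \<open>
  A translate of the unit cell meets countably many lattice translates of the cell; moving every
  piece back by its lattice vector reassembles the cell.
\<close>

lemma emeasure_torus_translate:
  fixes a :: "real^'d::finite"
  assumes P: "P \<in> sets borel"
  shows "emeasure torus_measure ((\<lambda>p. p + to_torus a) -` P) = emeasure torus_measure P"
proof -
  define Q where "Q = (unit_cell :: (real^'d) set)"
  define Z where "Z = range (\<lambda>k :: int^'d. (\<chi> i. real_of_int (k $ i)) :: real^'d)"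
  define R where "R = to_torus -` P"
  have Rm: "R \<in> sets borel"
    using measurable_sets[OF to_torus_borel_measurable P] by (simp add: R_def)
  have Qm: "Q \<in> sets borel" by (simp add: Q_def)
  have [measurable]: "(+) v \<in> borel_measurable borel" for v :: "real^'d" by simp
  have shift: "(+) v -` S \<in> sets borel" if "S \<in> sets borel" for v and S :: "(real^'d) set"
    using measurable_sets[of "(+) v" borel borel S] that by simp
  have inv: "emeasure lborel ((+) v -` S) = emeasure lborel S" if "S \<in> sets borel" for v and S :: "(real^'d) set"
  proof -
    have "emeasure lborel S = emeasure (distr lborel borel ((+) v)) S" by (simp add: lborel_distr_plus)
    also have "\<dots> = emeasure lborel ((+) v -` S)" using that by (subst emeasure_distr) auto
    finally show ?thesis by simp
  qed
  have "countable (UNIV :: (int^'d) set)"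
  proof -
    have "countable (UNIV :: ('d \<Rightarrow> int) set)" by simp
    then have "countable (vec_lambda ` (UNIV :: ('d \<Rightarrow> int) set))" by (rule countable_image)
    moreover have "vec_lambda ` (UNIV :: ('d \<Rightarrow> int) set) = (UNIV :: (int^'d) set)"
      by (metis surj_def vec_lambda_eta)
    ultimately show ?thesis by simp
  qed
  then have Zc: "countable Z" unfolding Z_def by (rule countable_image)
  have Zneg: "- k \<in> Z" if "k \<in> Z" for k
  proof -
    obtain j :: "int^'d" where "k = (\<chi> i. real_of_int (j $ i))" using \<open>k \<in> Z\<close> by (auto simp: Z_def)
    then have "- k = (\<chi> i. real_of_int ((\<chi> i. - (j $ i)) $ i))" by (simp add: vec_eq_iff)
    then show ?thesis unfolding Z_def by (rule range_eqI)
  qed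
  have ZR: "x + k \<in> R \<longleftrightarrow> x \<in> R" if "k \<in> Z" for x k
  proof -
    have "to_torus (x + k) = to_torus x"
      using that by (auto simp: to_torus_eq_iff lattice_rel_def Z_def)
    then show ?thesis by (simp add: R_def)
  qed
  have cover: "\<exists>k\<in>Z. x + k \<in> Q" for x
  proof (rule bexI)
    show "x + (\<chi> i. real_of_int ((\<chi> i. - \<lfloor>x $ i\<rfloor>) $ i)) \<in> Q"
      by (auto simp: Q_def unit_cell_def) linarith
    show "(\<chi> i. real_of_int ((\<chi> i. - \<lfloor>x $ i\<rfloor>) $ i)) \<in> Z"
      unfolding Z_def by (rule rangeI)
  qed
  have uniq: "k = k'" if "x + k \<in> Q" "x + k' \<in> Q" "k \<in> Z" "k' \<in> Z" for x k k'
  proof -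
    obtain j j' :: "int^'d" where j: "k = (\<chi> i. real_of_int (j $ i))" "k' = (\<chi> i. real_of_int (j' $ i))"
      using \<open>k \<in> Z\<close> \<open>k' \<in> Z\<close> by (auto simp: Z_def)
    have "j $ i = j' $ i" for i
    proof -
      have "0 \<le> x $ i + j $ i" "x $ i + j $ i < 1" "0 \<le> x $ i + j' $ i" "x $ i + j' $ i < 1"
        using that(1,2) by (auto simp: j Q_def unit_cell_def)
      then show ?thesis by linarith
    qed
    then show ?thesis by (simp add: j vec_eq_iff)
  qed
  define X where "X k = Q \<inter> (+) a -` R \<inter> (+) (a + k) -` Q" for k
  define Y where "Y k = Q \<inter> R \<inter> (+) (- a - k) -` Q" for k
  have Xm: "X k \<in> sets borel" and Ym: "Y k \<in> sets borel" for k
    using Qm Rm shift by (auto simp: X_def Y_def)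
  have XY: "emeasure lborel (X k) = emeasure lborel (Y k)" if "k \<in> Z" for k
  proof -
    have "X k = (+) (a + k) -` Y k"
      using ZR[OF that] by (auto simp: X_def Y_def algebra_simps) (metis add.assoc)+
    then show ?thesis using inv[OF Ym] by simp
  qed
  have "emeasure lborel (Q \<inter> (+) a -` R) = emeasure lborel (\<Union>k\<in>Z. X k)"
  proof (rule arg_cong[where f = "emeasure lborel"])
    show "Q \<inter> (+) a -` R = (\<Union>k\<in>Z. X k)"
    proof (intro equalityI subsetI)
      fix x assume "x \<in> Q \<inter> (+) a -` R"
      then show "x \<in> (\<Union>k\<in>Z. X k)"
        using cover[of "a + x"] by (auto simp: X_def algebra_simps)
    qed (auto simp: X_def)
  qed
  also have "\<dots> = (\<integral>\<^sup>+k. emeasure lborel (X k) \<partial>count_space Z)"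
  proof (rule emeasure_UN_countable)
    show "disjoint_family_on X Z"
      unfolding disjoint_family_on_def
    proof (intro ballI impI)
      fix m n assume mn: "m \<in> Z" "n \<in> Z" "m \<noteq> n"
      show "X m \<inter> X n = {}"
        using uniq[of "a + _" m n] mn by (auto simp: X_def algebra_simps)
    qed
  qed (use Xm Zc in auto)
  also have "\<dots> = (\<integral>\<^sup>+k. emeasure lborel (Y k) \<partial>count_space Z)"
    using XY by (intro nn_integral_cong) auto
  also have "\<dots> = emeasure lborel (\<Union>k\<in>Z. Y k)"
  proof (rule emeasure_UN_countable[symmetric])
    show "disjoint_family_on Y Z"
      unfolding disjoint_family_on_def
    proof (intro ballI impI)
      fix m n assume mn: "m \<in> Z" "n \<in> Z" "m \<noteq> n"
      show "Y m \<inter> Y n = {}"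
        using uniq[of "_ - a" "- m" "- n"] mn Zneg by (auto simp: Y_def algebra_simps)
    qed
  qed (use Ym Zc in auto)
  also have "(\<Union>k\<in>Z. Y k) = Q \<inter> R"
  proof (intro equalityI subsetI)
    fix x assume x: "x \<in> Q \<inter> R"
    obtain k where k: "k \<in> Z" "x - a + k \<in> Q" using cover by blast
    then have "x \<in> Y (- k)" using x by (auto simp: Y_def algebra_simps)
    then show "x \<in> (\<Union>k\<in>Z. Y k)" using Zneg k by blast
  qed (auto simp: Y_def)
  finally have "emeasure lborel (Q \<inter> (+) a -` R) = emeasure lborel (Q \<inter> R)" .
  moreover have "to_torus -` (\<lambda>p. p + to_torus a) -` P = (+) a -` R"
    by (auto simp: R_def to_torus_add add.commute)
  moreover have "(\<lambda>p. p + to_torus a) -` P \<in> sets borel"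
    using measurable_sets[of "\<lambda>p. p + to_torus a" borel borel P] P
    by (simp add: borel_measurable_continuous_onI continuous_intros)
  ultimately show ?thesis using P by (simp add: emeasure_torus Q_def R_def)
qed

lemma translate_borel [measurable]: "(\<lambda>p. p + q) \<in> borel \<rightarrow>\<^sub>M borel" for q :: "'d::finite torus"
  by (intro borel_measurable_continuous_onI continuous_intros)

lemma distr_torus_translate: "distr torus_measure borel (\<lambda>p. p + q) = torus_measure"
proof (rule measure_eqI)
  fix P :: "'a torus set" assume P: "P \<in> sets (distr torus_measure borel (\<lambda>p. p + q))"
  obtain a where a: "q = to_torus a" using ex_to_torus by blast
  show "emeasure (distr torus_measure borel (\<lambda>p. p + q)) P = emeasure torus_measure P"
    using P emeasure_torus_translate[of P a] by (subst emeasure_distr) (auto simp: a)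
qed simp

lemma integral_torus_translate:
  fixes f :: "'d::finite torus \<Rightarrow> 'e::{banach, second_countable_topology}"
  assumes [measurable]: "f \<in> borel_measurable borel"
  shows "(LINT p|torus_measure. f (p + q)) = (LINT p|torus_measure. f p)"
proof -
  have "(LINT p|torus_measure. f p) = (LINT p|distr torus_measure borel (\<lambda>p. p + q). f p)"
    by (simp add: distr_torus_translate)
  also have "\<dots> = (LINT p|torus_measure. f (p + q))"
    by (rule integral_distr) measurable
  finally show ?thesis by simp
qed

lemma emeasure_torus_open_pos:
  fixes U :: "'d::finite torus set"
  assumes "open U" "U \<noteq> {}"
  shows "emeasure torus_measure U > 0"
proof -
  obtain p where p: "p \<in> U" using assms by blast
  obtain x where x: "p = to_torus x" using ex_to_torus by blast
  define h :: "real^'d" where "h = (\<chi> i. 1/2)"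
  define V where "V = to_torus -` ((\<lambda>q. q + to_torus (x - h)) -` U) \<inter> box 0 (\<chi> i. 1)"
  have Uo: "open ((\<lambda>q. q + to_torus (x - h)) -` U)"
    using assms by (intro open_vimage) (auto intro!: continuous_intros)
  have "open V" unfolding V_def
    by (intro open_Int open_vimage[OF Uo continuous_to_torus] open_box)
  moreover have "h \<in> V"
    using p x by (auto simp: V_def to_torus_add h_def mem_box_cart)
  ultimately have "emeasure lborel V \<noteq> 0"
    using open_not_negligible[of V] by (auto simp: negligible_iff_null_sets null_sets_def emeasure_completion)
  moreover have "emeasure lborel V \<le> emeasure torus_measure ((\<lambda>q. q + to_torus (x - h)) -` U)"
    using Uo measurable_sets[OF to_torus_borel_measurable, of "(\<lambda>q. q + to_torus (x - h)) -` U"]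
    by (subst emeasure_torus)
       (auto intro!: emeasure_mono simp: V_def mem_box_cart unit_cell_def less_imp_le)
  ultimately show ?thesis
    using emeasure_torus_translate[of U "x - h"] assms by (auto simp: zero_less_iff_neq_zero)
qed

section \<open>Integration along axis lines\<close>

abbreviation axis_pt :: "'d::finite \<Rightarrow> real \<Rightarrow> 'd torus" where
  "axis_pt \<mu> c \<equiv> to_torus (c *\<^sub>R axis \<mu> 1)"

lemma axis_pt_add: "axis_pt \<mu> (a + b) = axis_pt \<mu> a + axis_pt \<mu> b"
  by (simp add: to_torus_add scaleR_add_left)

lemma to_torus_0 [simp]: "to_torus 0 = 0"
  by (simp add: zero_torus.abs_eq)

lemma to_torus_minus [simp]: "to_torus (- x) = - to_torus x"
  by (simp add: uminus_torus.abs_eq)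

lemma axis_pt_minus: "axis_pt \<mu> (- c) = - axis_pt \<mu> c"
  by simp

lemma continuous_axis_pt [continuous_intros]:
  assumes "continuous_on S f"
  shows "continuous_on S (\<lambda>x. axis_pt \<mu> (f x))"
  by (rule continuous_on_compose2[OF continuous_to_torus[of UNIV]])
     (auto intro!: continuous_intros assms)

lemma line_translate_measurable [measurable]:
  "(\<lambda>(c, p). p + axis_pt \<mu> c) \<in> borel \<Otimes>\<^sub>M borel \<rightarrow>\<^sub>M (borel :: 'd::finite torus measure)"
  "(\<lambda>(c, p). p - axis_pt \<mu> c) \<in> borel \<Otimes>\<^sub>M borel \<rightarrow>\<^sub>M (borel :: 'd::finite torus measure)"
proof -
  have "continuous_on UNIV (\<lambda>x. snd x + axis_pt \<mu> (fst x) :: 'd torus)"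
    by (intro continuous_intros)
  then show "(\<lambda>(c, p). p + axis_pt \<mu> c) \<in> borel \<Otimes>\<^sub>M borel \<rightarrow>\<^sub>M (borel :: 'd torus measure)"
    by (simp add: borel_prod borel_measurable_continuous_onI case_prod_beta')
  have "continuous_on UNIV (\<lambda>x. snd x + axis_pt \<mu> (- fst x) :: 'd torus)"
    by (intro continuous_intros)
  then show "(\<lambda>(c, p). p - axis_pt \<mu> c) \<in> borel \<Otimes>\<^sub>M borel \<rightarrow>\<^sub>M (borel :: 'd torus measure)"
    by (simp add: borel_prod borel_measurable_continuous_onI case_prod_beta' axis_pt_minus)
qed

lemma set_integrable_Icc_bounded:
  fixes g :: "real \<Rightarrow> 'e::{banach, second_countable_topology}"
  assumes "g \<in> borel_measurable borel" "\<And>c. norm (g c) \<le> K"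
  shows "set_integrable lborel {a..b} g"
  unfolding set_integrable_def
  by (rule integrableI_bounded_set[where A = "{a..b}" and B = K])
     (use assms in \<open>auto simp: emeasure_lborel_Icc_eq\<close>)

lemma norm_integral_le:
  fixes f :: "'a \<Rightarrow> 'e::{banach, second_countable_topology}"
  assumes "integrable M g" "\<And>x. norm (f x) \<le> g x"
  shows "norm (LINT x|M. f x) \<le> (LINT x|M. g x)"
proof -
  have "norm (LINT x|M. f x) \<le> (LINT x|M. norm (f x))" by (rule integral_norm_bound)
  also have "\<dots> \<le> (LINT x|M. g x)"
    using assms by (intro integral_mono') (auto intro: order_trans[OF norm_ge_zero])
  finally show ?thesis .
qed

lemma norm_set_integral_Icc_le:
  fixes g :: "real \<Rightarrow> 'e::{banach, second_countable_topology}"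
  assumes "\<And>c. c \<in> {0..s} \<Longrightarrow> norm (g c) \<le> K" "0 \<le> s" "0 \<le> K"
  shows "norm (LINT c:{0..s}|lborel. g c) \<le> K * s"
proof -
  have "norm (LINT c:{0..s}|lborel. g c) \<le> (LINT c|lborel. K * indicator {0..s} c)"
    unfolding set_lebesgue_integral_def
  proof (rule norm_integral_le)
    show "integrable lborel (\<lambda>c. K * indicator {0..s} c)"
      by (intro integrable_mult_right integrable_real_indicator) (auto simp: emeasure_lborel_Icc_eq)
  qed (use assms in \<open>auto simp: indicator_def\<close>)
  then show ?thesis using assms by simp
qed

lemma fubini_Icc_torus:
  fixes G :: "real \<Rightarrow> 'd::finite torus \<Rightarrow> 'e::{banach, second_countable_topology}"
  assumes G [measurable]: "(\<lambda>(c, p). G c p) \<in> borel_measurable (borel \<Otimes>\<^sub>M borel)"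
    and bound: "\<And>c p. norm (G c p) \<le> K"
  shows "(LINT c:{0..s}|lborel. LINT p|torus_measure. G c p) =
      (LINT p|torus_measure. (LINT c:{0..s}|lborel. G c p))"
proof -
  interpret pair_sigma_finite "lborel :: real measure" "torus_measure :: 'd torus measure" ..
  have "integrable (lborel \<Otimes>\<^sub>M torus_measure) (\<lambda>(c, p). indicator {0..s} c *\<^sub>R G c p)"
  proof (rule integrableI_bounded_set[where A = "{0..s} \<times> UNIV" and B = K])
    show "emeasure (lborel \<Otimes>\<^sub>M torus_measure) ({0..s} \<times> (UNIV :: 'd torus set)) < \<infinity>"
      by (subst torus_measure.emeasure_pair_measure_Times) (auto simp: emeasure_lborel_Icc_eq)
  qed (use bound in \<open>auto simp: indicator_def\<close>)
  from Fubini_integral[OF this]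
  show ?thesis unfolding set_lebesgue_integral_def
    by (simp del: Bochner_Integration.integral_scaleR_right
        add: Bochner_Integration.integral_scaleR_right[symmetric])
qed

lemma line_integral_borel:
  fixes F :: "'d::finite torus \<Rightarrow> 'e::{banach, second_countable_topology}"
  assumes F: "F \<in> borel_measurable borel"
  shows "(\<lambda>p. LINT c:{0..s}|lborel. F (p + axis_pt \<mu> c)) \<in> borel_measurable borel"
proof -
  have "(\<lambda>(p, c). indicator {0..s} c *\<^sub>R F (p + axis_pt \<mu> c)) \<in> borel_measurable (borel \<Otimes>\<^sub>M lborel)"
    using measurable_compose[OF measurable_pair_swap' measurable_compose[OF line_translate_measurable(1) F, of \<mu>]]
    by (simp add: case_prod_beta')
  then show ?thesis unfolding set_lebesgue_integral_def
    by (rule lborel.borel_measurable_lebesgue_integral)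
qed

text \<open>
  Fubini's theorem and translation invariance move the shift along the line from \<open>F\<close> to \<open>f\<close>:
  averaging a form along a line is dual to averaging the test function in the opposite direction.
\<close>

lemma integral_line_average:
  fixes F :: "'d::finite torus \<Rightarrow> 'e::{banach, second_countable_topology}"
  assumes f [measurable]: "f \<in> borel_measurable borel" and fb: "bounded (range f)"
    and F [measurable]: "F \<in> borel_measurable borel" and Fb: "bounded (range F)"
  shows "(LINT p|torus_measure. f p *\<^sub>R (LINT c:{0..s}|lborel. F (p + axis_pt \<mu> c))) =
      (LINT c:{0..s}|lborel. LINT p|torus_measure. f (p - axis_pt \<mu> c) *\<^sub>R F p)"
proof -
  obtain K L where K: "\<And>p. \<bar>f p\<bar> \<le> K" and L: "\<And>p. norm (F p) \<le> L"
    using fb Fb by (auto simp: bounded_iff)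
  have "0 \<le> K" using K[of 0] by linarith
  then have bound: "norm (f p *\<^sub>R F q) \<le> K * L" for p q
    using mult_mono[OF K[of p] L[of q]] by simp
  have m [measurable]: "(\<lambda>(c, p). f p *\<^sub>R F (p + axis_pt \<mu> c)) \<in> borel_measurable (borel \<Otimes>\<^sub>M borel)"
    using measurable_compose[OF line_translate_measurable(1) F, of \<mu>] by (simp add: case_prod_beta')
  have "(LINT p|torus_measure. f p *\<^sub>R (LINT c:{0..s}|lborel. F (p + axis_pt \<mu> c))) =
      (LINT p|torus_measure. (LINT c:{0..s}|lborel. f p *\<^sub>R F (p + axis_pt \<mu> c)))"
    by (simp add: set_lebesgue_integral_def Bochner_Integration.integral_scaleR_right[symmetric]
        scaleR_left_commute del: Bochner_Integration.integral_scaleR_right)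
  also have "\<dots> = (LINT c:{0..s}|lborel. LINT p|torus_measure. f p *\<^sub>R F (p + axis_pt \<mu> c))"
    by (rule fubini_Icc_torus[OF m bound, symmetric])
  also have "(\<lambda>c. LINT p|torus_measure. f p *\<^sub>R F (p + axis_pt \<mu> c)) =
      (\<lambda>c. LINT p|torus_measure. f (p - axis_pt \<mu> c) *\<^sub>R F p)"
  proof
    fix c
    have [measurable]: "(\<lambda>p. f (p - axis_pt \<mu> c)) \<in> borel_measurable borel"
      using measurable_compose[OF translate_borel f, of "- axis_pt \<mu> c"] by simp
    show "(LINT p|torus_measure. f p *\<^sub>R F (p + axis_pt \<mu> c)) =
        (LINT p|torus_measure. f (p - axis_pt \<mu> c) *\<^sub>R F p)"
      using integral_torus_translate[of "\<lambda>p. f (p - axis_pt \<mu> c) *\<^sub>R F p" "axis_pt \<mu> c"] by simp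
  qed
  finally show ?thesis .
qed

section \<open>Derivatives of test functions and pairings\<close>

definition torus_partial :: "'d::finite \<Rightarrow> ('d torus \<Rightarrow> real) \<Rightarrow> 'd torus \<Rightarrow> real" where
  "torus_partial \<mu> \<phi> p = deriv (\<lambda>t. \<phi> (p + axis_pt \<mu> t)) 0"

lemma partial_to_torus: "partial \<mu> (\<phi> \<circ> to_torus) x = torus_partial \<mu> \<phi> (to_torus x)"
  by (simp add: partial_def torus_partial_def to_torus_add)

lemma differentiable_imp_continuous_UNIV:
  "(\<And>x. f differentiable (at x)) \<Longrightarrow> continuous_on UNIV f"
  by (auto intro!: differentiable_imp_continuous_on simp: differentiable_on_def)

lemma test_fun_continuous:
  assumes "\<phi> \<in> test_funs"
  shows "continuous_on UNIV \<phi>" "continuous_on UNIV (torus_partial \<mu> \<phi>)"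
proof -
  have d: "iter_partial is (\<phi> \<circ> to_torus) differentiable (at x)" for "is" x
    using assms by (simp add: test_funs_def smooth_def)
  have "continuous_on UNIV (\<phi> \<circ> to_torus)"
    using d[of "[]"] by (intro differentiable_imp_continuous_UNIV) (simp add: iter_partial_def)
  then show "continuous_on UNIV \<phi>" by (simp add: continuous_on_torus_iff comp_def)
  have "continuous_on UNIV (partial \<mu> (\<phi> \<circ> to_torus))"
    using d[of "[\<mu>]"] by (intro differentiable_imp_continuous_UNIV) (simp add: iter_partial_def)
  then have "continuous_on UNIV (\<lambda>x. torus_partial \<mu> \<phi> (to_torus x))"
    by (simp add: partial_to_torus)
  then show "continuous_on UNIV (torus_partial \<mu> \<phi>)" by (simp add: continuous_on_torus_iff)
qed

lemma test_fun_has_derivative: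
  assumes "\<phi> \<in> test_funs"
  shows "((\<lambda>t. \<phi> (p + axis_pt \<mu> t)) has_real_derivative torus_partial \<mu> \<phi> (p + axis_pt \<mu> t)) (at t)"
proof -
  obtain x where x: "p = to_torus x" using ex_to_torus by blast
  define y where "y = x + t *\<^sub>R axis \<mu> 1"
  have "iter_partial [] (\<phi> \<circ> to_torus) differentiable (at z)" for z
    using assms by (simp add: test_funs_def smooth_def)
  then have "(\<phi> \<circ> to_torus) differentiable (at z)" for z by (simp add: iter_partial_def)
  moreover have "(\<lambda>s. y + s *\<^sub>R axis \<mu> 1) differentiable (at 0)"
    by (intro derivative_intros)
  ultimately have "((\<phi> \<circ> to_torus) \<circ> (\<lambda>s. y + s *\<^sub>R axis \<mu> 1)) differentiable (at 0)"
    by (intro differentiable_chain_at)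
  then have "((\<lambda>s. \<phi> (p + axis_pt \<mu> t + axis_pt \<mu> s)) differentiable (at 0))"
    by (simp add: comp_def y_def x to_torus_add[symmetric] add.assoc)
  then have "((\<lambda>s. \<phi> (p + axis_pt \<mu> t + axis_pt \<mu> s)) has_real_derivative
      torus_partial \<mu> \<phi> (p + axis_pt \<mu> t)) (at 0)"
    by (simp add: torus_partial_def DERIV_deriv_iff_real_differentiable)
  then have "((\<lambda>s. \<phi> (p + axis_pt \<mu> (s + t))) has_real_derivative
      torus_partial \<mu> \<phi> (p + axis_pt \<mu> t)) (at 0)"
    by (simp add: axis_pt_add ac_simps)
  then show ?thesis
    using DERIV_shift[of "\<lambda>t. \<phi> (p + axis_pt \<mu> t)" "torus_partial \<mu> \<phi> (p + axis_pt \<mu> t)" 0 t] by simp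
qed

lemma iter_partial_translate:
  "iter_partial is (\<lambda>x. f (x + a)) = (\<lambda>x. iter_partial is f (x + a))"
  by (induction "is") (auto simp: iter_partial_def partial_def fun_eq_iff ac_simps)

lemma test_fun_translate:
  assumes "\<phi> \<in> test_funs"
  shows "(\<lambda>p. \<phi> (p - q)) \<in> test_funs"
proof -
  obtain a where a: "q = to_torus a" using ex_to_torus by blast
  have "iter_partial is ((\<lambda>p. \<phi> (p - q)) \<circ> to_torus) differentiable (at x)" for "is" x
  proof -
    have "(\<lambda>p. \<phi> (p - q)) \<circ> to_torus = (\<lambda>x. (\<phi> \<circ> to_torus) (x + (- a)))"
      by (simp add: fun_eq_iff a to_torus_diff)
    then have "iter_partial is ((\<lambda>p. \<phi> (p - q)) \<circ> to_torus) =
        iter_partial is (\<phi> \<circ> to_torus) \<circ> (\<lambda>x. x + (- a))"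
      by (simp only: iter_partial_translate) (simp add: comp_def)
    moreover have "(iter_partial is (\<phi> \<circ> to_torus) \<circ> (\<lambda>x. x + (- a))) differentiable (at x)"
      using assms by (intro differentiable_chain_at derivative_intros) (simp add: test_funs_def smooth_def)
    ultimately show ?thesis by simp
  qed
  then show ?thesis by (simp add: test_funs_def smooth_def)
qed

lemma torus_partial_translate:
  "torus_partial \<mu> (\<lambda>p. \<phi> (p - q)) p = torus_partial \<mu> \<phi> (p - q)"
  by (simp add: torus_partial_def algebra_simps)

lemma test_fun_borel: "\<phi> \<in> test_funs \<Longrightarrow> \<phi> \<in> borel_measurable borel"
  by (intro borel_measurable_continuous_onI test_fun_continuous)

lemma torus_partial_borel: "\<phi> \<in> test_funs \<Longrightarrow> torus_partial \<mu> \<phi> \<in> borel_measurable borel"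
  by (intro borel_measurable_continuous_onI test_fun_continuous)

lemma bounded_test_fun: "\<phi> \<in> test_funs \<Longrightarrow> bounded (range \<phi>)"
  by (intro bounded_continuous_torus test_fun_continuous)

lemma bounded_torus_partial: "\<phi> \<in> test_funs \<Longrightarrow> bounded (range (torus_partial \<mu> \<phi>))"
  by (intro bounded_continuous_torus test_fun_continuous)

lemma test_fun_FTC:
  assumes \<phi>: "\<phi> \<in> test_funs" and s: "0 \<le> s"
  shows "(LINT c:{0..s}|lborel. torus_partial \<mu> \<phi> (p - axis_pt \<mu> c)) = \<phi> p - \<phi> (p - axis_pt \<mu> s)"
proof -
  have D: "((\<lambda>c. - \<phi> (p - axis_pt \<mu> c)) has_real_derivative torus_partial \<mu> \<phi> (p - axis_pt \<mu> c)) (at c)" for c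
    using DERIV_minus[OF DERIV_chain'[OF DERIV_minus[OF DERIV_ident] test_fun_has_derivative[OF \<phi>, of p \<mu>]], of c]
    by (simp add: axis_pt_minus)
  have "continuous_on UNIV (\<lambda>c. torus_partial \<mu> \<phi> (p + axis_pt \<mu> (- c)))"
    by (rule continuous_on_compose2[OF test_fun_continuous(2)[OF \<phi>]]) (auto intro!: continuous_intros)
  then have "continuous_on {0..s} (\<lambda>c. torus_partial \<mu> \<phi> (p - axis_pt \<mu> c))"
    by (auto simp: axis_pt_minus intro: continuous_on_subset)
  with D s show ?thesis unfolding set_lebesgue_integral_def
    by (subst integral_FTC_atLeastAtMost[where F = "\<lambda>c. - \<phi> (p - axis_pt \<mu> c)"])
       (auto simp: has_real_derivative_iff_has_vector_derivative[symmetric] intro: DERIV_subset)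
qed

text \<open>
  Write \<open>L s p\<close> for the integral of \<open>F\<close> over the segment of length \<open>s\<close> from \<open>p\<close>, and \<open>\<phi>\<^sub>s\<close> for
  the translate of \<open>\<phi>\<close> by \<open>s\<close>. By duality and the fundamental theorem of calculus,
  \<open>\<integral> \<partial>\<phi> \<cdot> L s = \<langle>F, \<phi>\<rangle> - \<langle>F, \<phi>\<^sub>s\<rangle>\<close>, while the integral of \<open>\<langle>F, \<phi>\<^sub>s\<rangle>\<close> over \<open>0 \<le> s \<le> h\<close> is
  \<open>\<integral> \<phi> \<cdot> L h\<close>. Integrating the first identity over \<open>s\<close> therefore expresses \<open>h \<cdot> \<langle>F, \<phi>\<rangle>\<close> through line
  integrals of \<open>F\<close> alone.
\<close>

lemma test_pairing_bound:
  fixes F :: "'d::finite torus \<Rightarrow> 'e::{banach, second_countable_topology}"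
  assumes F [measurable]: "F \<in> borel_measurable borel" and Fb: "bounded (range F)"
    and \<phi>: "\<phi> \<in> test_funs" and h: "0 < h" and N: "0 \<le> N"
    and line: "\<And>p s. 0 \<le> s \<Longrightarrow> s \<le> h \<Longrightarrow> norm (LINT c:{0..s}|lborel. F (p + axis_pt \<mu> c)) \<le> N"
  shows "h * norm (LINT p|torus_measure. \<phi> p *\<^sub>R F p) \<le>
    N * ((LINT p|torus_measure. \<bar>\<phi> p\<bar>) + h * (LINT p|torus_measure. \<bar>torus_partial \<mu> \<phi> p\<bar>))"
proof -
  have [measurable]: "\<phi> \<in> borel_measurable borel" "torus_partial \<mu> \<phi> \<in> borel_measurable borel"
    using \<phi> test_fun_borel torus_partial_borel by blast+
  define L where "L s p = (LINT c:{0..s}|lborel. F (p + axis_pt \<mu> c))" for s p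
  define J where "J s = (LINT p|torus_measure. \<phi> (p - axis_pt \<mu> s) *\<^sub>R F p)" for s
  define I where "I = (LINT p|torus_measure. \<phi> p *\<^sub>R F p)"
  obtain K where K: "\<And>p. norm (F p) \<le> K" using Fb by (auto simp: bounded_iff)
  obtain C where C: "\<And>p. \<bar>\<phi> p\<bar> \<le> C" using bounded_test_fun[OF \<phi>] by (auto simp: bounded_iff)
  obtain D where D: "\<And>p. \<bar>torus_partial \<mu> \<phi> p\<bar> \<le> D"
    using bounded_torus_partial[OF \<phi>] by (auto simp: bounded_iff)
  have CD: "0 \<le> C" "0 \<le> D" "0 \<le> K"
    using order_trans[OF abs_ge_zero C] order_trans[OF abs_ge_zero D] order_trans[OF norm_ge_zero K] by auto
  have m: "(\<lambda>(c, p). g (p - axis_pt \<mu> c) *\<^sub>R F p) \<in> borel_measurable (borel \<Otimes>\<^sub>M borel)"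
    if [measurable]: "g \<in> borel_measurable borel" for g :: "'d torus \<Rightarrow> real"
    using measurable_compose[OF line_translate_measurable(2) that, of \<mu>] by (simp add: case_prod_beta')
  have int: "integrable torus_measure (\<lambda>p. \<phi> (p - q) *\<^sub>R F p)" for q
  proof (rule torus_measure.integrable_const_bound[of _ "C * K"])
    show "AE p in torus_measure. norm (\<phi> (p - q) *\<^sub>R F p) \<le> C * K"
      using C K CD by (auto intro!: mult_mono)
    show "(\<lambda>p. \<phi> (p - q) *\<^sub>R F p) \<in> borel_measurable torus_measure"
      using measurable_compose[OF translate_borel, of \<phi> borel "- q"] by simp
  qed
  have part: "(LINT p|torus_measure. torus_partial \<mu> \<phi> p *\<^sub>R L s p) = I - J s" if s: "0 \<le> s" for s
  proof -
    have "(LINT p|torus_measure. torus_partial \<mu> \<phi> p *\<^sub>R L s p) =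
        (LINT c:{0..s}|lborel. LINT p|torus_measure. torus_partial \<mu> \<phi> (p - axis_pt \<mu> c) *\<^sub>R F p)"
      unfolding L_def by (rule integral_line_average) (use Fb bounded_torus_partial[OF \<phi>] in auto)
    also have "\<dots> = (LINT p|torus_measure. (LINT c:{0..s}|lborel. torus_partial \<mu> \<phi> (p - axis_pt \<mu> c) *\<^sub>R F p))"
      by (rule fubini_Icc_torus[where K = "D * K"]) (use m D K CD in \<open>auto intro!: mult_mono\<close>)
    also have "\<dots> = (LINT p|torus_measure. (\<phi> p - \<phi> (p - axis_pt \<mu> s)) *\<^sub>R F p)"
    proof (rule Bochner_Integration.integral_cong[OF refl])
      fix p
      have "continuous_on UNIV (\<lambda>c. torus_partial \<mu> \<phi> (p + axis_pt \<mu> (- c)))"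
        by (rule continuous_on_compose2[OF test_fun_continuous(2)[OF \<phi>]]) (auto intro!: continuous_intros)
      then have "set_integrable lborel {0..s} (\<lambda>c. torus_partial \<mu> \<phi> (p - axis_pt \<mu> c))"
        using D by (intro set_integrable_Icc_bounded[where K = D])
          (auto simp: axis_pt_minus intro: borel_measurable_continuous_onI)
      then have "(LINT c:{0..s}|lborel. torus_partial \<mu> \<phi> (p - axis_pt \<mu> c) *\<^sub>R F p) =
          (LINT c:{0..s}|lborel. torus_partial \<mu> \<phi> (p - axis_pt \<mu> c)) *\<^sub>R F p"
        unfolding set_lebesgue_integral_def set_integrable_def by simp
      then show "(LINT c:{0..s}|lborel. torus_partial \<mu> \<phi> (p - axis_pt \<mu> c) *\<^sub>R F p) =
          (\<phi> p - \<phi> (p - axis_pt \<mu> s)) *\<^sub>R F p"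
        by (simp add: test_fun_FTC[OF \<phi> s])
    qed
    also have "\<dots> = I - J s"
      unfolding I_def J_def scaleR_diff_left
      using int[of 0] int by (intro Bochner_Integration.integral_diff) auto
    finally show ?thesis .
  qed
  have J_int: "set_integrable lborel {0..h} J"
  proof (rule set_integrable_Icc_bounded)
    show "J \<in> borel_measurable borel"
      unfolding J_def by (rule torus_measure.borel_measurable_lebesgue_integral) (use m in simp)
    show "norm (J c) \<le> C * K" for c
      unfolding J_def
    proof (rule order_trans[OF integral_norm_bound])
      have "(LINT p|torus_measure. norm (\<phi> (p - axis_pt \<mu> c) *\<^sub>R F p)) \<le> (LINT p|(torus_measure :: 'd torus measure). C * K)"
        using C K CD by (intro integral_mono integrable_norm int) (auto intro!: mult_mono)
      then show "(LINT p|torus_measure. norm (\<phi> (p - axis_pt \<mu> c) *\<^sub>R F p)) \<le> C * K"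
        by simp
    qed
  qed
  have pair: "norm (LINT p|torus_measure. f p *\<^sub>R L s p) \<le> N * (LINT p|torus_measure. \<bar>f p\<bar>)"
    if [measurable]: "f \<in> borel_measurable borel" and f: "bounded (range f)" and s: "0 \<le> s" "s \<le> h" for f s
  proof -
    have fi: "integrable torus_measure f" using that by (intro integrable_torus_bounded)
    have "norm (f p *\<^sub>R L s p) \<le> N * \<bar>f p\<bar>" for p
      using mult_left_mono[OF line[OF s, of p], of "\<bar>f p\<bar>"] by (simp add: L_def mult.commute)
    then have "norm (LINT p|torus_measure. f p *\<^sub>R L s p) \<le> (LINT p|torus_measure. N * \<bar>f p\<bar>)"
      using fi N by (intro norm_integral_le) auto
    then show ?thesis by simp
  qed
  have hI: "h *\<^sub>R I = (LINT s:{0..h}|lborel. I - J s) + (LINT s:{0..h}|lborel. J s)"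
  proof -
    have "set_integrable lborel {0..h} (\<lambda>s. I)" by (rule set_integrable_Icc_bounded) auto
    then have "(LINT s:{0..h}|lborel. I - J s) + (LINT s:{0..h}|lborel. J s) = (LINT s:{0..h}|lborel. I)"
      using J_int by (simp add: set_integral_diff)
    also have "\<dots> = h *\<^sub>R I" using h unfolding set_lebesgue_integral_def by simp
    finally show ?thesis by simp
  qed
  have "norm (LINT s:{0..h}|lborel. I - J s) \<le> N * (LINT p|torus_measure. \<bar>torus_partial \<mu> \<phi> p\<bar>) * h"
  proof (rule norm_set_integral_Icc_le)
    show "norm (I - J s) \<le> N * (LINT p|torus_measure. \<bar>torus_partial \<mu> \<phi> p\<bar>)" if "s \<in> {0..h}" for s
      using pair[of "torus_partial \<mu> \<phi>" s] that part[of s] bounded_torus_partial[OF \<phi>] by simp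
  qed (use h N in auto)
  moreover have "norm (LINT s:{0..h}|lborel. J s) \<le> N * (LINT p|torus_measure. \<bar>\<phi> p\<bar>)"
  proof -
    have "(LINT s:{0..h}|lborel. J s) = (LINT p|torus_measure. \<phi> p *\<^sub>R L h p)"
      unfolding L_def J_def
      by (rule integral_line_average[symmetric]) (use Fb bounded_test_fun[OF \<phi>] in auto)
    then show ?thesis using pair[of \<phi> h] h bounded_test_fun[OF \<phi>] by simp
  qed
  ultimately have "norm (h *\<^sub>R I) \<le> N * (LINT p|torus_measure. \<bar>torus_partial \<mu> \<phi> p\<bar>) * h + N * (LINT p|torus_measure. \<bar>\<phi> p\<bar>)"
    unfolding hI by (intro norm_triangle_le add_mono)
  then show ?thesis using h by (simp add: I_def algebra_simps)
qed

section \<open>Smooth functions and density of test functions\<close>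

lemma partial_has_derivative:
  assumes "f differentiable (at x)"
  shows "((\<lambda>t. f (x + t *\<^sub>R axis i 1)) has_real_derivative partial i f x) (at 0)"
proof -
  have "(\<lambda>t. x + t *\<^sub>R axis i 1) differentiable (at (0::real))" by (intro derivative_intros)
  then have "(f \<circ> (\<lambda>t. x + t *\<^sub>R axis i 1)) differentiable (at 0)"
    using assms by (intro differentiable_chain_at) auto
  then show ?thesis by (simp add: partial_def comp_def DERIV_deriv_iff_real_differentiable)
qed

text \<open>
  Exhibiting a set closed under partial derivatives replaces the computation of iterated ones.
\<close>

lemma smooth_coinduct:
  assumes "f \<in> S"
    and "\<And>g x. g \<in> S \<Longrightarrow> g differentiable (at x)"
    and "\<And>g i. g \<in> S \<Longrightarrow> partial i g \<in> S"
  shows "smooth f"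
proof -
  have "iter_partial is f \<in> S" for "is"
    by (induction "is") (use assms in \<open>auto simp: iter_partial_def\<close>)
  then show ?thesis using assms by (auto simp: smooth_def)
qed

lemma smooth_differentiable: "smooth f \<Longrightarrow> f differentiable (at x)"
  by (auto simp: smooth_def iter_partial_def dest: spec[of _ "[]"])

lemma smooth_partial: "smooth f \<Longrightarrow> smooth (partial i f)"
proof -
  assume "smooth f"
  moreover have "iter_partial is (partial i f) = iter_partial (is @ [i]) f" for "is"
    by (simp add: iter_partial_def)
  ultimately show ?thesis by (simp add: smooth_def)
qed

text \<open>
  A derivative of a product is a sum of products, so the set closed under partial derivatives has to
  contain all sums of products of smooth functions.
\<close>

inductive_set smooth_algebra :: "(real^'d::finite \<Rightarrow> real) set" where
  base: "smooth f \<Longrightarrow> f \<in> smooth_algebra"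
| add: "f \<in> smooth_algebra \<Longrightarrow> g \<in> smooth_algebra \<Longrightarrow> (\<lambda>x. f x + g x) \<in> smooth_algebra"
| mult: "f \<in> smooth_algebra \<Longrightarrow> g \<in> smooth_algebra \<Longrightarrow> (\<lambda>x. f x * g x) \<in> smooth_algebra"

lemma smooth_algebra_smooth:
  assumes "f \<in> smooth_algebra"
  shows "smooth f"
proof (rule smooth_coinduct[OF assms])
  show d: "g differentiable (at x)" if "g \<in> smooth_algebra" for g :: "real^'a \<Rightarrow> real" and x
    using that by induction (auto simp: smooth_differentiable)
  show "partial i g \<in> smooth_algebra" if "g \<in> smooth_algebra" for g :: "real^'a \<Rightarrow> real" and i
    using that
  proof induction
    case (base f)
    then show ?case by (intro smooth_algebra.base smooth_partial)
  next
    case (add f g)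
    have "partial i (\<lambda>x. f x + g x) = (\<lambda>x. partial i f x + partial i g x)"
    proof
      fix x
      have "((\<lambda>t. f (x + t *\<^sub>R axis i 1) + g (x + t *\<^sub>R axis i 1)) has_real_derivative
          partial i f x + partial i g x) (at 0)"
        using add by (intro DERIV_add partial_has_derivative d)
      then show "partial i (\<lambda>x. f x + g x) x = partial i f x + partial i g x"
        by (simp add: partial_def[of i "\<lambda>x. f x + g x"] DERIV_imp_deriv)
    qed
    then show ?case using add by (simp add: smooth_algebra.add)
  next
    case (mult f g)
    have "partial i (\<lambda>x. f x * g x) = (\<lambda>x. partial i f x * g x + partial i g x * f x)"
    proof
      fix x
      have "((\<lambda>t. f (x + t *\<^sub>R axis i 1) * g (x + t *\<^sub>R axis i 1)) has_real_derivative
          partial i f x * g (x + 0 *\<^sub>R axis i 1) + partial i g x * f (x + 0 *\<^sub>R axis i 1)) (at 0)"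
        using mult by (intro DERIV_mult partial_has_derivative d)
      then show "partial i (\<lambda>x. f x * g x) x = partial i f x * g x + partial i g x * f x"
        by (simp add: partial_def[of i "\<lambda>x. f x * g x"] DERIV_imp_deriv)
    qed
    then show ?case using mult by (simp add: smooth_algebra.add smooth_algebra.mult)
  qed
qed

text \<open>
  With a free amplitude and phase these waves are closed under partial derivatives, since
  differentiation shifts the phase of a cosine by \<open>pi / 2\<close> or annihilates it.
\<close>

lemma smooth_wave: "smooth (\<lambda>x :: real^'d::finite. a * cos (k * x $ j + \<theta>))"
proof (rule smooth_coinduct)
  let ?S = "{\<lambda>x :: real^'d. a * cos (k * x $ j + \<theta>) | a \<theta>. True}"
  show "(\<lambda>x :: real^'d. a * cos (k * x $ j + \<theta>)) \<in> ?S" by blast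
  show d: "g differentiable (at x)" if "g \<in> ?S" for g x
  proof -
    from that obtain a \<theta> where g: "g = (\<lambda>x. a * cos (k * x $ j + \<theta>))" by blast
    have "((\<lambda>x :: real^'d. a * cos (k * x $ j + \<theta>)) has_derivative
        (\<lambda>h. a * (- (k * h $ j) * sin (k * x $ j + \<theta>)))) (at x)"
      by (auto intro!: derivative_eq_intros bounded_linear.has_derivative[OF bounded_linear_vec_nth])
    then show ?thesis unfolding g differentiable_def by blast
  qed
  show "partial i g \<in> ?S" if "g \<in> ?S" for g i
  proof -
    from that obtain a \<theta> where g: "g = (\<lambda>x. a * cos (k * x $ j + \<theta>))" by blast
    have "partial i g = (\<lambda>x. (if i = j then a * k else 0) * cos (k * x $ j + (\<theta> + pi / 2)))"
    proof
      fix x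
      have "((\<lambda>t. g (x + t *\<^sub>R axis i 1)) has_real_derivative
          (if i = j then a * k else 0) * cos (k * x $ j + (\<theta> + pi / 2))) (at 0)"
        unfolding g
        by (auto intro!: derivative_eq_intros simp: axis_def cos_add sin_add algebra_simps)
      then show "partial i g x = (if i = j then a * k else 0) * cos (k * x $ j + (\<theta> + pi / 2))"
        by (simp add: partial_def DERIV_imp_deriv)
    qed
    then show ?thesis by blast
  qed
qed

lemma test_funs_add: "\<phi> \<in> test_funs \<Longrightarrow> \<eta> \<in> test_funs \<Longrightarrow> (\<lambda>p. \<phi> p + \<eta> p) \<in> test_funs"
  using smooth_algebra_smooth[OF smooth_algebra.add[OF smooth_algebra.base smooth_algebra.base]]
  by (auto simp: test_funs_def comp_def)

lemma test_funs_mult: "\<phi> \<in> test_funs \<Longrightarrow> \<eta> \<in> test_funs \<Longrightarrow> (\<lambda>p. \<phi> p * \<eta> p) \<in> test_funs"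
  using smooth_algebra_smooth[OF smooth_algebra.mult[OF smooth_algebra.base smooth_algebra.base]]
  by (auto simp: test_funs_def comp_def)

lemma test_funs_const: "(\<lambda>p. c) \<in> test_funs"
  using smooth_wave[of c 0 _ 0] by (simp add: test_funs_def comp_def)

lemma test_funs_scale: "\<phi> \<in> test_funs \<Longrightarrow> (\<lambda>p. c * \<phi> p) \<in> test_funs"
  using test_funs_mult[OF test_funs_const] .

text \<open>
  If all test functions agree at two points, then so do the waves \<open>cos (2 * pi * x $ j + \<theta>)\<close>; the phases
  \<open>0\<close> and \<open>- pi / 2\<close> determine the coordinates up to integers.
\<close>

lemma test_funs_separate:
  fixes p q :: "'d::finite torus"
  assumes "p \<noteq> q"
  shows "\<exists>\<phi>\<in>test_funs. \<phi> p \<noteq> \<phi> q"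
proof (rule ccontr)
  assume same: "\<not> ?thesis"
  obtain x y where x: "p = to_torus x" and y: "q = to_torus y" using ex_to_torus by metis
  have "x $ j - y $ j \<in> \<int>" for j
  proof -
    have eq: "cos (2 * pi * x $ j + \<theta>) = cos (2 * pi * y $ j + \<theta>)" for \<theta>
    proof -
      have "\<exists>\<phi>. \<forall>z. \<phi> (to_torus z :: 'd torus) = cos (2 * pi * z $ j + \<theta>)"
      proof -
        have "cos (2 * pi * u $ j + \<theta>) = cos (2 * pi * v $ j + \<theta>)"
          if "lattice_rel u v" for u v :: "real^'d"
        proof -
          from that have "u $ j - v $ j \<in> \<int>" by (simp add: lattice_rel_def)
          then obtain n where "u $ j - v $ j = of_int n" by (auto elim: Ints_cases)
          then have u: "2 * pi * u $ j + \<theta> = (2 * pi * v $ j + \<theta>) + 2 * pi * of_int n"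
            by (simp add: algebra_simps)
          show ?thesis unfolding u by (simp add: cos_add[of _ "2 * pi * of_int n"])
        qed
        then have "cos (2 * pi * (rep_torus (to_torus z)) $ j + \<theta>) = cos (2 * pi * z $ j + \<theta>)" for z
          by (metis Quotient_abs_rep Quotient_torus to_torus_eq_iff)
        then show ?thesis by (intro exI[of _ "\<lambda>p. cos (2 * pi * rep_torus p $ j + \<theta>)"]) simp
      qed
      then obtain \<phi> where \<phi>: "\<And>z. \<phi> (to_torus z :: 'd torus) = cos (2 * pi * z $ j + \<theta>)" by blast
      have "\<phi> \<in> test_funs"
        using smooth_wave[of 1 "2 * pi" j \<theta>] by (simp add: test_funs_def comp_def \<phi>)
      then have "\<phi> p = \<phi> q" using same by blast
      then show ?thesis by (simp add: x y \<phi>)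
    qed
    have "cos (2 * pi * x $ j) = cos (2 * pi * y $ j) \<and> sin (2 * pi * x $ j) = sin (2 * pi * y $ j)"
      using eq[of 0] eq[of "- (pi / 2)"] by (simp add: cos_diff)
    then obtain n where "2 * pi * x $ j = 2 * pi * y $ j + 2 * of_int n * pi"
      using sin_cos_eq_iff[of "2 * pi * x $ j" "2 * pi * y $ j"] by auto
    then have "pi * (x $ j - y $ j - of_int n) = 0" by (simp add: algebra_simps)
    then have "x $ j - y $ j = of_int n" by simp
    then show ?thesis by simp
  qed
  then show False using assms by (simp add: x y to_torus_eq_iff lattice_rel_def)
qed

text \<open>
  The Stone-Weierstrass theorem applies to the algebra of test functions on the compact torus.
\<close>

lemma test_funs_dense:
  fixes u :: "'d::finite torus \<Rightarrow> real"
  assumes "continuous_on UNIV u" "0 < e"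
  shows "\<exists>\<phi>\<in>test_funs. \<forall>p. \<bar>u p - \<phi> p\<bar> < e"
proof -
  interpret function_ring_on "test_funs :: ('d torus \<Rightarrow> real) set" UNIV
    by standard
      (blast intro: compact_torus test_fun_continuous(1) test_funs_add test_funs_mult
        test_funs_const test_funs_separate)+
  show ?thesis using Stone_Weierstrass_basic[OF assms] by auto
qed

text \<open>
  The fundamental lemma of the calculus of variations. By density \<open>d\<close> is orthogonal to every continuous
  weight. A tent supported where \<open>d\<close> is close to a nonzero value \<open>d p\<close> has positive integral,
  because open sets have positive measure, and contradicts this.
\<close>

lemma continuous_torus_eq_0I:
  fixes d :: "'d::finite torus \<Rightarrow> 'e::{banach, second_countable_topology}"
  assumes d: "continuous_on UNIV d"
    and zero: "\<And>\<phi>. \<phi> \<in> test_funs \<Longrightarrow> (LINT p|torus_measure. \<phi> p *\<^sub>R d p) = 0"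
  shows "d p = 0"
proof (rule ccontr)
  assume nz: "d p \<noteq> 0"
  define v where "v = norm (d p)"
  have v: "v > 0" using nz by (simp add: v_def)
  obtain r where r: "r > 0" "\<And>q. dist q p < r \<Longrightarrow> dist (d q) (d p) < v / 2"
    using d v unfolding continuous_on_iff by (metis UNIV_I half_gt_zero)
  define u where "u q = max 0 (r - dist q p)" for q
  have uc: "continuous_on UNIV u" unfolding u_def by (intro continuous_intros)
  have u0: "0 \<le> u q" for q by (simp add: u_def)
  have um [measurable]: "u \<in> borel_measurable borel" and dm [measurable]: "d \<in> borel_measurable borel"
    using uc d by (auto intro: borel_measurable_continuous_onI)
  have ub: "bounded (range u)" and db: "bounded (range d)"
    using uc d by (auto intro: bounded_continuous_torus)
  obtain C where C: "\<And>p. norm (d p) \<le> C" using db by (auto simp: bounded_iff)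
  have C0: "0 \<le> C" using order_trans[OF norm_ge_zero C] .
  have int: "integrable torus_measure (\<lambda>q. w q *\<^sub>R f q)"
    if "continuous_on UNIV w" "continuous_on UNIV f" for w and f :: "'d torus \<Rightarrow> 'e"
  proof -
    have "continuous_on UNIV (\<lambda>q. w q *\<^sub>R f q)" using that by (intro continuous_intros)
    then show ?thesis
      by (intro integrable_torus_bounded borel_measurable_continuous_onI bounded_continuous_torus)
  qed
  \<comment> \<open>Orthogonality passes from test functions to the tent by uniform approximation.\<close>
  have ud: "(LINT q|torus_measure. u q *\<^sub>R d q) = 0"
  proof -
    have bound: "norm (LINT q|torus_measure. u q *\<^sub>R d q) \<le> e * C" if "e > 0" for e
    proof -
      from test_funs_dense[OF uc that]
      obtain \<phi> where \<phi>: "\<phi> \<in> test_funs" "\<And>p. \<bar>u p - \<phi> p\<bar> < e" by blast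
      have "(LINT q|torus_measure. u q *\<^sub>R d q) = (LINT q|torus_measure. (u q - \<phi> q) *\<^sub>R d q)"
        using int[OF uc d] int[OF test_fun_continuous(1)[OF \<phi>(1)] d] zero[OF \<phi>(1)]
        by (simp add: scaleR_diff_left)
      also have "norm \<dots> \<le> (LINT q|(torus_measure :: 'd torus measure). e * C)"
      proof (rule norm_integral_le)
        show "norm ((u q - \<phi> q) *\<^sub>R d q) \<le> e * C" for q
          using \<phi>(2)[of q] C[of q] C0 that by (auto intro!: mult_mono)
      qed simp
      finally show ?thesis by simp
    qed
    have "norm (LINT q|torus_measure. u q *\<^sub>R d q) \<le> e" if "e > 0" for e
    proof -
      have "norm (LINT q|torus_measure. u q *\<^sub>R d q) \<le> (e / (C + 1)) * C"
        using that C0 by (intro bound) simp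
      also have "\<dots> \<le> e" using that C0 by (simp add: field_simps)
      finally show ?thesis .
    qed
    then have "norm (LINT q|torus_measure. u q *\<^sub>R d q) \<le> 0" by (meson dense_ge)
    then show ?thesis by simp
  qed
  have ui: "integrable torus_measure u" using um ub by (rule integrable_torus_bounded)
  define I where "I = (LINT q|torus_measure. u q)"
  have "I > 0"
  proof -
    have "I \<noteq> 0"
    proof
      assume "I = 0"
      then have "AE q in torus_measure. u q = 0"
        using integral_nonneg_eq_0_iff_AE[OF ui] u0 by (simp add: I_def)
      then have "emeasure torus_measure {q. u q \<noteq> 0} = 0"
        by (subst (asm) AE_iff_measurable[OF _ refl]) auto
      moreover have "{q. u q \<noteq> 0} = ball p r" by (auto simp: u_def dist_commute max_def)
      ultimately show False using emeasure_torus_open_pos[of "ball p r"] r by auto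
    qed
    moreover have "I \<ge> 0" unfolding I_def using u0 by (intro integral_nonneg_AE) auto
    ultimately show ?thesis by simp
  qed
  have "(LINT q|torus_measure. u q *\<^sub>R (d p - d q)) = I *\<^sub>R d p"
    using int[OF uc d] int[OF uc continuous_on_const[of UNIV "d p"]] ud ui
    by (simp add: scaleR_diff_right I_def)
  moreover have "norm (LINT q|torus_measure. u q *\<^sub>R (d p - d q)) \<le> (LINT q|torus_measure. u q * (v / 2))"
  proof (rule norm_integral_le)
    show "integrable torus_measure (\<lambda>q. u q * (v / 2))" using ui by simp
    show "norm (u q *\<^sub>R (d p - d q)) \<le> u q * (v / 2)" for q
    proof (cases "dist q p < r")
      case True
      then have "norm (d p - d q) \<le> v / 2"
        using r(2)[of q] by (simp add: dist_norm norm_minus_commute)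
      then show ?thesis using mult_left_mono[OF _ u0[of q]] u0[of q] by fastforce
    qed (simp add: u_def)
  qed
  ultimately have "I * v \<le> I * (v / 2)" using \<open>I > 0\<close> by (simp add: v_def I_def[symmetric])
  then show False using \<open>I > 0\<close> v by simp
qed

section \<open>Limits of bounded forms\<close>

lemma ex_seg: "L \<in> segments \<Longrightarrow> \<exists>x \<mu> l. L = seg x \<mu> l \<and> 0 \<le> l \<and> l \<le> 1"
  by (auto simp: segments_def)

lemma gr_norm_le_iff:
  assumes "0 \<le> K"
  shows "gr_norm \<alpha> B \<le> ennreal K \<longleftrightarrow>
    (\<forall>p \<mu> s. 0 < s \<and> s \<le> 1 \<longrightarrow> norm (B (seg p \<mu> s)) \<le> K * s powr \<alpha>)"
proof -
  have "gr_norm \<alpha> B \<le> ennreal K \<longleftrightarrow>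
      (\<forall>L\<in>segments. seg_length L > 0 \<longrightarrow> norm (B L) / seg_length L powr \<alpha> \<le> K)"
    using assms by (auto simp: gr_norm_def SUP_le_iff ennreal_le_iff)
  also have "\<dots> \<longleftrightarrow> (\<forall>p \<mu> s. 0 \<le> s \<and> s \<le> 1 \<longrightarrow> 0 < s \<longrightarrow> norm (B (seg p \<mu> s)) / s powr \<alpha> \<le> K)"
    unfolding segments_def by (auto simp: seg_length_seg) (metis less_eq_real_def seg_length_seg)
  also have "\<dots> \<longleftrightarrow> (\<forall>p \<mu> s. 0 < s \<and> s \<le> 1 \<longrightarrow> norm (B (seg p \<mu> s)) \<le> K * s powr \<alpha>)"
    by (auto simp: divide_le_eq)
  finally show ?thesis .
qed

lemma gr_norm_add:
  fixes B B' :: "'d::finite torus set \<Rightarrow> 'e::real_normed_vector"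
  shows "gr_norm \<alpha> (\<lambda>L. B L + B' L) \<le> gr_norm \<alpha> B + gr_norm \<alpha> B'"
  unfolding gr_norm_def[of \<alpha> "\<lambda>L. B L + B' L"]
proof (rule SUP_least)
  fix L :: "'d torus set" assume L: "L \<in> {L \<in> segments. seg_length L > 0}"
  have "ennreal (norm (B L + B' L) / seg_length L powr \<alpha>) \<le>
      ennreal (norm (B L) / seg_length L powr \<alpha> + norm (B' L) / seg_length L powr \<alpha>)"
    by (intro ennreal_leI) (simp add: add_divide_distrib[symmetric] divide_right_mono norm_triangle_ineq)
  also have "\<dots> = ennreal (norm (B L) / seg_length L powr \<alpha>) + ennreal (norm (B' L) / seg_length L powr \<alpha>)"
    by (intro ennreal_plus) auto
  also have "\<dots> \<le> gr_norm \<alpha> B + gr_norm \<alpha> B'"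
    unfolding gr_norm_def by (intro add_mono SUP_upper L)
  finally show "ennreal (norm (B L + B' L) / seg_length L powr \<alpha>) \<le> gr_norm \<alpha> B + gr_norm \<alpha> B'" .
qed

lemma gr_norm_scale:
  fixes B :: "'d::finite torus set \<Rightarrow> 'e::real_normed_vector"
  shows "gr_norm \<alpha> (\<lambda>L. c *\<^sub>R B L) \<le> ennreal \<bar>c\<bar> * gr_norm \<alpha> B"
  unfolding gr_norm_def[of \<alpha> "\<lambda>L. c *\<^sub>R B L"]
proof (rule SUP_least)
  fix L :: "'d torus set" assume L: "L \<in> {L \<in> segments. seg_length L > 0}"
  have "ennreal (norm (c *\<^sub>R B L) / seg_length L powr \<alpha>) =
      ennreal \<bar>c\<bar> * ennreal (norm (B L) / seg_length L powr \<alpha>)"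
    by (simp add: ennreal_mult[symmetric])
  also have "\<dots> \<le> ennreal \<bar>c\<bar> * gr_norm \<alpha> B"
    unfolding gr_norm_def by (intro mult_left_mono SUP_upper L) simp
  finally show "ennreal (norm (c *\<^sub>R B L) / seg_length L powr \<alpha>) \<le> ennreal \<bar>c\<bar> * gr_norm \<alpha> B" .
qed

lemma gr_norm_lincomb:
  "gr_norm \<alpha> (\<lambda>L. a *\<^sub>R B L + b *\<^sub>R B' L) \<le> ennreal \<bar>a\<bar> * gr_norm \<alpha> B + ennreal \<bar>b\<bar> * gr_norm \<alpha> B'"
  by (rule order_trans[OF gr_norm_add add_mono[OF gr_norm_scale gr_norm_scale]])

lemma gr_norm_0 [simp]: "gr_norm \<alpha> (\<lambda>L. 0) = 0"
  using gr_norm_scale[of \<alpha> 0 "\<lambda>L. 0"] by simp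

lemma gr_le_alpha_norm: "gr_norm \<alpha> B \<le> alpha_norm \<alpha> B"
  by (simp add: alpha_norm_def)

lemma bdd_formsD:
  assumes "A \<in> bdd_forms"
  shows "A \<mu> \<in> borel_measurable borel" "bounded (range (A \<mu>))"
  using assms by (auto simp: bdd_forms_def)

lemma line_measurable [measurable]: "(\<lambda>c. p + axis_pt \<mu> c) \<in> borel \<rightarrow>\<^sub>M borel"
  by (intro borel_measurable_continuous_onI continuous_intros)

lemma bdd_forms_lincomb:
  assumes "A \<in> bdd_forms" "A' \<in> bdd_forms"
  shows "(\<lambda>\<mu> p. a *\<^sub>R A \<mu> p + b *\<^sub>R A' \<mu> p) \<in> bdd_forms"
  unfolding bdd_forms_def
proof safe
  fix \<mu>
  note [measurable] = bdd_formsD(1)[OF assms(1)] bdd_formsD(1)[OF assms(2)]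
  show "(\<lambda>p. a *\<^sub>R A \<mu> p + b *\<^sub>R A' \<mu> p) \<in> borel_measurable borel" by measurable
  obtain K L where K: "\<And>p. norm (A \<mu> p) \<le> K" and L: "\<And>p. norm (A' \<mu> p) \<le> L"
    using bdd_formsD(2)[OF assms(1)] bdd_formsD(2)[OF assms(2)] by (metis bounded_iff rangeI)
  have "norm (a *\<^sub>R A \<mu> p + b *\<^sub>R A' \<mu> p) \<le> \<bar>a\<bar> * K + \<bar>b\<bar> * L" for p
    by (rule norm_triangle_le) (use K L in \<open>auto intro!: add_mono mult_left_mono\<close>)
  then show "bounded (range (\<lambda>p. a *\<^sub>R A \<mu> p + b *\<^sub>R A' \<mu> p))" by (auto simp: bounded_iff)
qed

lemma bdd_form_line_integrable:
  assumes "A \<in> bdd_forms"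
  shows "set_integrable lborel {u..v} (\<lambda>c. A \<mu> (p + axis_pt \<mu> c))"
proof -
  note [measurable] = bdd_formsD(1)[OF assms]
  obtain K where K: "\<And>p. norm (A \<mu> p) \<le> K" using assms by (auto simp: bdd_forms_def bounded_iff)
  show ?thesis by (rule set_integrable_Icc_bounded[where K = K]) (use K in auto)
qed

lemma line_int_lincomb:
  assumes "A \<in> bdd_forms" "A' \<in> bdd_forms"
  shows "line_int (\<lambda>\<mu> p. a *\<^sub>R A \<mu> p + b *\<^sub>R A' \<mu> p) = (\<lambda>L. a *\<^sub>R line_int A L + b *\<^sub>R line_int A' L)"
proof
  fix L :: "'a torus set"
  show "line_int (\<lambda>\<mu> p. a *\<^sub>R A \<mu> p + b *\<^sub>R A' \<mu> p) L = a *\<^sub>R line_int A L + b *\<^sub>R line_int A' L"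
  proof (cases "L \<in> segments")
    case True
    then obtain x \<mu> l where L: "L = seg x \<mu> l" "0 \<le> l" "l \<le> 1" using ex_seg by blast
    show ?thesis
      using bdd_form_line_integrable[OF assms(1), of 0 l \<mu> x] bdd_form_line_integrable[OF assms(2), of 0 l \<mu> x]
      by (simp add: L line_int_seg assms bdd_forms_lincomb set_integral_add)
  qed (simp add: line_int_def)
qed

lemma integrable_test_form:
  assumes "\<phi> \<in> test_funs" "A \<in> bdd_forms"
  shows "integrable torus_measure (\<lambda>p. \<phi> p *\<^sub>R A \<mu> p)"
proof -
  note [measurable] = bdd_formsD(1)[OF assms(2)] test_fun_borel[OF assms(1)]
  obtain K C where K: "\<And>p. norm (A \<mu> p) \<le> K" and C: "\<And>p. \<bar>\<phi> p\<bar> \<le> C"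
    using bdd_formsD(2)[OF assms(2)] bounded_test_fun[OF assms(1)] by (auto simp: bounded_iff) metis
  have "0 \<le> C" using order_trans[OF abs_ge_zero C] .
  then show ?thesis
    by (intro torus_measure.integrable_const_bound[where B = "C * K"]) (use K C in \<open>auto intro!: mult_mono\<close>)
qed

lemma form_distr_lincomb:
  assumes "A \<in> bdd_forms" "A' \<in> bdd_forms"
  shows "form_distr (\<lambda>\<mu> p. a *\<^sub>R A \<mu> p + b *\<^sub>R A' \<mu> p) \<mu> \<phi> =
    a *\<^sub>R form_distr A \<mu> \<phi> + b *\<^sub>R form_distr A' \<mu> \<phi>"
proof (cases "\<phi> \<in> test_funs")
  case True
  then show ?thesis
    using integrable_test_form[OF True assms(1), of \<mu>] integrable_test_form[OF True assms(2), of \<mu>]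
    by (simp add: form_distr_def fun_distr_def scaleR_add_right scaleR_left_commute[of "\<phi> _"]
        del: scaleR_scaleR)
qed (simp add: form_distr_def fun_distr_def)

text \<open>
  The extension of \<^term>\<open>form_distr\<close> by density, as a relation: \<open>T\<close> is a limit of the distributions of
  bounded forms that approximate \<open>D\<close>. Linearity and estimates pass to the limit without reference to
  a choice of the approximating sequence; uniqueness of \<open>T\<close> is then one more estimate. Convergence
  in the seminorm \<^term>\<open>gr_norm\<close> suffices for all of this.
\<close>

definition represents ::
  "real \<Rightarrow> ('d::finite torus set \<Rightarrow> 'e::{banach, second_countable_topology}) \<Rightarrow>
    ('d \<Rightarrow> ('d torus \<Rightarrow> real) \<Rightarrow> 'e) \<Rightarrow> bool" where
  "represents \<alpha> D T \<longleftrightarrow> (\<exists>A. (\<forall>n. A n \<in> bdd_forms) \<and>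
     (\<lambda>n. gr_norm \<alpha> (\<lambda>L. D L - line_int (A n) L)) \<longlonglongrightarrow> 0 \<and>
     (\<forall>\<mu> \<phi>. (\<lambda>n. form_distr (A n) \<mu> \<phi>) \<longlonglongrightarrow> T \<mu> \<phi>))"

text \<open>
  After dropping finitely many terms the distances are finite, hence bounded by a real null sequence.
\<close>

lemma represents_seq:
  assumes "represents \<alpha> D T"
  shows "\<exists>A e. (\<forall>n. A n \<in> bdd_forms) \<and>
    (\<forall>n. gr_norm \<alpha> (\<lambda>L. D L - line_int (A n) L) \<le> ennreal (e n)) \<and> (\<forall>n. 0 \<le> e n) \<and> e \<longlonglongrightarrow> 0 \<and>
    (\<forall>\<mu> \<phi>. (\<lambda>n. form_distr (A n) \<mu> \<phi>) \<longlonglongrightarrow> T \<mu> \<phi>)"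
proof -
  obtain A where A: "\<And>n. A n \<in> bdd_forms" "(\<lambda>n. gr_norm \<alpha> (\<lambda>L. D L - line_int (A n) L)) \<longlonglongrightarrow> 0"
      "\<And>\<mu> \<phi>. (\<lambda>n. form_distr (A n) \<mu> \<phi>) \<longlonglongrightarrow> T \<mu> \<phi>"
    using assms by (auto simp: represents_def)
  have "\<forall>\<^sub>F n in sequentially. gr_norm \<alpha> (\<lambda>L. D L - line_int (A n) L) < 1"
    using A(2) by (rule order_tendstoD) simp
  then obtain N where N: "\<And>n. n \<ge> N \<Longrightarrow> gr_norm \<alpha> (\<lambda>L. D L - line_int (A n) L) < 1"
    by (auto simp: eventually_sequentially)
  define e where "e n = enn2real (gr_norm \<alpha> (\<lambda>L. D L - line_int (A (n + N)) L))" for n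
  show ?thesis
  proof (intro exI[of _ "\<lambda>n. A (n + N)"] exI[of _ e] conjI allI)
    show "A (n + N) \<in> bdd_forms" "0 \<le> e n" for n by (simp_all add: A e_def)
    show "gr_norm \<alpha> (\<lambda>L. D L - line_int (A (n + N)) L) \<le> ennreal (e n)" for n
      using N[of "n + N"] unfolding e_def by (auto simp: ennreal_enn2real_if)
    show "e \<longlonglongrightarrow> 0" unfolding e_def
      using LIMSEQ_ignore_initial_segment[OF A(2), of N] by (intro tendsto_enn2real) auto
    show "(\<lambda>n. form_distr (A (n + N)) \<mu> \<phi>) \<longlonglongrightarrow> T \<mu> \<phi>" for \<mu> \<phi>
      using A(3) by (rule LIMSEQ_ignore_initial_segment)
  qed
qed

lemma represents_bdd_form: "A \<in> bdd_forms \<Longrightarrow> represents \<alpha> (line_int A) (form_distr A)"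
  unfolding represents_def by (intro exI[of _ "\<lambda>_. A"]) simp

lemma represents_lincomb:
  assumes "represents \<alpha> D T" "represents \<alpha> D' T'"
  shows "represents \<alpha> (\<lambda>L. a *\<^sub>R D L + b *\<^sub>R D' L) (\<lambda>\<mu> \<phi>. a *\<^sub>R T \<mu> \<phi> + b *\<^sub>R T' \<mu> \<phi>)"
proof -
  obtain A A' where A: "\<And>n. A n \<in> bdd_forms" "(\<lambda>n. gr_norm \<alpha> (\<lambda>L. D L - line_int (A n) L)) \<longlonglongrightarrow> 0"
      "\<And>\<mu> \<phi>. (\<lambda>n. form_distr (A n) \<mu> \<phi>) \<longlonglongrightarrow> T \<mu> \<phi>"
    and A': "\<And>n. A' n \<in> bdd_forms" "(\<lambda>n. gr_norm \<alpha> (\<lambda>L. D' L - line_int (A' n) L)) \<longlonglongrightarrow> 0"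
      "\<And>\<mu> \<phi>. (\<lambda>n. form_distr (A' n) \<mu> \<phi>) \<longlonglongrightarrow> T' \<mu> \<phi>"
    using assms by (auto simp: represents_def)
  define X where "X n = (\<lambda>\<mu> p. a *\<^sub>R A n \<mu> p + b *\<^sub>R A' n \<mu> p)" for n
  have lim: "(\<lambda>n. ennreal \<bar>a\<bar> * gr_norm \<alpha> (\<lambda>L. D L - line_int (A n) L) +
      ennreal \<bar>b\<bar> * gr_norm \<alpha> (\<lambda>L. D' L - line_int (A' n) L)) \<longlonglongrightarrow> ennreal \<bar>a\<bar> * 0 + ennreal \<bar>b\<bar> * 0"
    using A(2) A'(2) by (intro tendsto_add ennreal_tendsto_cmult) auto
  have "(\<lambda>n. gr_norm \<alpha> (\<lambda>L. (a *\<^sub>R D L + b *\<^sub>R D' L) - line_int (X n) L)) \<longlonglongrightarrow> 0"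
  proof (rule tendsto_sandwich[OF _ _ tendsto_const])
    show "\<forall>\<^sub>F n in sequentially. gr_norm \<alpha> (\<lambda>L. (a *\<^sub>R D L + b *\<^sub>R D' L) - line_int (X n) L) \<le>
        ennreal \<bar>a\<bar> * gr_norm \<alpha> (\<lambda>L. D L - line_int (A n) L) +
        ennreal \<bar>b\<bar> * gr_norm \<alpha> (\<lambda>L. D' L - line_int (A' n) L)"
    proof (intro always_eventually allI)
      fix n
      have "(\<lambda>L. (a *\<^sub>R D L + b *\<^sub>R D' L) - line_int (X n) L) =
          (\<lambda>L. a *\<^sub>R (D L - line_int (A n) L) + b *\<^sub>R (D' L - line_int (A' n) L))"
        by (simp add: X_def line_int_lincomb A A' scaleR_diff_right fun_eq_iff)
      then show "gr_norm \<alpha> (\<lambda>L. (a *\<^sub>R D L + b *\<^sub>R D' L) - line_int (X n) L) \<le>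
        ennreal \<bar>a\<bar> * gr_norm \<alpha> (\<lambda>L. D L - line_int (A n) L) +
        ennreal \<bar>b\<bar> * gr_norm \<alpha> (\<lambda>L. D' L - line_int (A' n) L)"
        by (simp only: gr_norm_lincomb)
    qed
  qed (use lim in auto)
  moreover have "(\<lambda>n. form_distr (X n) \<mu> \<phi>) \<longlonglongrightarrow> a *\<^sub>R T \<mu> \<phi> + b *\<^sub>R T' \<mu> \<phi>" for \<mu> \<phi>
    unfolding X_def using A A' by (simp add: form_distr_lincomb) (intro tendsto_intros; simp)
  moreover have "X n \<in> bdd_forms" for n unfolding X_def using A(1) A'(1) by (rule bdd_forms_lincomb)
  ultimately show ?thesis unfolding represents_def by (intro exI[of _ X]) simp
qed

lemma represents_diff:
  assumes "represents \<alpha> D T" "represents \<alpha> D' T'"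
  shows "represents \<alpha> (\<lambda>L. D L - D' L) (\<lambda>\<mu> \<phi>. T \<mu> \<phi> - T' \<mu> \<phi>)"
  using represents_lincomb[OF assms, of 1 "-1"] by simp

lemma represents_nontest:
  assumes "represents \<alpha> D T" "\<phi> \<notin> test_funs"
  shows "T \<mu> \<phi> = 0"
proof -
  obtain A where "(\<lambda>n. form_distr (A n) \<mu> \<phi>) \<longlonglongrightarrow> T \<mu> \<phi>"
    using assms by (auto simp: represents_def)
  then have "(\<lambda>n::nat. 0) \<longlonglongrightarrow> T \<mu> \<phi>" using assms(2) by (simp add: form_distr_def fun_distr_def)
  then show ?thesis using LIMSEQ_unique tendsto_const by blast
qed

lemma form_distr_bound:
  assumes A: "A \<in> bdd_forms" and K: "gr_norm \<alpha> (line_int A) \<le> ennreal K" "0 \<le> K"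
    and \<phi>: "\<phi> \<in> test_funs" and h: "0 < h" "h \<le> 1" and \<alpha>: "0 < \<alpha>"
  shows "h * norm (form_distr A \<mu> \<phi>) \<le> K * (h powr \<alpha> *
    ((LINT p|torus_measure. \<bar>\<phi> p\<bar>) + h * (LINT p|torus_measure. \<bar>torus_partial \<mu> \<phi> p\<bar>)))"
proof -
  have "norm (LINT c:{0..s}|lborel. A \<mu> (p + axis_pt \<mu> c)) \<le> K * h powr \<alpha>" if s: "0 \<le> s" "s \<le> h" for p s
  proof (cases "s = 0")
    case True
    have "norm (line_int A (seg p \<mu> 0)) = 0"
    proof -
      have "AE c in lborel. indicator {0..0::real} c *\<^sub>R A \<mu> (p + axis_pt \<mu> c) = 0"
        using AE_lborel_singleton[of "0::real"] by (auto elim!: eventually_mono)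
      then have "(LINT c:{0..0}|lborel. A \<mu> (p + axis_pt \<mu> c)) = 0"
        unfolding set_lebesgue_integral_def by (rule integral_eq_zero_AE)
      then show ?thesis using A by (simp add: line_int_seg)
    qed
    then show ?thesis using True A K by (simp add: line_int_seg)
  next
    case False
    then have "norm (line_int A (seg p \<mu> s)) \<le> K * s powr \<alpha>"
      using K s h by (simp add: gr_norm_le_iff)
    also have "\<dots> \<le> K * h powr \<alpha>" using s K \<alpha> by (intro mult_left_mono powr_mono2) auto
    finally show ?thesis using A s h by (simp add: line_int_seg)
  qed
  from test_pairing_bound[OF bdd_formsD[OF A] \<phi> h(1) _ this] K show ?thesis
    using \<phi> by (simp add: form_distr_def fun_distr_def mult.assoc)
qed

text \<open>
  The central estimate. The length \<open>h\<close> is free: \<open>h = 1\<close> gives continuity of \<open>T\<close> on test functions, and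
  \<open>h\<close> equal to the scale of a bump gives the scaling of a distribution of regularity \<open>\<alpha> - 1\<close>.
\<close>

lemma represents_bound:
  assumes D: "represents \<alpha> D T" and K: "gr_norm \<alpha> D \<le> ennreal K" "0 \<le> K"
    and \<phi>: "\<phi> \<in> test_funs" and h: "0 < h" "h \<le> 1" and \<alpha>: "0 < \<alpha>"
  shows "h * norm (T \<mu> \<phi>) \<le> K * (h powr \<alpha> *
    ((LINT p|torus_measure. \<bar>\<phi> p\<bar>) + h * (LINT p|torus_measure. \<bar>torus_partial \<mu> \<phi> p\<bar>)))"
    (is "_ \<le> K * ?Y")
proof -
  obtain A e where A: "\<And>n. A n \<in> bdd_forms"
      "\<And>n. gr_norm \<alpha> (\<lambda>L. D L - line_int (A n) L) \<le> ennreal (e n)" "\<And>n. 0 \<le> e n" "e \<longlonglongrightarrow> 0"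
      "\<And>\<mu> \<phi>. (\<lambda>n. form_distr (A n) \<mu> \<phi>) \<longlonglongrightarrow> T \<mu> \<phi>"
    using represents_seq[OF D] by blast
  show ?thesis
  proof (rule tendsto_le[OF sequentially_bot])
    show "(\<lambda>n. (K + e n) * ?Y) \<longlonglongrightarrow> K * ?Y"
      using tendsto_mult[OF tendsto_add[OF tendsto_const A(4), of K] tendsto_const[of ?Y]] by simp
    show "(\<lambda>n. h * norm (form_distr (A n) \<mu> \<phi>)) \<longlonglongrightarrow> h * norm (T \<mu> \<phi>)"
      by (intro tendsto_intros A)
    show "\<forall>\<^sub>F n in sequentially. h * norm (form_distr (A n) \<mu> \<phi>) \<le> (K + e n) * ?Y"
    proof (intro always_eventually allI)
      fix n
      have "gr_norm \<alpha> (\<lambda>L. 1 *\<^sub>R D L + (-1) *\<^sub>R (D L - line_int (A n) L)) \<le>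
          ennreal \<bar>1\<bar> * gr_norm \<alpha> D + ennreal \<bar>-1\<bar> * gr_norm \<alpha> (\<lambda>L. D L - line_int (A n) L)"
        by (rule gr_norm_lincomb)
      also have "\<dots> \<le> ennreal K + ennreal (e n)" using K A(2)[of n] by (simp add: add_mono)
      finally have "gr_norm \<alpha> (line_int (A n)) \<le> ennreal (K + e n)" using K A(3) by simp
      from form_distr_bound[OF A(1) this _ \<phi> h \<alpha>, of \<mu>] K A(3)[of n]
      show "h * norm (form_distr (A n) \<mu> \<phi>) \<le> (K + e n) * ?Y" by simp
    qed
  qed
qed

text \<open>
  The difference of two limits represents zero, to which the central estimate applies.
\<close>

lemma represents_unique:
  assumes "represents \<alpha> D T" "represents \<alpha> D T'" and \<alpha>: "0 < \<alpha>"
  shows "T = T'"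
proof (intro ext)
  fix \<mu> \<phi>
  have r: "represents \<alpha> (\<lambda>L. D L - D L) (\<lambda>\<mu> \<phi>. T \<mu> \<phi> - T' \<mu> \<phi>)"
    using assms(1,2) by (rule represents_diff)
  show "T \<mu> \<phi> = T' \<mu> \<phi>"
  proof (cases "\<phi> \<in> test_funs")
    case True
    from represents_bound[OF r _ _ True, of 0 1 \<mu>] \<alpha> show ?thesis by simp
  next
    case False
    then show ?thesis using represents_nontest assms(1,2) by metis
  qed
qed

text \<open>
  By linearity and the estimate for bounded forms, the distributions of an approximating sequence are
  Cauchy at every test function.
\<close>

lemma ex_represents:
  assumes D: "D \<in> Omega1 \<alpha>" and \<alpha>: "0 < \<alpha>"
  shows "\<exists>T. represents \<alpha> D T"
proof -
  have "\<exists>A\<in>bdd_forms. alpha_norm \<alpha> (\<lambda>L. D L - line_int A L) < ennreal (1 / Suc n)" for n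
  proof -
    have "\<forall>\<epsilon>>0. \<exists>A\<in>bdd_forms. alpha_norm \<alpha> (line_int A) < \<infinity> \<and>
        alpha_norm \<alpha> (\<lambda>L. D L - line_int A L) < ennreal \<epsilon>"
      using D by (simp add: Omega1_def)
    from this[rule_format, of "1 / Suc n"] show ?thesis by auto
  qed
  then have "\<forall>n. \<exists>A. A \<in> bdd_forms \<and> alpha_norm \<alpha> (\<lambda>L. D L - line_int A L) < ennreal (1 / Suc n)"
    by blast
  from choice[OF this] obtain A where A: "\<And>n. A n \<in> bdd_forms"
      "\<And>n. alpha_norm \<alpha> (\<lambda>L. D L - line_int (A n) L) < ennreal (1 / Suc n)"
    by blast
  define e where "e n = 1 / real (Suc n)" for n
  have gr: "gr_norm \<alpha> (\<lambda>L. D L - line_int (A n) L) \<le> ennreal (e n)" for n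
    using order_trans[OF gr_le_alpha_norm less_imp_le[OF A(2)[of n]]] by (simp add: e_def)
  have e: "e \<longlonglongrightarrow> 0" unfolding e_def by (rule LIMSEQ_Suc[OF lim_1_over_n])
  have e0: "0 \<le> e n" for n by (simp add: e_def)
  have "(\<lambda>n. ennreal (e n)) \<longlonglongrightarrow> 0" using tendsto_ennrealI[OF e] by simp
  then have lim: "(\<lambda>n. gr_norm \<alpha> (\<lambda>L. D L - line_int (A n) L)) \<longlonglongrightarrow> 0"
    by (rule tendsto_sandwich[OF _ _ tendsto_const, rotated -1]) (use gr in auto)
  have "convergent (\<lambda>n. form_distr (A n) \<mu> \<phi>)" for \<mu> \<phi>
  proof (cases "\<phi> \<in> test_funs")
    case True
    define Y where "Y = (LINT p|torus_measure. \<bar>\<phi> p\<bar>) + (LINT p|torus_measure. \<bar>torus_partial \<mu> \<phi> p\<bar>)"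
    have Y: "0 \<le> Y" unfolding Y_def by (intro add_nonneg_nonneg integral_nonneg_AE) auto
    have diff: "norm (form_distr (A m) \<mu> \<phi> - form_distr (A n) \<mu> \<phi>) \<le> (e m + e n) * Y" for m n
    proof -
      define X where "X = (\<lambda>\<mu> p. 1 *\<^sub>R A m \<mu> p + (-1) *\<^sub>R A n \<mu> p)"
      have X: "X \<in> bdd_forms" unfolding X_def using A(1) A(1) by (rule bdd_forms_lincomb)
      have "line_int X = (\<lambda>L. (-1) *\<^sub>R (D L - line_int (A m) L) + 1 *\<^sub>R (D L - line_int (A n) L))"
        unfolding X_def by (subst line_int_lincomb) (auto simp: A(1))
      then have "gr_norm \<alpha> (line_int X) \<le> ennreal \<bar>-1\<bar> * gr_norm \<alpha> (\<lambda>L. D L - line_int (A m) L) +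
          ennreal \<bar>1\<bar> * gr_norm \<alpha> (\<lambda>L. D L - line_int (A n) L)"
        by (simp only: gr_norm_lincomb)
      also have "\<dots> \<le> ennreal (e m) + ennreal (e n)" using gr[of m] gr[of n] by (simp add: add_mono)
      finally have "gr_norm \<alpha> (line_int X) \<le> ennreal (e m + e n)" using e0 by simp
      from form_distr_bound[OF X this _ True zero_less_one _ \<alpha>, of \<mu>] e0[of m] e0[of n]
      have "norm (form_distr X \<mu> \<phi>) \<le> (e m + e n) * Y" by (simp add: Y_def)
      moreover have "form_distr X \<mu> \<phi> = form_distr (A m) \<mu> \<phi> - form_distr (A n) \<mu> \<phi>"
        unfolding X_def by (subst form_distr_lincomb) (auto simp: A(1))
      ultimately show ?thesis by simp
    qed
    have eY: "(\<lambda>n. e n * Y) \<longlonglongrightarrow> 0" using tendsto_mult[OF e tendsto_const[of Y]] by simp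
    have "Cauchy (\<lambda>n. form_distr (A n) \<mu> \<phi>)"
    proof (rule CauchyI)
      fix r :: real assume "0 < r"
      then obtain N where N: "\<And>n. n \<ge> N \<Longrightarrow> \<bar>e n * Y\<bar> < r / 2"
        using LIMSEQ_D[OF eY, of "r / 2"] by auto
      have "norm (form_distr (A m) \<mu> \<phi> - form_distr (A n) \<mu> \<phi>) < r" if "m \<ge> N" "n \<ge> N" for m n
        using diff[of m n] N[OF that(1)] N[OF that(2)] unfolding distrib_right by linarith
      then show "\<exists>M. \<forall>m\<ge>M. \<forall>n\<ge>M. norm (form_distr (A m) \<mu> \<phi> - form_distr (A n) \<mu> \<phi>) < r" by blast
    qed
    then show ?thesis by (simp add: Cauchy_convergent_iff)
  qed (simp add: form_distr_def fun_distr_def convergent_const)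
  then have "(\<lambda>n. form_distr (A n) \<mu> \<phi>) \<longlonglongrightarrow> lim (\<lambda>n. form_distr (A n) \<mu> \<phi>)" for \<mu> \<phi>
    by (simp add: convergent_LIMSEQ_iff)
  then show ?thesis using A(1) lim unfolding represents_def
    by (intro exI[of _ "\<lambda>\<mu> \<phi>. lim (\<lambda>n. form_distr (A n) \<mu> \<phi>)"] exI[of _ A]) simp
qed

lemma represents_distributions:
  assumes D: "represents \<alpha> D T" and fin: "gr_norm \<alpha> D < \<infinity>" and \<alpha>: "0 < \<alpha>"
  shows "T \<mu> \<in> distributions"
proof -
  obtain A where A: "\<And>n. A n \<in> bdd_forms" "\<And>\<mu> \<phi>. (\<lambda>n. form_distr (A n) \<mu> \<phi>) \<longlonglongrightarrow> T \<mu> \<phi>"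
    using D by (auto simp: represents_def)
  have add: "T \<mu> (\<lambda>p. \<phi> p + \<eta> p) = T \<mu> \<phi> + T \<mu> \<eta>" if "\<phi> \<in> test_funs" "\<eta> \<in> test_funs" for \<phi> \<eta>
  proof (rule LIMSEQ_unique[OF A(2)])
    have "form_distr (A n) \<mu> (\<lambda>p. \<phi> p + \<eta> p) = form_distr (A n) \<mu> \<phi> + form_distr (A n) \<mu> \<eta>" for n
      using that integrable_test_form[OF that(1) A(1), of n \<mu>] integrable_test_form[OF that(2) A(1), of n \<mu>]
      by (simp add: form_distr_def fun_distr_def test_funs_add scaleR_add_left)
    then show "(\<lambda>n. form_distr (A n) \<mu> (\<lambda>p. \<phi> p + \<eta> p)) \<longlonglongrightarrow> T \<mu> \<phi> + T \<mu> \<eta>"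
      using tendsto_add[OF A(2)[of \<mu> \<phi>] A(2)[of \<mu> \<eta>]] by simp
  qed
  have scale: "T \<mu> (\<lambda>p. c * \<phi> p) = c *\<^sub>R T \<mu> \<phi>" if "\<phi> \<in> test_funs" for \<phi> c
  proof (rule LIMSEQ_unique[OF A(2)])
    have "form_distr (A n) \<mu> (\<lambda>p. c * \<phi> p) = c *\<^sub>R form_distr (A n) \<mu> \<phi>" for n
      using that by (simp add: form_distr_def fun_distr_def test_funs_scale flip: scaleR_scaleR)
    then show "(\<lambda>n. form_distr (A n) \<mu> (\<lambda>p. c * \<phi> p)) \<longlonglongrightarrow> c *\<^sub>R T \<mu> \<phi>"
      using tendsto_scaleR[OF tendsto_const[of c] A(2)[of \<mu> \<phi>]] by simp
  qed
  obtain K where K: "gr_norm \<alpha> D = ennreal K" "0 \<le> K"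
    using fin by (cases "gr_norm \<alpha> D") auto
  \<comment> \<open>The summand \<open>1\<close> keeps the constant positive, so that its product with an infinite supremum is infinite.\<close>
  have bound: "ennreal (norm (T \<mu> \<phi>)) \<le> ennreal (2 * K + 1) * deriv_sup 1 (\<phi> \<circ> to_torus)"
    if \<phi>: "\<phi> \<in> test_funs" for \<phi>
  proof (cases "deriv_sup 1 (\<phi> \<circ> to_torus)")
    case (real S)
    have le: "\<bar>iter_partial is (\<phi> \<circ> to_torus) x\<bar> \<le> S" if "length is \<le> 1" for "is" x
    proof -
      have "ennreal \<bar>iter_partial is (\<phi> \<circ> to_torus) x\<bar> \<le> deriv_sup 1 (\<phi> \<circ> to_torus)"
        unfolding deriv_sup_def using that by (intro SUP_upper2[of "is"] SUP_upper) auto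
      then show ?thesis using real by simp
    qed
    have 1: "\<bar>\<phi> p\<bar> \<le> S" for p
      using le[of "[]"] ex_to_torus[of p] by (auto simp: iter_partial_def)
    have 2: "\<bar>torus_partial \<mu> \<phi> p\<bar> \<le> S" for p
      using le[of "[\<mu>]"] ex_to_torus[of p] by (auto simp: iter_partial_def partial_to_torus)
    have le_S: "(LINT p|torus_measure. \<bar>f p\<bar>) \<le> S" if "\<And>p. \<bar>f p\<bar> \<le> S" for f :: "'a torus \<Rightarrow> real"
      using norm_integral_le[of torus_measure "\<lambda>p::'a torus. S" "\<lambda>p. \<bar>f p\<bar>"] that by simp
    have "1 * norm (T \<mu> \<phi>) \<le> K * (1 powr \<alpha> *
        ((LINT p|torus_measure. \<bar>\<phi> p\<bar>) + 1 * (LINT p|torus_measure. \<bar>torus_partial \<mu> \<phi> p\<bar>)))"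
      using represents_bound[OF D _ K(2) \<phi> _ _ \<alpha>, of 1 \<mu>] K by simp
    also have "\<dots> \<le> K * (S + S)"
      using add_mono[OF le_S[of \<phi>, OF 1] le_S[of "torus_partial \<mu> \<phi>", OF 2]] K
      by (auto intro!: mult_left_mono)
    also have "\<dots> \<le> (2 * K + 1) * S" using real by (simp add: algebra_simps)
    finally have "ennreal (norm (T \<mu> \<phi>)) \<le> ennreal ((2 * K + 1) * S)" by (intro ennreal_leI) simp
    also have "\<dots> = ennreal (2 * K + 1) * ennreal S" using K real by (intro ennreal_mult) auto
    finally show ?thesis by (simp only: real)
  qed (use K in \<open>simp add: ennreal_mult_top\<close>)
  show ?thesis
    unfolding distributions_def using add scale bound represents_nontest[OF D] by blast
qed

section \<open>Injectivity\<close>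

lemma seg_add:
  assumes "0 \<le> a" "0 \<le> b"
  shows "seg p \<mu> (a + b) = seg p \<mu> a \<union> seg (p + axis_pt \<mu> a) \<mu> b"
proof -
  have "{0..a + b} = {0..a} \<union> (+) a ` {0..b}" using assms by (auto simp: image_iff)
  then show ?thesis
    unfolding seg_def by (simp add: image_Un image_image axis_pt_add add.assoc del: image_add_atLeastAtMost)
qed

lemma seg_in_segments: "0 \<le> l \<Longrightarrow> l \<le> 1 \<Longrightarrow> seg p \<mu> l \<in> segments"
  unfolding segments_def by blast

lemma Omega_seg_add:
  assumes "B \<in> Omega" "0 \<le> a" "0 \<le> b" "a + b \<le> 1"
  shows "B (seg p \<mu> (a + b)) = B (seg p \<mu> a) + B (seg (p + axis_pt \<mu> a) \<mu> b)"
proof -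
  have "joinable (seg p \<mu> a) (seg (p + axis_pt \<mu> a) \<mu> b)"
    unfolding joinable_def seg_add[OF assms(2,3), symmetric]
    using assms by (auto simp: seg_in_segments seg_length_seg)
  then show ?thesis using assms by (simp add: Omega_def seg_add)
qed

lemma Omega_seg_0: "B \<in> Omega \<Longrightarrow> B (seg p \<mu> 0) = 0"
  using Omega_seg_add[of B 0 0 p \<mu>] by simp

text \<open>
  Shifting a segment along itself changes only its two ends, which are segments of length \<open>\<bar>c\<bar>\<close>.
\<close>

lemma longitudinal_shift_bound:
  assumes B: "B \<in> Omega" and K: "gr_norm \<alpha> B \<le> ennreal K" "0 \<le> K"
    and h: "0 < h" and c: "\<bar>c\<bar> + h \<le> 1"
  shows "norm (B (seg (p + axis_pt \<mu> c) \<mu> h) - B (seg p \<mu> h)) \<le> 2 * K * \<bar>c\<bar> powr \<alpha>"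
proof -
  have pos: "norm (B (seg (p + axis_pt \<mu> c) \<mu> h) - B (seg p \<mu> h)) \<le> 2 * K * c powr \<alpha>"
    if c: "0 < c" "c + h \<le> 1" for c p
  proof -
    have "B (seg p \<mu> c) + B (seg (p + axis_pt \<mu> c) \<mu> h) = B (seg p \<mu> h) + B (seg (p + axis_pt \<mu> h) \<mu> c)"
      using Omega_seg_add[OF B, of c h p \<mu>] Omega_seg_add[OF B, of h c p \<mu>] c h by (simp add: add.commute)
    then have "B (seg (p + axis_pt \<mu> c) \<mu> h) - B (seg p \<mu> h) =
        B (seg (p + axis_pt \<mu> h) \<mu> c) - B (seg p \<mu> c)"
      by (simp add: algebra_simps)
    moreover have end_bound: "norm (B (seg q \<mu> c)) \<le> K * c powr \<alpha>" for q
      using K c h by (simp add: gr_norm_le_iff)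
    ultimately show ?thesis
      using order_trans[OF norm_triangle_ineq4 add_mono[OF end_bound end_bound]] by (simp add: mult.assoc)
  qed
  consider "c = 0" | "0 < c" | "c < 0" by linarith
  then show ?thesis
  proof cases
    case 2 then show ?thesis using pos[of c p] c by simp
  next
    case 3
    then show ?thesis using pos[of "- c" "p + axis_pt \<mu> c"] c by (simp add: norm_minus_commute)
  qed simp
qed

lemma compact_seg: "compact (seg p \<mu> l)"
  unfolding seg_def by (intro compact_continuous_image continuous_on_subset[OF continuous_on_line]) auto

lemma torus_coord_seg:
  assumes "v $ \<mu> = 0"
  shows "torus_coord \<mu> ` seg (p + to_torus v) \<mu> h = torus_coord \<mu> ` seg p \<mu> h"
proof -
  obtain x where x: "p = to_torus x" using ex_to_torus by blast
  have "torus_coord \<mu> (p + to_torus v + axis_pt \<mu> c) = torus_coord \<mu> (p + axis_pt \<mu> c)" for c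
    using assms by (simp add: x to_torus_add torus_coord.abs_eq)
  then show ?thesis unfolding seg_def by (simp add: image_image)
qed

text \<open>
  A segment and its transversal translate are parallel, so \<^term>\<open>rho_norm\<close> compares them. The quotient
  in this norm carries information only if its denominator is nonzero, as division by zero yields
  zero; hence the two segments have to be shown to be at positive distance.
\<close>

lemma transversal_shift_bound:
  assumes R: "rho_norm \<alpha> B \<le> ennreal R" "0 \<le> R" and h: "0 < h" "h \<le> 1" and \<alpha>: "0 < \<alpha>"
    and v: "v $ \<mu> = 0" "norm v \<le> 1 / 2"
  shows "norm (B (seg (p + to_torus v) \<mu> h) - B (seg p \<mu> h)) \<le> R * norm v powr (\<alpha> / 2)"
proof (cases "v = 0")
  case False
  define L where "L = seg (p + to_torus v) \<mu> h"
  define L' where "L' = seg p \<mu> h"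
  obtain i where i: "v $ i \<noteq> 0" using False by (auto simp: vec_eq_iff)
  have ne: "p + to_torus v \<in> L" "p \<in> L'"
    unfolding L_def L'_def seg_def using h by (auto intro!: image_eqI[of _ _ 0])
  have disj: "L \<inter> L' = {}"
  proof (rule ccontr)
    assume "L \<inter> L' \<noteq> {}"
    then obtain c c' where "p + to_torus v + axis_pt \<mu> c = p + axis_pt \<mu> c'"
      by (auto simp: L_def L'_def seg_def)
    then have "to_torus (v + c *\<^sub>R axis \<mu> 1) = axis_pt \<mu> c'" by (simp add: add.assoc to_torus_add)
    then have "v $ i \<in> \<int>"
      using i v(1) by (auto simp: to_torus_eq_iff lattice_rel_def axis_def split: if_splits dest!: spec[of _ i])
    moreover have "\<bar>v $ i\<bar> < 1" using component_le_norm_cart[of v i] v(2) by linarith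
    ultimately show False using Ints_nonzero_abs_less1 i by blast
  qed
  have "compact L" "closed L'" by (simp_all add: L_def L'_def compact_seg compact_imp_closed)
  then have "setdist L L' \<noteq> 0" using disj ne by (subst setdist_eq_0_compact_closed) auto
  then have pos: "setdist L L' > 0" using setdist_pos_le[of L L'] by linarith
  have "dist (p + to_torus v) p = dist (to_torus v) (to_torus 0)"
    using dist_add_right[of "to_torus v" p 0] by (simp add: add.commute)
  then have "setdist L L' \<le> norm v"
    using setdist_le_dist[OF ne] dist_to_torus_le[of v 0] by simp
  then have "rho L L' powr \<alpha> \<le> (1 * norm v powr (1 / 2)) powr \<alpha>"
    unfolding rho_def using h \<alpha> pos
    by (intro powr_mono2 mult_mono) (auto simp: L_def seg_length_seg powr_le1)
  then have rho_le: "rho L L' powr \<alpha> \<le> norm v powr (\<alpha> / 2)" by (simp add: powr_powr)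
  have "rho L L' powr \<alpha> > 0"
    unfolding rho_def using h pos by (simp add: L_def seg_length_seg)
  moreover have "norm (B L - B L') / rho L L' powr \<alpha> \<le> R"
  proof -
    have "parallel L L'"
      unfolding parallel_def has_direction_def L_def L'_def using torus_coord_seg[OF v(1)] h by blast
    moreover have "L \<noteq> L'" using disj ne by blast
    ultimately have "ennreal (norm (B L - B L') / rho L L' powr \<alpha>) \<le> rho_norm \<alpha> B"
      unfolding rho_norm_def by (intro SUP_upper2[of "(L, L')"]) auto
    then have "ennreal (norm (B L - B L') / rho L L' powr \<alpha>) \<le> ennreal R" using R(1) by (rule order_trans)
    then show ?thesis using R(2) by (simp add: ennreal_le_iff)
  qed
  ultimately have "norm (B L - B L') \<le> R * rho L L' powr \<alpha>" by (simp add: divide_le_eq)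
  also have "\<dots> \<le> R * norm v powr (\<alpha> / 2)" using rho_le R(2) by (rule mult_left_mono)
  finally show ?thesis by (simp add: L_def L'_def)
qed simp

text \<open>
  A small shift of a segment is a transversal shift followed by a longitudinal one. The latter needs
  room for a longer segment, which is why \<open>h < 1\<close>.
\<close>

lemma continuous_seg:
  fixes B :: "'d::finite torus set \<Rightarrow> 'e::real_normed_vector"
  assumes B: "B \<in> Omega_alpha \<alpha>" and h: "0 < h" "h < 1" and \<alpha>: "0 < \<alpha>"
  shows "continuous_on UNIV (\<lambda>p. B (seg p \<mu> h))"
proof -
  have "gr_norm \<alpha> B < \<infinity>" "rho_norm \<alpha> B < \<infinity>"
    using B by (auto simp: Omega_alpha_def alpha_norm_def less_top)
  then obtain K R where K: "gr_norm \<alpha> B \<le> ennreal K" "0 \<le> K" and R: "rho_norm \<alpha> B \<le> ennreal R" "0 \<le> R"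
    by (cases "gr_norm \<alpha> B"; cases "rho_norm \<alpha> B") auto
  have O: "B \<in> Omega" using B by (simp add: Omega_alpha_def)
  have bound: "norm (B (seg (p + to_torus w) \<mu> h) - B (seg p \<mu> h)) \<le>
      2 * K * norm w powr \<alpha> + R * norm w powr (\<alpha> / 2)"
    if w: "norm w < min (1 / 2) (1 - h)" for p and w :: "real^'d"
  proof -
    define v where "v = w - (w $ \<mu>) *\<^sub>R axis \<mu> 1"
    have v0: "v $ \<mu> = 0" by (simp add: v_def axis_def)
    have "norm v \<le> norm w" by (rule norm_le_componentwise_cart) (simp add: v_def axis_def)
    have wm: "\<bar>w $ \<mu>\<bar> \<le> norm w" by (rule component_le_norm_cart)
    have split: "p + to_torus w = (p + to_torus v) + axis_pt \<mu> (w $ \<mu>)"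
      by (simp add: v_def add.assoc to_torus_add)
    have "norm (B (seg (p + to_torus w) \<mu> h) - B (seg (p + to_torus v) \<mu> h)) \<le> 2 * K * \<bar>w $ \<mu>\<bar> powr \<alpha>"
      unfolding split by (rule longitudinal_shift_bound[OF O K h(1)]) (use wm w in auto)
    also have "\<dots> \<le> 2 * K * norm w powr \<alpha>" using K wm \<alpha> by (intro mult_left_mono powr_mono2) auto
    finally have 1: "norm (B (seg (p + to_torus w) \<mu> h) - B (seg (p + to_torus v) \<mu> h)) \<le> 2 * K * norm w powr \<alpha>" .
    have "norm (B (seg (p + to_torus v) \<mu> h) - B (seg p \<mu> h)) \<le> R * norm v powr (\<alpha> / 2)"
      by (rule transversal_shift_bound[OF R h(1) _ \<alpha> v0]) (use h w \<open>norm v \<le> norm w\<close> in auto)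
    also have "\<dots> \<le> R * norm w powr (\<alpha> / 2)"
      using R \<open>norm v \<le> norm w\<close> \<alpha> by (intro mult_left_mono powr_mono2) auto
    finally show ?thesis using norm_diff_triangle_le[OF 1] by simp
  qed
  have "((\<lambda>y. B (seg (to_torus y) \<mu> h)) \<longlongrightarrow> B (seg (to_torus x) \<mu> h)) (at x)" for x :: "real^'d"
  proof -
    have n0: "((\<lambda>y. norm (y - x)) \<longlongrightarrow> 0) (at x)"
      using tendsto_norm[OF tendsto_diff[OF tendsto_ident_at[of x UNIV] tendsto_const[of x]]] by simp
    have "((\<lambda>y. B (seg (to_torus y) \<mu> h) - B (seg (to_torus x) \<mu> h)) \<longlongrightarrow> 0) (at x)"
    proof (rule Lim_null_comparison)
      show "\<forall>\<^sub>F y in at x. norm (B (seg (to_torus y) \<mu> h) - B (seg (to_torus x) \<mu> h)) \<le>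
          2 * K * norm (y - x) powr \<alpha> + R * norm (y - x) powr (\<alpha> / 2)"
      proof -
        have "\<forall>\<^sub>F y in at x. norm (y - x) < min (1 / 2) (1 - h)"
          using n0 by (rule order_tendstoD) (use h in auto)
        then show ?thesis
          by eventually_elim (use bound[of "_ - x" "to_torus x"] in \<open>simp add: to_torus_add\<close>)
      qed
      have "((\<lambda>y. 2 * K * norm (y - x) powr \<alpha> + R * norm (y - x) powr (\<alpha> / 2)) \<longlongrightarrow> 2 * K * 0 + R * 0) (at x)"
        by (intro tendsto_add tendsto_mult tendsto_const tendsto_zero_powrI[OF n0 tendsto_const]) (use \<alpha> in auto)
      then show "((\<lambda>y. 2 * K * norm (y - x) powr \<alpha> + R * norm (y - x) powr (\<alpha> / 2)) \<longlongrightarrow> 0) (at x)" by simp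
    qed
    then show ?thesis by (simp add: LIM_zero_iff)
  qed
  then have "continuous_on UNIV (\<lambda>x. B (seg (to_torus x) \<mu> h))" by (simp add: continuous_on_def)
  then show ?thesis by (subst (asm) continuous_on_torus_iff[of "\<lambda>p. B (seg p \<mu> h)"])
qed

text \<open>
  For a bounded form, the integral of \<open>\<phi>\<close> against the line integrals over segments of length \<open>h\<close> is the
  integral of its pairings with the translates of \<open>\<phi>\<close> along the line. All translates have the same
  constants in the central estimate, so these pairings tend to zero uniformly when the forms
  approximate a \<open>D\<close> that represents zero. In the limit \<open>p \<mapsto> D (seg p \<mu> h)\<close> is orthogonal to all test functions.
\<close>

lemma represents_zero_seg:
  fixes D :: "'d::finite torus set \<Rightarrow> 'e::{banach, second_countable_topology}"
  assumes D: "represents \<alpha> D (\<lambda>\<mu> \<phi>. 0)" and \<alpha>: "0 < \<alpha>" and h: "0 < h" "h \<le> 1"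
    and cont: "continuous_on UNIV (\<lambda>p. D (seg p \<mu> h))"
  shows "D (seg p \<mu> h) = 0"
proof (rule continuous_torus_eq_0I[OF cont])
  fix \<phi> :: "'d torus \<Rightarrow> real" assume \<phi>: "\<phi> \<in> test_funs"
  note [measurable] = test_fun_borel[OF \<phi>] torus_partial_borel[OF \<phi>]
  define I where "I = (LINT p|torus_measure. \<phi> p *\<^sub>R D (seg p \<mu> h))"
  obtain A e where A: "\<And>n. A n \<in> bdd_forms"
      "\<And>n. gr_norm \<alpha> (\<lambda>L. D L - line_int (A n) L) \<le> ennreal (e n)" "\<And>n. 0 \<le> e n" "e \<longlonglongrightarrow> 0"
    using represents_seq[OF D] by blast
  define N where "N = (LINT p|torus_measure. \<bar>\<phi> p\<bar>)"
  define Y where "Y = N + (LINT p|torus_measure. \<bar>torus_partial \<mu> \<phi> p\<bar>)"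
  have Y: "0 \<le> Y" unfolding Y_def N_def by (intro add_nonneg_nonneg integral_nonneg_AE) auto
  have \<phi>i: "integrable torus_measure \<phi>"
    by (intro integrable_torus_bounded bounded_test_fun \<phi>) measurable
  have "norm I \<le> e n * (Y * h + h powr \<alpha> * N)" for n
  proof -
    note en = A(2,3)[of n]
    have rep: "represents \<alpha> (\<lambda>L. D L - line_int (A n) L) (\<lambda>\<mu> \<phi>. 0 - form_distr (A n) \<mu> \<phi>)"
      using D represents_bdd_form[OF A(1)] by (rule represents_diff)
    define L where "L p = (LINT c:{0..h}|lborel. A n \<mu> (p + axis_pt \<mu> c))" for p
    have L: "L p = line_int (A n) (seg p \<mu> h)" for p
      using line_int_seg[OF A(1), of h n p \<mu>] h by (simp add: L_def)
    have [measurable]: "A n \<mu> \<in> borel_measurable borel" using bdd_formsD[OF A(1)] by blast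
    have "(LINT p|torus_measure. \<phi> p *\<^sub>R L p) =
        (LINT c:{0..h}|lborel. LINT p|torus_measure. \<phi> (p - axis_pt \<mu> c) *\<^sub>R A n \<mu> p)"
      unfolding L_def by (rule integral_line_average) (use \<phi> bounded_test_fun bdd_formsD[OF A(1)] in auto)
    also have "norm \<dots> \<le> e n * Y * h"
    proof (rule norm_set_integral_Icc_le)
      fix c
      have t: "(\<lambda>p. \<phi> (p - axis_pt \<mu> c)) \<in> test_funs" by (rule test_fun_translate[OF \<phi>])
      have "(LINT p|torus_measure. \<bar>\<phi> (p - axis_pt \<mu> c)\<bar>) = N"
        using integral_torus_translate[of "\<lambda>p. \<bar>\<phi> p\<bar>" "- axis_pt \<mu> c"] by (simp add: N_def)
      moreover have "(LINT p|torus_measure. \<bar>torus_partial \<mu> (\<lambda>p. \<phi> (p - axis_pt \<mu> c)) p\<bar>) =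
          (LINT p|torus_measure. \<bar>torus_partial \<mu> \<phi> p\<bar>)"
        using integral_torus_translate[of "\<lambda>p. \<bar>torus_partial \<mu> \<phi> p\<bar>" "- axis_pt \<mu> c"]
        by (simp add: torus_partial_translate)
      ultimately have "norm (form_distr (A n) \<mu> (\<lambda>p. \<phi> (p - axis_pt \<mu> c))) \<le> e n * Y"
        using represents_bound[OF rep en t, of 1 \<mu>] \<alpha> by (simp add: Y_def)
      then show "norm (LINT p|torus_measure. \<phi> (p - axis_pt \<mu> c) *\<^sub>R A n \<mu> p) \<le> e n * Y"
        using t by (simp add: form_distr_def fun_distr_def)
    qed (use h en Y in auto)
    finally have 1: "norm (LINT p|torus_measure. \<phi> p *\<^sub>R L p) \<le> e n * Y * h" .
    have Dm [measurable]: "(\<lambda>p. D (seg p \<mu> h)) \<in> borel_measurable borel"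
      using cont by (rule borel_measurable_continuous_onI)
    have diff: "norm (D (seg p \<mu> h) - L p) \<le> e n * h powr \<alpha>" for p
      using en h by (simp add: gr_norm_le_iff L)
    have Lm [measurable]: "L \<in> borel_measurable borel"
      unfolding L_def by (rule line_integral_borel) measurable
    have bd: "bounded (range (\<lambda>p. \<phi> p *\<^sub>R D (seg p \<mu> h)))"
      by (intro bounded_continuous_torus continuous_intros cont test_fun_continuous \<phi>)
    have i1: "integrable torus_measure (\<lambda>p. \<phi> p *\<^sub>R D (seg p \<mu> h))"
      by (rule integrable_torus_bounded[OF _ bd]) measurable
    have i2: "integrable torus_measure (\<lambda>p. \<phi> p *\<^sub>R (D (seg p \<mu> h) - L p))"
    proof (rule Bochner_Integration.integrable_bound)
      show "integrable torus_measure (\<lambda>p. \<phi> p * (e n * h powr \<alpha>))" using \<phi>i by simp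
      show "AE p in torus_measure. norm (\<phi> p *\<^sub>R (D (seg p \<mu> h) - L p)) \<le> norm (\<phi> p * (e n * h powr \<alpha>))"
        using diff en by (auto simp: abs_mult intro!: mult_left_mono)
    qed measurable
    have "(LINT p|torus_measure. \<phi> p *\<^sub>R L p) =
        (LINT p|torus_measure. \<phi> p *\<^sub>R D (seg p \<mu> h) - \<phi> p *\<^sub>R (D (seg p \<mu> h) - L p))"
      by (simp add: scaleR_diff_right)
    also have "\<dots> = I - (LINT p|torus_measure. \<phi> p *\<^sub>R (D (seg p \<mu> h) - L p))"
      unfolding I_def by (rule Bochner_Integration.integral_diff[OF i1 i2])
    finally have I: "I = (LINT p|torus_measure. \<phi> p *\<^sub>R L p) + (LINT p|torus_measure. \<phi> p *\<^sub>R (D (seg p \<mu> h) - L p))"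
      by simp
    have "norm (LINT p|torus_measure. \<phi> p *\<^sub>R (D (seg p \<mu> h) - L p)) \<le>
        (LINT p|torus_measure. (e n * h powr \<alpha>) * \<bar>\<phi> p\<bar>)"
    proof (rule norm_integral_le)
      show "norm (\<phi> p *\<^sub>R (D (seg p \<mu> h) - L p)) \<le> e n * h powr \<alpha> * \<bar>\<phi> p\<bar>" for p
        using mult_left_mono[OF diff[of p], of "\<bar>\<phi> p\<bar>"] by (simp add: mult.commute)
    qed (use \<phi>i in simp)
    then have 2: "norm (LINT p|torus_measure. \<phi> p *\<^sub>R (D (seg p \<mu> h) - L p)) \<le> e n * h powr \<alpha> * N"
      by (simp add: N_def)
    have "norm I \<le> e n * Y * h + e n * h powr \<alpha> * N"
      unfolding I by (rule norm_triangle_le[OF add_mono[OF 1 2]])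
    then show ?thesis by (simp add: algebra_simps)
  qed
  moreover have "(\<lambda>n. e n * (Y * h + h powr \<alpha> * N)) \<longlonglongrightarrow> 0"
    using tendsto_mult[OF A(4) tendsto_const[of "Y * h + h powr \<alpha> * N"]] by simp
  ultimately have "norm I \<le> 0" by (intro tendsto_lowerbound[where F = sequentially]) auto
  then show "(LINT p|torus_measure. \<phi> p *\<^sub>R D (seg p \<mu> h)) = 0" by (simp add: I_def)
qed

lemma represents_inj:
  assumes D: "represents \<alpha> D T" "D \<in> Omega_alpha \<alpha>" and D': "represents \<alpha> D' T" "D' \<in> Omega_alpha \<alpha>"
    and \<alpha>: "0 < \<alpha>"
  shows "D = D'"
proof
  fix L
  have O: "D \<in> Omega" "D' \<in> Omega" using D D' by (auto simp: Omega_alpha_def)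
  have rep: "represents \<alpha> (\<lambda>L. D L - D' L) (\<lambda>\<mu> \<phi>. 0)"
    using represents_diff[OF D(1) D'(1)] by simp
  have eq: "D (seg p \<mu> h) = D' (seg p \<mu> h)" if h: "0 < h" "h < 1" for p \<mu> h
    using represents_zero_seg[OF rep \<alpha> h(1) less_imp_le[OF h(2)]]
      continuous_on_diff[OF continuous_seg[OF D(2) h \<alpha>] continuous_seg[OF D'(2) h \<alpha>]] by simp
  show "D L = D' L"
  proof (cases "L \<in> segments")
    case True
    then obtain p \<mu> l where L: "L = seg p \<mu> l" "0 \<le> l" "l \<le> 1" using ex_seg by blast
    consider "l = 0" | "0 < l" "l < 1" | "l = 1" using L by linarith
    then show ?thesis
    proof cases
      case 1 then show ?thesis using O by (simp add: L Omega_seg_0)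
    next
      case 2 then show ?thesis by (simp add: L eq)
    next
      \<comment> \<open>A closed loop is cut into two halves, whose lengths are covered by the previous case.\<close>
      case 3
      then show ?thesis
        using Omega_seg_add[OF O(1), of "1/2" "1/2" p \<mu>] Omega_seg_add[OF O(2), of "1/2" "1/2" p \<mu>]
        by (simp add: L eq)
    qed
  qed (use O in \<open>simp add: Omega_def\<close>)
qed

section \<open>Rescaled bumps and the Besov norm\<close>

lemma bumps_1D:
  assumes "\<psi> \<in> bumps 1"
  shows "\<bar>\<psi> y\<bar> \<le> 1" "\<bar>\<psi> y - \<psi> y'\<bar> \<le> dist y y'" "closure {x. \<psi> x \<noteq> 0} \<subseteq> ball 0 (1/4)"
proof -
  have s: "deriv_sup 0 \<psi> + deriv_lip 0 \<psi> \<le> 1" using assms by (simp add: bumps_def)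
  then have 1: "deriv_sup 0 \<psi> \<le> 1" by (rule order_trans[rotated]) simp
  have 2: "deriv_lip 0 \<psi> \<le> 1" using s by (rule order_trans[rotated]) simp
  have "ennreal \<bar>iter_partial [] \<psi> y\<bar> \<le> deriv_sup 0 \<psi>"
    unfolding deriv_sup_def by (intro SUP_upper2[of "[]"] SUP_upper) auto
  from order_trans[OF this 1] show "\<bar>\<psi> y\<bar> \<le> 1" by (simp add: iter_partial_def)
  show "\<bar>\<psi> y - \<psi> y'\<bar> \<le> dist y y'"
  proof (cases "y = y'")
    case False
    have "ennreal (\<bar>iter_partial [] \<psi> y - iter_partial [] \<psi> y'\<bar> / dist y y') \<le> deriv_lip 0 \<psi>"
      unfolding deriv_lip_def by (intro SUP_upper2[of "[]"] SUP_upper2[of "(y, y')"]) (use False in auto)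
    from order_trans[OF this 2] have "\<bar>\<psi> y - \<psi> y'\<bar> / dist y y' \<le> 1"
      by (simp add: iter_partial_def)
    then show ?thesis using False by (simp add: divide_le_eq)
  qed simp
  show "closure {x. \<psi> x \<noteq> 0} \<subseteq> ball 0 (1/4)" using assms by (simp add: bumps_def)
qed

text \<open>
  Another lift of the same point differs from \<open>z\<close> by at least \<open>1\<close> in some coordinate, which puts it outside
  the support. The cube is chosen larger than the cell centred at the origin, so that the equality
  holds near every point of this cell and can be differentiated there.
\<close>

lemma periodise_eq:
  fixes f :: "real^'d::finite \<Rightarrow> real"
  assumes supp: "\<And>y. norm y \<ge> 1/4 \<Longrightarrow> f y = 0" and z: "\<And>i. \<bar>z $ i\<bar> < 3/4"
  shows "periodise f (to_torus z) = f z"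
proof -
  have "f y = 0" if "y \<noteq> z" "to_torus y = to_torus z" for y
  proof -
    obtain i where i: "y $ i \<noteq> z $ i" using \<open>y \<noteq> z\<close> by (auto simp: vec_eq_iff)
    have "y $ i - z $ i \<in> \<int>" using that(2) by (simp add: to_torus_eq_iff lattice_rel_def)
    then have "\<bar>y $ i - z $ i\<bar> \<ge> 1" using i by (intro Ints_nonzero_abs_ge1) auto
    then have "\<bar>y $ i\<bar> \<ge> 1/4" using z[of i] by linarith
    then show ?thesis using supp component_le_norm_cart[of y i] by simp
  qed
  then have "periodise f (to_torus z) = (\<Sum>\<^sub>\<infinity>y\<in>{z}. f y)"
    unfolding periodise_def by (intro infsum_cong_neutral) auto
  then show ?thesis by simp
qed

lemma measure_ball_le:
  assumes r: "0 < r"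
  shows "measure lborel (ball (a :: real^'d::finite) r) \<le> (2 * r) ^ CARD('d)"
proof -
  define u :: "real^'d" where "u = (\<chi> i. r)"
  have sub: "ball a r \<subseteq> cbox (a - u) (a + u)"
  proof
    fix x assume "x \<in> ball a r"
    then have "\<bar>(x - a) $ i\<bar> < r" for i
      using component_le_norm_cart[of "x - a" i] by (simp add: dist_norm norm_minus_commute)
    then have "\<bar>x $ i - a $ i\<bar> < r" for i by simp
    then have "a $ i - r \<le> x $ i \<and> x $ i \<le> a $ i + r" for i
      by (smt (verit, best))
    then show "x \<in> cbox (a - u) (a + u)" by (simp add: mem_box_cart u_def)
  qed
  have "a \<in> cbox (a - u) (a + u)" using r by (simp add: mem_box_cart u_def)
  then have "measure lborel (cbox (a - u) (a + u)) = (\<Prod>i\<in>UNIV. (a + u) $ i - (a - u) $ i)"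
    by (intro content_cbox_cart) auto
  also have "\<dots> = (2 * r) ^ CARD('d)" by (simp add: u_def)
  finally show ?thesis using measure_mono_fmeasurable[OF sub, of lborel] by simp
qed

text \<open>By translation invariance the integral may be taken over the cell centred at the origin.\<close>

lemma integral_torus_bump_le:
  fixes u :: "'d::finite torus \<Rightarrow> real"
  assumes u [measurable]: "u \<in> borel_measurable borel" and C: "0 \<le> C" and r: "0 < r"
    and le: "\<And>z. (\<And>i. \<bar>z $ i\<bar> \<le> 1/2) \<Longrightarrow> \<bar>u (to_torus z)\<bar> \<le> C * indicator (ball 0 r) z"
  shows "(LINT p|torus_measure. \<bar>u p\<bar>) \<le> C * (2 * r) ^ CARD('d)"
proof -
  define a :: "real^'d" where "a = (\<chi> i. 1/2)"
  have "(LINT p|torus_measure. \<bar>u p\<bar>) = (LINT p|torus_measure. \<bar>u (p + - to_torus a)\<bar>)"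
    by (rule integral_torus_translate[symmetric]) simp
  also have "\<dots> = (LINT x:unit_cell|lborel. \<bar>u (to_torus (x - a))\<bar>)"
    using measurable_compose[OF translate_borel u, of "- to_torus a"]
    by (subst integral_torus) (auto simp: to_torus_diff)
  also have "\<dots> \<le> norm (LINT x|lborel. indicator unit_cell x *\<^sub>R \<bar>u (to_torus (x - a))\<bar>)"
    by (simp add: set_lebesgue_integral_def)
  also have "\<dots> \<le> (LINT x|lborel. C * indicator (ball a r) x)"
  proof (rule norm_integral_le)
    show "integrable lborel (\<lambda>x. C * indicator (ball a r) x)"
      using emeasure_lborel_ball_finite[of a r]
      by (intro integrable_mult_right integrable_real_indicator) auto
    fix x :: "real^'d"
    have "\<bar>u (to_torus (x - a))\<bar> \<le> C * indicator (ball a r) x" if "x \<in> unit_cell"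
    proof -
      have "\<bar>u (to_torus (x - a))\<bar> \<le> C * indicator (ball 0 r) (x - a)"
      proof (rule le)
        fix i
        have "0 \<le> x $ i" "x $ i < 1" using that by (auto simp: unit_cell_def)
        moreover have "(x - a) $ i = x $ i - 1/2" by (simp add: a_def)
        ultimately show "\<bar>(x - a) $ i\<bar> \<le> 1/2" by linarith
      qed
      also have "indicator (ball 0 r) (x - a) = (indicator (ball a r) x :: real)"
        by (simp add: indicator_def dist_norm norm_minus_commute)
      finally show ?thesis .
    qed
    then show "norm (indicator unit_cell x *\<^sub>R \<bar>u (to_torus (x - a))\<bar>) \<le> C * indicator (ball a r) x"
      using C by (auto simp: indicator_def split: if_splits)
  qed
  also have "\<dots> = C * measure lborel (ball a r)" by simp
  also have "\<dots> \<le> C * (2 * r) ^ CARD('d)" using measure_ball_le[OF r] C by (rule mult_left_mono)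
  finally show ?thesis .
qed

text \<open>
  A bump of scale \<open>l\<close> has height at most \<open>1 / l ^ CARD('d)\<close> and slope at most \<open>1 / l ^ (CARD('d) + 1)\<close> on a ball
  of measure at most \<open>l ^ CARD('d)\<close>, and it vanishes elsewhere.
\<close>

lemma bump_integrals:
  fixes \<psi> :: "real^'d::finite \<Rightarrow> real" and x :: "'d torus"
  assumes \<psi>: "\<psi> \<in> bumps 1" and l: "0 < l" "l \<le> 1"
    and \<phi>: "\<phi> = (\<lambda>y. periodise (rescale l \<psi>) (y - x))" and test: "\<phi> \<in> test_funs"
  shows "(LINT p|torus_measure. \<bar>\<phi> p\<bar>) \<le> 1"
    and "l * (LINT p|torus_measure. \<bar>torus_partial \<mu> \<phi> p\<bar>) \<le> 1"
proof -
  define g where "g = rescale l \<psi>"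
  define P where "P = periodise g"
  define n where "n = CARD('d)"
  have ln: "0 < l ^ n" using l by simp
  have \<phi>P: "\<phi> = (\<lambda>y. P (y - x))" by (simp add: \<phi> P_def g_def)
  have P: "P \<in> test_funs"
    using test_fun_translate[OF test, of "- x"] by (simp add: \<phi>P)
  note [measurable] = test_fun_borel[OF P] torus_partial_borel[OF P]
  have g: "g y = \<psi> ((1 / l) *\<^sub>R y) / l ^ n" for y by (simp add: g_def rescale_def n_def)
  have \<psi>0: "\<psi> w = 0" if "norm w \<ge> 1/4" for w
  proof -
    have "w \<notin> closure {x. \<psi> x \<noteq> 0}" using bumps_1D(3)[OF \<psi>] that by auto
    then show ?thesis using closure_subset[of "{x. \<psi> x \<noteq> 0}"] by auto
  qed
  have g0: "g y = 0" if "norm y \<ge> l / 4" for y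
    using \<psi>0[of "(1 / l) *\<^sub>R y"] that l by (simp add: g field_simps)
  have gP: "P (to_torus z) = g z" if "\<And>i. \<bar>z $ i\<bar> < 3/4" for z
    unfolding P_def by (rule periodise_eq[OF _ that]) (use g0 l in auto)
  have "(LINT p|torus_measure. \<bar>P p\<bar>) \<le> (1 / l ^ n) * (2 * (l / 4)) ^ n"
    unfolding n_def
  proof (rule integral_torus_bump_le)
    fix z :: "real^'d" assume z: "\<And>i. \<bar>z $ i\<bar> \<le> 1/2"
    have "\<bar>z $ i\<bar> < 3/4" for i using z[of i] by simp
    then have "P (to_torus z) = g z" by (rule gP)
    then show "\<bar>P (to_torus z)\<bar> \<le> 1 / l ^ CARD('d) * indicator (ball 0 (l / 4)) z"
      using g0[of z] bumps_1D(1)[OF \<psi>, of "(1 / l) *\<^sub>R z"] ln l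
      by (auto simp: indicator_def g n_def divide_right_mono)
  qed (use l in auto)
  also have "\<dots> = (1 / 2) ^ n" using l by (simp add: field_simps flip: power_mult_distrib)
  also have "\<dots> \<le> 1" by (simp add: power_le_one)
  finally show "(LINT p|torus_measure. \<bar>\<phi> p\<bar>) \<le> 1"
    using integral_torus_translate[of "\<lambda>p. \<bar>P p\<bar>" "- x"] by (simp add: \<phi>P)
  have "(LINT p|torus_measure. \<bar>torus_partial \<mu> P p\<bar>) \<le> (1 / (l ^ n * l)) * (2 * (l / 4)) ^ n"
    unfolding n_def
  proof (rule integral_torus_bump_le)
    fix z :: "real^'d" assume z: "\<And>i. \<bar>z $ i\<bar> \<le> 1/2"
    define e :: "real^'d" where "e = axis \<mu> 1"
    have e: "norm e = 1" by (simp add: e_def)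
    have gPt: "P (to_torus z + axis_pt \<mu> t) = g (z + t *\<^sub>R e)" if "\<bar>t\<bar> < 1/4" for t
      unfolding to_torus_add e_def[symmetric]
    proof (rule gP)
      fix i
      have "\<bar>(t *\<^sub>R e) $ i\<bar> \<le> \<bar>t\<bar>" using component_le_norm_cart[of "t *\<^sub>R e" i] e by simp
      moreover have "(z + t *\<^sub>R e) $ i = z $ i + (t *\<^sub>R e) $ i" by simp
      ultimately show "\<bar>(z + t *\<^sub>R e) $ i\<bar> < 3/4" using z[of i] that by linarith
    qed
    have "((\<lambda>t. P (to_torus z + axis_pt \<mu> t)) has_real_derivative torus_partial \<mu> P (to_torus z)) (at 0)"
      using test_fun_has_derivative[OF P, of "to_torus z" \<mu> 0] by simp
    then have "((\<lambda>t. (P (to_torus z + axis_pt \<mu> t) - P (to_torus z)) / t) \<longlongrightarrow> torus_partial \<mu> P (to_torus z)) (at 0)"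
      by (simp add: DERIV_def)
    moreover have small: "\<forall>\<^sub>F t in at (0::real). \<bar>t\<bar> < 1/4"
      unfolding eventually_at by (rule exI[of _ "1/4"]) (auto simp: dist_real_def)
    then have "\<forall>\<^sub>F t in at 0. (P (to_torus z + axis_pt \<mu> t) - P (to_torus z)) / t = (g (z + t *\<^sub>R e) - g z) / t"
      by eventually_elim (use gPt gPt[of 0] in simp)
    ultimately have D: "((\<lambda>t. (g (z + t *\<^sub>R e) - g z) / t) \<longlongrightarrow> torus_partial \<mu> P (to_torus z)) (at 0)"
      by (rule Lim_transform_eventually)
    show "\<bar>torus_partial \<mu> P (to_torus z)\<bar> \<le> 1 / (l ^ CARD('d) * l) * indicator (ball 0 (l / 4)) z"
    proof (cases "z \<in> ball 0 (l / 4)")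
      case True
      have "\<bar>(g (z + t *\<^sub>R e) - g z) / t\<bar> \<le> 1 / (l ^ n * l)" if "t \<noteq> 0" for t
      proof -
        have "\<bar>\<psi> ((1 / l) *\<^sub>R (z + t *\<^sub>R e)) - \<psi> ((1 / l) *\<^sub>R z)\<bar> \<le> dist ((1 / l) *\<^sub>R (z + t *\<^sub>R e)) ((1 / l) *\<^sub>R z)"
          by (rule bumps_1D(2)[OF \<psi>])
        also have "\<dots> = norm ((t / l) *\<^sub>R e)" by (simp add: dist_norm algebra_simps)
        also have "\<dots> = \<bar>t\<bar> / l" using l e by simp
        finally have "\<bar>\<psi> ((1 / l) *\<^sub>R (z + t *\<^sub>R e)) - \<psi> ((1 / l) *\<^sub>R z)\<bar> / l ^ n \<le> (\<bar>t\<bar> / l) / l ^ n"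
          using ln by (intro divide_right_mono) auto
        then have "\<bar>g (z + t *\<^sub>R e) - g z\<bar> \<le> \<bar>t\<bar> / (l ^ n * l)"
          using ln by (simp add: g abs_divide diff_divide_distrib[symmetric] mult.commute)
        then show ?thesis using that by (simp add: abs_divide divide_le_eq mult.commute)
      qed
      then have "\<forall>\<^sub>F t in at 0. \<bar>(g (z + t *\<^sub>R e) - g z) / t\<bar> \<le> 1 / (l ^ n * l)"
        unfolding eventually_at by (intro exI[of _ 1]) auto
      then have "\<bar>torus_partial \<mu> P (to_torus z)\<bar> \<le> 1 / (l ^ n * l)"
        by (intro tendsto_upperbound[OF tendsto_rabs[OF D]]) auto
      then show ?thesis using True by (simp add: n_def)
    next
      case False
      define S where "S = closure {x. \<psi> x \<noteq> 0}"
      have "norm ((1 / l) *\<^sub>R z) \<ge> 1/4" using False l by (simp add: field_simps)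
      then have "(1 / l) *\<^sub>R z \<in> - S" using bumps_1D(3)[OF \<psi>] by (auto simp: S_def)
      moreover have "((\<lambda>t. (1 / l) *\<^sub>R (z + t *\<^sub>R e)) \<longlongrightarrow> (1 / l) *\<^sub>R (z + 0 *\<^sub>R e)) (at (0::real))"
        by (intro tendsto_intros)
      ultimately have outside: "\<forall>\<^sub>F t in at 0. (1 / l) *\<^sub>R (z + t *\<^sub>R e) \<in> - S"
        by (intro topological_tendstoD[where S = "- S"]) (auto simp: S_def)
      have \<psi>S: "\<psi> w = 0" if "w \<in> - S" for w
        using that closure_subset[of "{x. \<psi> x \<noteq> 0}"] by (auto simp: S_def)
      have "\<forall>\<^sub>F t in at 0. g (z + t *\<^sub>R e) = 0"
        using outside by (rule eventually_mono) (simp only: g \<psi>S div_0)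
      then have "\<forall>\<^sub>F t in at 0. (g (z + t *\<^sub>R e) - g z) / t = 0"
        using g0[of z] False by (auto elim: eventually_mono)
      then have "((\<lambda>t::real. 0) \<longlongrightarrow> torus_partial \<mu> P (to_torus z)) (at 0)"
        by (rule Lim_transform_eventually[OF D])
      then have "torus_partial \<mu> P (to_torus z) = 0"
        using tendsto_unique[OF _ _ tendsto_const] by (metis at_neq_bot)
      then show ?thesis using False by simp
    qed
  qed (use l in auto)
  then have "l * (LINT p|torus_measure. \<bar>torus_partial \<mu> P p\<bar>) \<le> l * ((1 / (l ^ n * l)) * (2 * (l / 4)) ^ n)"
    using l by (intro mult_left_mono) auto
  also have "\<dots> = (1 / 2) ^ n" using l by (simp add: field_simps flip: power_mult_distrib)
  also have "\<dots> \<le> 1" by (simp add: power_le_one)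
  finally show "l * (LINT p|torus_measure. \<bar>torus_partial \<mu> \<phi> p\<bar>) \<le> 1"
    using integral_torus_translate[of "\<lambda>p. \<bar>torus_partial \<mu> P p\<bar>" "- x"]
    by (simp add: \<phi>P torus_partial_translate)
qed

text \<open>
  Segments as long as the scale \<open>l\<close> of the bump make both terms of the central estimate of order \<open>l powr \<alpha>\<close>.
\<close>

lemma represents_besov_bound:
  assumes D: "represents \<alpha> D T" and K: "gr_norm \<alpha> D \<le> ennreal K" "0 \<le> K" and \<alpha>: "0 < \<alpha>" "\<alpha> < 1"
  shows "besov_norm (\<alpha> - 1) (T \<mu>) \<le> ennreal (2 * K)"
proof -
  have "\<lfloor>\<alpha> - 1\<rfloor> = -1" using \<alpha> by (simp add: floor_eq_iff)
  then have r: "nat (- \<lfloor>\<alpha> - 1\<rfloor>) = 1" by simp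
  show ?thesis unfolding besov_norm_def r
  proof (intro SUP_least ennreal_leI)
    fix l :: real and \<psi> :: "real^'a \<Rightarrow> real" and x :: "'a torus"
    assume l: "l \<in> {0<..1}" and \<psi>: "\<psi> \<in> bumps 1"
    define \<phi> where "\<phi> = (\<lambda>y. periodise (rescale l \<psi>) (y - x))"
    have "norm (T \<mu> \<phi>) \<le> 2 * K * l powr (\<alpha> - 1)"
    proof (cases "\<phi> \<in> test_funs")
      case True
      have "l * norm (T \<mu> \<phi>) \<le> K * (l powr \<alpha> *
          ((LINT p|torus_measure. \<bar>\<phi> p\<bar>) + l * (LINT p|torus_measure. \<bar>torus_partial \<mu> \<phi> p\<bar>)))"
        using l by (intro represents_bound[OF D K True _ _ \<alpha>(1)]) auto
      also have "\<dots> \<le> K * (l powr \<alpha> * (1 + 1))"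
        using bump_integrals(1)[OF \<psi> _ _ \<phi>_def True] bump_integrals(2)[OF \<psi> _ _ \<phi>_def True, of \<mu>] l K
        by (intro mult_left_mono add_mono) auto
      also have "\<dots> = l * (2 * K * l powr (\<alpha> - 1))" using l by (simp add: powr_diff)
      finally show ?thesis using l by simp
    next
      \<comment> \<open>Distributions are extended by zero to all other functions.\<close>
      case False
      then show ?thesis using represents_nontest[OF D] K by simp
    qed
    then show "norm (T \<mu> (\<lambda>y. periodise (rescale l \<psi>) (y - x))) / l powr (\<alpha> - 1) \<le> 2 * K"
      using l by (simp add: \<phi>_def divide_le_eq)
  qed
qed

section \<open>Essentially bounded limits at exponent one\<close>

lemma set_integral_Icc_shift:
  fixes g :: "real \<Rightarrow> 'e::{banach, second_countable_topology}"
  shows "(LINT c:{0..s}|lborel. g (t + c)) = (LINT c:{t..t + s}|lborel. g c)"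
proof -
  have "(LINT c|lborel. indicator {t..t + s} c *\<^sub>R g c) =
      \<bar>1\<bar> *\<^sub>R (LINT c|lborel. indicator {t..t + s} (t + 1 * c) *\<^sub>R g (t + 1 * c))"
    by (rule lborel_integral_real_affine) simp
  also have "\<dots> = (LINT c|lborel. indicator {0..s} c *\<^sub>R g (t + c))"
    by (auto intro!: Bochner_Integration.integral_cong simp: indicator_def)
  finally show ?thesis unfolding set_lebesgue_integral_def by simp
qed

text \<open>
  Lebesgue differentiation for vector-valued \<open>g\<close>, reduced to the real functions \<open>s \<mapsto> norm (g s - e)\<close> with
  \<open>e\<close> in a countable dense set. At a common Lebesgue point \<open>t\<close>, short averages of \<open>g\<close> are within
  about \<open>norm (g t - e)\<close> of \<open>e\<close>, so \<open>norm e \<le> K + norm (g t - e)\<close>; then \<open>e\<close> tends to \<open>g t\<close>.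
\<close>

lemma AE_norm_le_average:
  fixes g :: "real \<Rightarrow> 'e::{banach, second_countable_topology}"
  assumes g [measurable]: "g \<in> borel_measurable borel" and M: "\<And>t. norm (g t) \<le> M"
    and avg: "\<And>t s. 0 < s \<Longrightarrow> s \<le> 1 \<Longrightarrow> norm (LINT c:{t..t + s}|lborel. g c) \<le> K * s"
  shows "AE t in lborel. norm (g t) \<le> K"
proof -
  obtain D :: "'e set" where D: "countable D" "\<And>X. open X \<Longrightarrow> X \<noteq> {} \<Longrightarrow> \<exists>d\<in>D. d \<in> X"
    using countable_dense_setE by blast
  define f where "f e t = norm (g t - e)" for e t
  have int: "set_integrable lborel {a..b} (f e)" for a b e
  proof (rule set_integrable_Icc_bounded)
    show "norm (f e t) \<le> M + norm e" for t
      using norm_triangle_ineq4[of "g t" e] M[of t] by (simp add: f_def)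
    show "f e \<in> borel_measurable borel" unfolding f_def by measurable
  qed
  have "\<exists>N. negligible N \<and> (\<forall>x \<eta>. x \<notin> N \<and> 0 < \<eta> \<longrightarrow>
      (\<exists>d>0. \<forall>h. 0 < h \<and> h < d \<longrightarrow> norm (integral {x..x + h} (f e) / h - f e x) < \<eta>))" for e
  proof -
    have "f e integrable_on cbox a b" for a b
      using set_borel_integral_eq_integral(1)[OF int] by (simp add: cbox_interval)
    then obtain N where N: "negligible N" "\<And>x \<eta>. x \<notin> N \<Longrightarrow> 0 < \<eta> \<Longrightarrow>
        \<exists>d>0. \<forall>h. 0 < h \<and> h < d \<longrightarrow>
          norm (integral (cbox x (x + h *\<^sub>R One)) (f e) /\<^sub>R h ^ DIM(real) - f e x) < \<eta>"
      using integrable_ccontinuous_explicit[of "f e"] by blast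
    have "\<exists>d>0. \<forall>h. 0 < h \<and> h < d \<longrightarrow> norm (integral {x..x + h} (f e) / h - f e x) < \<eta>"
      if "x \<notin> N" "0 < \<eta>" for x \<eta>
      using N(2)[OF that] by (simp add: cbox_interval divide_inverse mult.commute)
    then show ?thesis using N(1) by blast
  qed
  then have "\<forall>e. \<exists>N. negligible N \<and> (\<forall>x \<eta>. x \<notin> N \<and> 0 < \<eta> \<longrightarrow>
      (\<exists>d>0. \<forall>h. 0 < h \<and> h < d \<longrightarrow> norm (integral {x..x + h} (f e) / h - f e x) < \<eta>))" by blast
  from choice[OF this] obtain N where N: "\<And>e. negligible (N e)" "\<And>e x \<eta>. x \<notin> N e \<Longrightarrow> 0 < \<eta> \<Longrightarrow>
      \<exists>d>0. \<forall>h. 0 < h \<and> h < d \<longrightarrow> norm (integral {x..x + h} (f e) / h - f e x) < \<eta>"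
    by blast
  have neg: "negligible (\<Union>(N ` D))"
    using N(1) D(1) by (intro negligible_countable_Union) auto
  have close: "norm e \<le> K + f e t" if t: "t \<notin> N e" for e t
  proof (rule field_le_epsilon)
    fix \<eta> :: real assume "0 < \<eta>"
    then obtain d where d: "d > 0" "\<And>h. 0 < h \<Longrightarrow> h < d \<Longrightarrow> norm (integral {t..t + h} (f e) / h - f e t) < \<eta>"
      using N(2)[OF t] by blast
    define h where "h = min 1 (d / 2)"
    have h: "0 < h" "h \<le> 1" "h < d" using d(1) by (auto simp: h_def)
    have gi: "set_integrable lborel {t..t + h} g"
      by (rule set_integrable_Icc_bounded[OF g M])
    have ei: "set_integrable lborel {t..t + h} (\<lambda>c. e)"
      by (rule set_integrable_Icc_bounded[of _ "norm e"]) auto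
    have "h *\<^sub>R e = (LINT c:{t..t + h}|lborel. e)"
      using h by (simp add: set_lebesgue_integral_def)
    also have "\<dots> = (LINT c:{t..t + h}|lborel. g c) - (LINT c:{t..t + h}|lborel. g c - e)"
      using gi ei by simp
    also have "norm \<dots> \<le> K * h + (LINT c:{t..t + h}|lborel. f e c)"
    proof (rule order_trans[OF norm_triangle_ineq4 add_mono])
      show "norm (LINT c:{t..t + h}|lborel. g c) \<le> K * h" using avg h by simp
      show "norm (LINT c:{t..t + h}|lborel. g c - e) \<le> (LINT c:{t..t + h}|lborel. f e c)"
        unfolding set_lebesgue_integral_def
        by (rule norm_integral_le)
           (use int[of t "t + h" e] in \<open>auto simp: set_integrable_def f_def indicator_def\<close>)
    qed
    also have "(LINT c:{t..t + h}|lborel. f e c) = integral {t..t + h} (f e)"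
      by (rule set_borel_integral_eq_integral(2)[OF int])
    finally have "norm e \<le> K + integral {t..t + h} (f e) / h" using h by (simp add: field_simps)
    then show "norm e \<le> K + f e t + \<eta>" using d(2)[OF h(1,3)] by (simp add: abs_less_iff)
  qed
  have le: "norm (g t) \<le> K" if t: "t \<notin> \<Union>(N ` D)" for t
  proof (rule field_le_epsilon)
    fix \<eta> :: real assume "0 < \<eta>"
    then obtain e where e: "e \<in> D" "e \<in> ball (g t) (\<eta> / 2)"
      using D(2)[of "ball (g t) (\<eta> / 2)"] by auto
    have "norm e \<le> K + norm (g t - e)" using close[of t e] t e(1) by (auto simp: f_def)
    moreover have "norm (g t) \<le> norm e + norm (g t - e)" using norm_triangle_ineq[of e "g t - e"] by simp
    moreover have "norm (g t - e) < \<eta> / 2" using e(2) by (simp add: dist_norm)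
    ultimately show "norm (g t) \<le> K + \<eta>" by linarith
  qed
  have "{t. \<not> norm (g t) \<le> K} \<subseteq> \<Union>(N ` D)" using le by blast
  then have "negligible {t. \<not> norm (g t) \<le> K}" using neg negligible_subset by blast
  moreover have "{t. \<not> norm (g t) \<le> K} \<in> sets lborel" by simp
  ultimately have "{t. \<not> norm (g t) \<le> K} \<in> null_sets lborel"
    by (simp add: negligible_iff_null_sets null_sets_completion_iff)
  then show ?thesis by (rule AE_I') auto
qed

text \<open>
  On each axis line the exceptional set is null. Its indicator function, paired with the constant test
  function \<open>1\<close>, has the same integral as its line averages, so it is null on the torus as well.
\<close>

lemma AE_torus_norm_le:
  fixes F :: "'d::finite torus \<Rightarrow> 'e::{banach, second_countable_topology}"
  assumes F [measurable]: "F \<in> borel_measurable borel" and Fb: "bounded (range F)"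
    and line: "\<And>p s. 0 < s \<Longrightarrow> s \<le> 1 \<Longrightarrow> norm (LINT c:{0..s}|lborel. F (p + axis_pt \<mu> c)) \<le> K * s"
  shows "AE p in torus_measure. norm (F p) \<le> K"
proof -
  obtain M where M: "\<And>p. norm (F p) \<le> M" using Fb by (auto simp: bounded_iff)
  define W where "W = {p. \<not> norm (F p) \<le> K}"
  have W [measurable]: "W \<in> sets borel" unfolding W_def by simp
  have "(LINT c:{0..1}|lborel. indicator W (p + axis_pt \<mu> c) :: real) = 0" for p
  proof -
    have "AE c in lborel. norm (F (p + axis_pt \<mu> c)) \<le> K"
    proof (rule AE_norm_le_average)
      show "norm (LINT c:{t..t + s}|lborel. F (p + axis_pt \<mu> c)) \<le> K * s" if "0 < s" "s \<le> 1" for t s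
        using line[OF that, of "p + axis_pt \<mu> t"] set_integral_Icc_shift[of s "\<lambda>c. F (p + axis_pt \<mu> c)" t]
        by (simp add: axis_pt_add add.assoc)
    qed (use M in auto)
    then have "AE c in lborel. indicator {0..1::real} c *\<^sub>R (indicator W (p + axis_pt \<mu> c) :: real) = 0"
      by eventually_elim (simp add: W_def)
    then show ?thesis unfolding set_lebesgue_integral_def by (rule integral_eq_zero_AE)
  qed
  moreover have "(LINT p|torus_measure. 1 *\<^sub>R (LINT c:{0..1}|lborel. indicator W (p + axis_pt \<mu> c) :: real)) =
      (LINT c:{0..1::real}|lborel. LINT p|torus_measure. 1 *\<^sub>R (indicator W p :: real))"
    by (rule integral_line_average[of "\<lambda>_. 1"]) (auto simp: bounded_iff indicator_def intro!: exI[of _ 1])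
  ultimately have "measure torus_measure W = 0" by (simp add: set_lebesgue_integral_def)
  then have "W \<in> null_sets torus_measure"
    by (auto simp: null_sets_def torus_measure.emeasure_eq_measure)
  then show ?thesis by (rule AE_I') (auto simp: W_def)
qed

lemma bdd_form_AE_norm_le:
  assumes A: "A \<in> bdd_forms" and K: "gr_norm 1 (line_int A) \<le> ennreal K" "0 \<le> K"
  shows "AE p in torus_measure. norm (A \<mu> p) \<le> K"
proof (rule AE_torus_norm_le[OF bdd_formsD[OF A]])
  fix p s assume s: "0 < s" "s \<le> (1::real)"
  have "norm (line_int A (seg p \<mu> s)) \<le> K * s"
    using K s by (simp add: gr_norm_le_iff)
  then show "norm (LINT c:{0..s}|lborel. A \<mu> (p + axis_pt \<mu> c)) \<le> K * s"
    using line_int_seg[OF A, of s p \<mu>] s by simp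
qed

text \<open>
  At exponent \<open>1\<close> the seminorm \<^term>\<open>gr_norm\<close> of a bounded form dominates its components in \<open>L\<^sup>\<infinity>\<close>, so
  approximating forms converge almost everywhere, and the limit function gives the distribution.
\<close>

lemma represents_Linf:
  fixes D :: "'d::finite torus set \<Rightarrow> 'e::{banach, second_countable_topology}"
  assumes D: "represents 1 D T" and K: "gr_norm 1 D \<le> ennreal K" "0 \<le> K"
  shows "\<exists>f \<in> borel_measurable borel. Linf_norm f \<le> ennreal K \<and> fun_distr f = T \<mu>"
proof -
  obtain A e where A: "\<And>n. A n \<in> bdd_forms"
      "\<And>n. gr_norm 1 (\<lambda>L. D L - line_int (A n) L) \<le> ennreal (e n)" "\<And>n. 0 \<le> e n" "e \<longlonglongrightarrow> 0"
      "\<And>\<mu> \<phi>. (\<lambda>n. form_distr (A n) \<mu> \<phi>) \<longlonglongrightarrow> T \<mu> \<phi>"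
    using represents_seq[OF D] by blast
  note [measurable] = bdd_formsD(1)[OF A(1)]
  define f where "f p = lim (\<lambda>n. A n \<mu> p)" for p
  have fm [measurable]: "f \<in> borel_measurable borel"
    unfolding f_def by (rule borel_measurable_lim_metric) measurable
  have 1: "AE p in torus_measure. norm (A n \<mu> p) \<le> K + e n" for n
  proof (rule bdd_form_AE_norm_le[OF A(1)])
    have "line_int (A n) = (\<lambda>L. 1 *\<^sub>R D L + (-1) *\<^sub>R (D L - line_int (A n) L))" by simp
    then have "gr_norm 1 (line_int (A n)) \<le>
        ennreal \<bar>1\<bar> * gr_norm 1 D + ennreal \<bar>-1\<bar> * gr_norm 1 (\<lambda>L. D L - line_int (A n) L)"
      using gr_norm_lincomb[of 1 1 D "-1" "\<lambda>L. D L - line_int (A n) L"] by simp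
    also have "\<dots> \<le> ennreal K + ennreal (e n)" using K A(2)[of n] by (simp add: add_mono)
    finally show "gr_norm 1 (line_int (A n)) \<le> ennreal (K + e n)" using K A(3) by simp
  qed (use K A(3) in simp)
  have 2: "AE p in torus_measure. norm (A m \<mu> p - A n \<mu> p) \<le> e m + e n" for m n
  proof -
    define X where "X = (\<lambda>\<mu> p. 1 *\<^sub>R A m \<mu> p + (-1) *\<^sub>R A n \<mu> p)"
    have "AE p in torus_measure. norm (X \<mu> p) \<le> e m + e n"
    proof (rule bdd_form_AE_norm_le)
      show "X \<in> bdd_forms" unfolding X_def using A(1) A(1) by (rule bdd_forms_lincomb)
      have "line_int X = (\<lambda>L. (-1) *\<^sub>R (D L - line_int (A m) L) + 1 *\<^sub>R (D L - line_int (A n) L))"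
        unfolding X_def by (subst line_int_lincomb) (auto simp: A(1))
      then have "gr_norm 1 (line_int X) \<le> ennreal \<bar>-1\<bar> * gr_norm 1 (\<lambda>L. D L - line_int (A m) L) +
          ennreal \<bar>1\<bar> * gr_norm 1 (\<lambda>L. D L - line_int (A n) L)"
        by (simp only: gr_norm_lincomb)
      also have "\<dots> \<le> ennreal (e m) + ennreal (e n)" using A(2)[of m] A(2)[of n] by (simp add: add_mono)
      finally show "gr_norm 1 (line_int X) \<le> ennreal (e m + e n)" using A(3) by simp
    qed (use A(3) in simp)
    then show ?thesis by (simp add: X_def)
  qed
  have lim: "AE p in torus_measure. (\<lambda>n. A n \<mu> p) \<longlonglongrightarrow> f p"
  proof -
    have "AE p in torus_measure. \<forall>m n. norm (A m \<mu> p - A n \<mu> p) \<le> e m + e n"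
      using 2 by (simp add: AE_all_countable)
    then show ?thesis
    proof eventually_elim
      case (elim p)
      have "Cauchy (\<lambda>n. A n \<mu> p)"
      proof (rule CauchyI)
        fix r :: real assume "0 < r"
        then obtain N where N: "\<And>n. n \<ge> N \<Longrightarrow> \<bar>e n\<bar> < r / 2" using LIMSEQ_D[OF A(4), of "r / 2"] by auto
        have "norm (A m \<mu> p - A n \<mu> p) < r" if "m \<ge> N" "n \<ge> N" for m n
          using elim[rule_format, of m n] N[OF that(1)] N[OF that(2)] by linarith
        then show "\<exists>M. \<forall>m\<ge>M. \<forall>n\<ge>M. norm (A m \<mu> p - A n \<mu> p) < r" by blast
      qed
      then show ?case by (simp add: f_def Cauchy_convergent_iff convergent_LIMSEQ_iff)
    qed
  qed
  have "AE p in torus_measure. norm (f p) \<le> K"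
  proof -
    have "AE p in torus_measure. \<forall>n. norm (A n \<mu> p) \<le> K + e n" using 1 by (simp add: AE_all_countable)
    then show ?thesis using lim
    proof eventually_elim
      case (elim p)
      have "(\<lambda>n. K + e n) \<longlonglongrightarrow> K" using tendsto_add[OF tendsto_const[of K] A(4)] by simp
      from LIMSEQ_le[OF tendsto_norm[OF elim(2)] this] elim(1) show ?case by blast
    qed
  qed
  then have "Linf_norm f \<le> ennreal K"
    unfolding Linf_norm_def by (intro esssup_I) (auto intro: ennreal_leI elim: eventually_mono)
  moreover have "fun_distr f \<phi> = T \<mu> \<phi>" for \<phi>
  proof (cases "\<phi> \<in> test_funs")
    case True
    note [measurable] = test_fun_borel[OF True]
    obtain C where C: "\<And>p. \<bar>\<phi> p\<bar> \<le> C" using bounded_test_fun[OF True] by (auto simp: bounded_iff)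
    have C0: "0 \<le> C" using order_trans[OF abs_ge_zero C] .
    obtain E where E: "\<And>n. e n \<le> E"
      using A(4) by (metis convergentI convergent_imp_Bseq Bseq_def abs_le_D1 real_norm_def)
    have "(\<lambda>n. LINT p|torus_measure. \<phi> p *\<^sub>R A n \<mu> p) \<longlonglongrightarrow> (LINT p|torus_measure. \<phi> p *\<^sub>R f p)"
    proof (rule integral_dominated_convergence[where w = "\<lambda>_. C * (K + E)"])
      show "AE p in torus_measure. (\<lambda>n. \<phi> p *\<^sub>R A n \<mu> p) \<longlonglongrightarrow> \<phi> p *\<^sub>R f p"
        using lim by eventually_elim (intro tendsto_intros)
      show "AE p in torus_measure. norm (\<phi> p *\<^sub>R A n \<mu> p) \<le> C * (K + E)" for n
        using 1[of n]
      proof eventually_elim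
        case (elim p)
        then have "norm (A n \<mu> p) \<le> K + E" using E[of n] by linarith
        then show ?case using C[of p] C0 by (auto intro!: mult_mono)
      qed
    qed auto
    then have "(\<lambda>n. form_distr (A n) \<mu> \<phi>) \<longlonglongrightarrow> fun_distr f \<phi>"
      using True by (simp add: form_distr_def fun_distr_def)
    then show ?thesis using A(5) LIMSEQ_unique by blast
  qed (simp add: represents_nontest[OF D] fun_distr_def)
  ultimately show ?thesis using fm by (intro bexI[of _ f]) auto
qed

section \<open>The embedding\<close>

lemma represents_C_norm_bound:
  fixes T :: "'d::finite \<Rightarrow> ('d torus \<Rightarrow> real) \<Rightarrow> 'e::{banach, second_countable_topology}" and K :: real
  assumes D: "represents \<alpha> D T" and K: "gr_norm \<alpha> D \<le> ennreal K" "0 \<le> K" and \<alpha>: "0 < \<alpha>" "\<alpha> \<le> 1"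
  shows "form_C_norm (\<alpha> - 1) T \<le> ennreal (CARD('d) * (2 * K))"
proof -
  have "C_norm (\<alpha> - 1) (T \<mu>) \<le> ennreal (2 * K)" for \<mu>
  proof (cases "\<alpha> < 1")
    case True
    then show ?thesis using represents_besov_bound[OF D K \<alpha>(1)] by (simp add: C_norm_def)
  next
    case False
    then have "\<alpha> = 1" using \<alpha> by simp
    then obtain f where f: "f \<in> borel_measurable borel" "Linf_norm f \<le> ennreal K" "fun_distr f = T \<mu>"
      using represents_Linf[of D T K \<mu>] D K by auto
    have "Linf_norm f < \<infinity>" using f(2) by (rule order_le_less_trans) simp
    then have "C_norm (\<alpha> - 1) (T \<mu>) \<le> Linf_norm f"
      unfolding C_norm_def using f \<open>\<alpha> = 1\<close> by (auto intro!: INF_lower)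
    also have "\<dots> \<le> ennreal (2 * K)" using f(2) K by (auto intro: order_trans ennreal_leI)
    finally show ?thesis .
  qed
  then have "form_C_norm (\<alpha> - 1) T \<le> (\<Sum>\<mu>\<in>(UNIV :: 'd set). ennreal (2 * K))"
    unfolding form_C_norm_def by (intro sum_mono) auto
  also have "\<dots> = ennreal (CARD('d) * (2 * K))"
    using K by (simp add: ennreal_of_nat_eq_real_of_nat ennreal_mult)
  finally show ?thesis .
qed

theorem corollary3p23:
  fixes \<alpha> :: real
  assumes fin_dim: "\<exists>S :: 'e::{banach, second_countable_topology} set. finite S \<and> span S = UNIV"
    and \<alpha>: "0 < \<alpha>" "\<alpha> \<le> 1"
  shows "\<exists>\<Phi> :: ('d::finite torus set \<Rightarrow> 'e) \<Rightarrow> 'd \<Rightarrow> ('d torus \<Rightarrow> real) \<Rightarrow> 'e.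
    (\<forall>A\<in>bdd_forms. alpha_norm \<alpha> (line_int A) < \<infinity> \<longrightarrow> \<Phi> (line_int A) = form_distr A) \<and>
    \<Phi> \<in> Omega1 \<alpha> \<rightarrow> Omega1_C (\<alpha> - 1) \<and>
    (\<forall>A\<in>Omega1 \<alpha>. \<forall>B\<in>Omega1 \<alpha>. \<Phi> (\<lambda>L. A L + B L) = (\<lambda>\<mu> \<phi>. \<Phi> A \<mu> \<phi> + \<Phi> B \<mu> \<phi>)) \<and>
    (\<forall>A\<in>Omega1 \<alpha>. \<forall>c. \<Phi> (\<lambda>L. c *\<^sub>R A L) = (\<lambda>\<mu> \<phi>. c *\<^sub>R \<Phi> A \<mu> \<phi>)) \<and>
    inj_on \<Phi> (Omega1 \<alpha>) \<and>
    (\<forall>A\<in>Omega1 \<alpha>. \<forall>\<epsilon>>0. \<exists>\<delta>>0. \<forall>B\<in>Omega1 \<alpha>.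
       alpha_norm \<alpha> (\<lambda>L. B L - A L) < ennreal \<delta> \<longrightarrow>
       form_C_norm (\<alpha> - 1) (\<lambda>\<mu> \<phi>. \<Phi> B \<mu> \<phi> - \<Phi> A \<mu> \<phi>) < ennreal \<epsilon>)"
proof -
  define \<Phi> :: "('d torus set \<Rightarrow> 'e) \<Rightarrow> 'd \<Rightarrow> ('d torus \<Rightarrow> real) \<Rightarrow> 'e"
    where "\<Phi> D = (SOME T. represents \<alpha> D T)" for D
  have \<Phi>_eq: "\<Phi> D = T" if "represents \<alpha> D T" for D T
    unfolding \<Phi>_def using that represents_unique[OF _ that \<alpha>(1)] by (rule some_equality)
  have \<Phi>: "represents \<alpha> D (\<Phi> D)" if "D \<in> Omega1 \<alpha>" for D
    using ex_represents[OF that \<alpha>(1)] \<Phi>_eq by blast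
  have gr: "\<exists>K\<ge>0. gr_norm \<alpha> B = ennreal K" if "alpha_norm \<alpha> B < \<infinity>" for B :: "'d torus set \<Rightarrow> 'e"
    using order_le_less_trans[OF gr_le_alpha_norm that] by (cases "gr_norm \<alpha> B") auto
  have \<Omega>: "D \<in> Omega_alpha \<alpha>" "alpha_norm \<alpha> D < \<infinity>" if "D \<in> Omega1 \<alpha>" for D :: "'d torus set \<Rightarrow> 'e"
    using that by (auto simp: Omega1_def Omega_alpha_def)
  show ?thesis
  proof (intro exI[of _ \<Phi>] conjI ballI impI allI funcsetI)
    show "\<Phi> (line_int A) = form_distr A" if "A \<in> bdd_forms" for A
      by (rule \<Phi>_eq[OF represents_bdd_form[OF that]])
    show "\<Phi> D \<in> Omega1_C (\<alpha> - 1)" if D: "D \<in> Omega1 \<alpha>" for D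
    proof -
      obtain K where K: "0 \<le> K" "gr_norm \<alpha> D = ennreal K" using gr \<Omega>(2)[OF D] by blast
      have "form_C_norm (\<alpha> - 1) (\<Phi> D) \<le> ennreal (CARD('d) * (2 * K))"
        by (rule represents_C_norm_bound[OF \<Phi>[OF D] _ _ \<alpha>]) (use K in auto)
      then have "form_C_norm (\<alpha> - 1) (\<Phi> D) < \<infinity>" by (rule order_le_less_trans) simp
      then show ?thesis
        using represents_distributions[OF \<Phi>[OF D] _ \<alpha>(1)] K by (simp add: Omega1_C_def)
    qed
    show "\<Phi> (\<lambda>L. A L + B L) = (\<lambda>\<mu> \<phi>. \<Phi> A \<mu> \<phi> + \<Phi> B \<mu> \<phi>)" if "A \<in> Omega1 \<alpha>" "B \<in> Omega1 \<alpha>" for A B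
      using \<Phi>_eq[OF represents_lincomb[OF \<Phi>[OF that(1)] \<Phi>[OF that(2)], of 1 1]] by simp
    show "\<Phi> (\<lambda>L. c *\<^sub>R A L) = (\<lambda>\<mu> \<phi>. c *\<^sub>R \<Phi> A \<mu> \<phi>)" if "A \<in> Omega1 \<alpha>" for A c
      using \<Phi>_eq[OF represents_lincomb[OF \<Phi>[OF that] \<Phi>[OF that], of c 0]] by simp
    show "inj_on \<Phi> (Omega1 \<alpha>)"
    proof (rule inj_onI)
      fix D D' assume D: "D \<in> Omega1 \<alpha>" "D' \<in> Omega1 \<alpha>" and "\<Phi> D = \<Phi> D'"
      then show "D = D'"
        using represents_inj[OF \<Phi>[OF D(1)] \<Omega>(1)[OF D(1)] _ \<Omega>(1)[OF D(2)] \<alpha>(1)] \<Phi>[OF D(2)] by simp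
    qed
    fix A :: "'d torus set \<Rightarrow> 'e" and \<epsilon> :: real assume A: "A \<in> Omega1 \<alpha>" and \<epsilon>: "0 < \<epsilon>"
    define \<delta> where "\<delta> = \<epsilon> / (2 * CARD('d))"
    have \<delta>: "\<delta> > 0" using \<epsilon> by (simp add: \<delta>_def)
    moreover have "form_C_norm (\<alpha> - 1) (\<lambda>\<mu> \<phi>. \<Phi> B \<mu> \<phi> - \<Phi> A \<mu> \<phi>) < ennreal \<epsilon>"
      if B: "B \<in> Omega1 \<alpha>" and lt: "alpha_norm \<alpha> (\<lambda>L. B L - A L) < ennreal \<delta>" for B
    proof -
      have "alpha_norm \<alpha> (\<lambda>L. B L - A L) < \<infinity>" using lt by (rule order_less_trans) simp
      then obtain K where K: "0 \<le> K" "gr_norm \<alpha> (\<lambda>L. B L - A L) = ennreal K" using gr by blast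
      have "ennreal K < ennreal \<delta>"
        using order_le_less_trans[OF gr_le_alpha_norm lt] K by simp
      then have "K < \<delta>" using K by (simp add: ennreal_less_iff)
      then have "CARD('d) * (2 * K) < \<epsilon>" by (simp add: \<delta>_def field_simps)
      moreover have "form_C_norm (\<alpha> - 1) (\<lambda>\<mu> \<phi>. \<Phi> B \<mu> \<phi> - \<Phi> A \<mu> \<phi>) \<le> ennreal (CARD('d) * (2 * K))"
        by (rule represents_C_norm_bound[OF represents_diff[OF \<Phi>[OF B] \<Phi>[OF A]] _ _ \<alpha>]) (use K in auto)
      ultimately show ?thesis using \<epsilon> by (auto intro: order_le_less_trans ennreal_lessI)
    qed
    ultimately show "\<exists>\<delta>>0. \<forall>B\<in>Omega1 \<alpha>. alpha_norm \<alpha> (\<lambda>L. B L - A L) < ennreal \<delta> \<longrightarrow>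
       form_C_norm (\<alpha> - 1) (\<lambda>\<mu> \<phi>. \<Phi> B \<mu> \<phi> - \<Phi> A \<mu> \<phi>) < ennreal \<epsilon>" by blast
  qed
qed

end
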